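(* Let $n\ge1$, $m\in\mathbb{N}$, $\alpha\in(0,\min\{n,2m\})$, and $1<p<p_F:=1+\frac{2m-\alpha}{n}$. Let $u_0\in L^1(\mathbb{R}^n)\cap C_0(\mathbb{R}^n)$ with $\int_{\mathbb{R}^n}u_0(x)\,dx>0$. Then there exists no global-in-time mild solution $u\in C([0,\infty);C_0(\mathbb{R}^n))$ of $$u_t+(-\Delta)^m u=|x|^{-\alpha}|u|^p\ \text{ in }\mathbb{R}^n\times(0,\infty),\qquad u(0)=u_0.$$
   Context: $C_0(\mathbb{R}^n)$ is the space of continuous functions on $\mathbb{R}^n$ vanishing at infinity. A global-in-time mild solution is a function $u\in C([0,\infty);C_0(\mathbb{R}^n))$ with $u(0)=u_0$ such that $u(t)=e^{-t(-\Delta)^m}u_0+\int_0^t e^{-(t-\tau)(-\Delta)^m}|\cdot|^{-\alpha}|u(\tau)|^p\,d\tau$ for every $t>0$, where $e^{-t(-\Delta)^m}$ is convolution with the kernel $g_m(\cdot,t)$, $\widehat{g_m}(\xi,t)=e^{-t|\xi|^{2m}}$. *)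

theory Defs
  imports "HOL-Analysis.Analysis"
begin

text \<open>
  The space of bounded continuous functions carries the supremum norm, so continuity of a curve
  in it is uniform convergence on the whole space.
\<close>

definition C0 :: "((real ^ 'n) \<Rightarrow>\<^sub>C real) set" where
  "C0 = {f. (apply_bcontfun f \<longlongrightarrow> 0) at_infinity}"

text \<open>
  Inverse of the Fourier transform with the convention
  \<open>f\<^sup>^(\<xi>) = \<integral> exp (- i x \<cdot> \<xi>) f(x) dx\<close>, the one for which convolution with \<open>g\<close>
  is the Fourier multiplier \<open>g\<^sup>^\<close> (no extra constant) and \<open>-\<Delta>\<close> has symbol \<open>|\<xi>|\<^sup>2\<close>.
\<close>

definition inverse_fourier :: "(real ^ 'n \<Rightarrow> complex) \<Rightarrow> real ^ 'n \<Rightarrow> complex" where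
  "inverse_fourier h x =
     (LINT \<xi>|lborel. exp (\<i> * complex_of_real (x \<bullet> \<xi>)) * h \<xi>) / (2 * pi) ^ CARD('n)"

text \<open>
  The kernel whose Fourier transform is \<open>exp (- t |\<xi>|\<^sup>2\<^sup>m)\<close>, for \<open>t > 0\<close>. The inverse transform of
  this even real function is real, so \<open>Re\<close> only changes the type.
\<close>

definition polyharmonic_kernel :: "nat \<Rightarrow> real \<Rightarrow> real ^ 'n \<Rightarrow> real" where
  "polyharmonic_kernel m t x =
     Re (inverse_fourier (\<lambda>\<xi>. complex_of_real (exp (- t * norm \<xi> ^ (2 * m)))) x)"

definition polyharmonic_semigroup ::
    "nat \<Rightarrow> real \<Rightarrow> (real ^ 'n \<Rightarrow> real) \<Rightarrow> real ^ 'n \<Rightarrow> real" where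
  "polyharmonic_semigroup m t f x =
     (LINT y|lborel. polyharmonic_kernel m t (x - y) * f y)"

text \<open>
  The Duhamel formula is an identity in \<open>C0\<close>; it is stated at every point \<open>x\<close>, which is the same
  thing because point evaluations are continuous linear functionals separating points.
  At \<open>y = 0\<close> the weight \<open>|y| powr (- \<alpha>)\<close> has the value \<open>0\<close>, on a null set.
\<close>

definition global_mild_solution ::
    "nat \<Rightarrow> real \<Rightarrow> real \<Rightarrow> ((real ^ 'n) \<Rightarrow>\<^sub>C real) \<Rightarrow> (real \<Rightarrow> (real ^ 'n) \<Rightarrow>\<^sub>C real) \<Rightarrow> bool" where
  "global_mild_solution m \<alpha> p u0 u \<longleftrightarrow>
     (\<forall>t\<ge>0. u t \<in> C0) \<and> continuous_on {0..} u \<and> u 0 = u0 \<and>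
     (\<forall>t>0. \<forall>x. apply_bcontfun (u t) x =
        polyharmonic_semigroup m t (apply_bcontfun u0) x +
        (LINT \<tau>:{0<..<t}|lborel. polyharmonic_semigroup m (t - \<tau>)
           (\<lambda>y. norm y powr (- \<alpha>) * \<bar>apply_bcontfun (u \<tau>) y\<bar> powr p) x))"

end

theory Submission
  imports Defs "HOL-Probability.Characteristic_Functions" "HOL-Probability.Sinc_Integral"
begin

text \<open>
  The argument is the test function method. Write \<open>S(t)\<close> for the semigroup and \<open>L = (-\<Delta>)\<^sup>m\<close>.
  Pairing a global solution on \<open>(0,T)\<close> with \<open>\<eta>(t) \<psi>(x)\<close>, where \<open>\<eta>(0) = 1\<close> and \<open>\<eta>(T) = 0\<close>, gives
  \<open>\<integral>\<integral> |x|\<^sup>-\<^sup>\<alpha> |u|\<^sup>p \<eta> \<psi> + \<integral> u\<^sub>0 \<psi> = \<integral>\<integral> u (\<eta> L\<psi> - \<eta>' \<psi>)\<close>.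
  Young's inequality absorbs the right-hand side into the nonlinear term, up to an error that does
  not involve \<open>u\<close>. With \<open>\<psi>(x) = exp (- |x|\<^sup>2 / (2 R\<^sup>2))\<close> and \<open>T = R\<^sup>2\<^sup>m\<close> the error scales like \<open>R\<close> to the
  power \<open>n - (2m - \<alpha>)/(p - 1)\<close>, and this exponent is negative exactly when \<open>p < 1 + (2m - \<alpha>)/n\<close>.
  Letting \<open>R\<close> tend to infinity yields \<open>\<integral> u\<^sub>0 \<le> 0\<close>, a contradiction.

  A Gaussian does not satisfy \<open>|L\<psi>| \<le> C \<psi>\<close>, but \<open>L\<psi>\<close> is a polynomial times \<open>\<psi>\<close>, and this suffices because
  Young's inequality only asks that \<open>|L\<psi>|\<^sup>p\<^sup>' \<psi>\<^sup>1\<^sup>-\<^sup>p\<^sup>'\<close>, with \<open>p' = p/(p - 1)\<close> and a power weight, be integrable. In return all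
  Fourier transforms are explicit, so that no general inversion theorem is needed.

  The tested identity has to be extracted from the Duhamel formula, whose kernel changes sign if
  \<open>m \<ge> 2\<close> and is given only as a Fourier integral. Two facts carry this step. First, the
  \<open>L\<^sup>1\<close> norm of the kernel is finite and independent of time (\<open>polyharmonic_kernel_nn_integral\<close>); this
  makes one Fubini exchange between the points \<open>(s,x)\<close> and \<open>(\<tau>,y)\<close> of space-time legitimate. Second, the
  test function solves the backward equation in the integrated form
  \<open>\<integral>\<^sub>\<tau>\<^sup>T S(s-\<tau>) (\<eta>(s) L\<psi> - \<eta>'(s) \<psi>) ds = \<eta>(\<tau>) \<psi>\<close> (\<open>backward_evolution\<close>), since on the Fourier side the
  integrand is the time derivative of \<open>- \<eta>(s) exp (- (s-\<tau>) |\<xi>|\<^sup>2\<^sup>m)\<close>. Together they give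
  \<open>mild_solution_tested\<close>.
\<close>

section \<open>Integrability on Euclidean space\<close>

lemma lborel_integrable_prod:
  fixes f :: "'a::euclidean_space \<Rightarrow> real \<Rightarrow> 'b::{real_normed_field,banach,second_countable_topology}"
  assumes "\<And>b. b \<in> Basis \<Longrightarrow> integrable lborel (f b)"
  shows "integrable lborel (\<lambda>x. \<Prod>b\<in>Basis. f b (x \<bullet> b))"
    and "(\<integral>x. (\<Prod>b\<in>Basis. f b (x \<bullet> b)) \<partial>lborel) = (\<Prod>b\<in>Basis. (LINT t|lborel. f b t))"
proof -
  interpret product_sigma_finite "\<lambda>_::'a. lborel :: real measure" ..
  have [measurable]: "f b \<in> borel_measurable borel" if "b \<in> Basis" for b
    using borel_measurable_integrable[OF assms[OF that]] by simp
  have *: "(\<Prod>b\<in>Basis. f b ((\<Sum>a\<in>Basis. y a *\<^sub>R a) \<bullet> b)) = (\<Prod>b\<in>Basis. f b (y b))" for y :: "'a \<Rightarrow> real"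
    by (intro prod.cong) auto
  have m: "(\<lambda>x::'a. \<Prod>b\<in>Basis. f b (x \<bullet> b)) \<in> borel_measurable borel"
    by measurable
  have m2: "(\<lambda>y. \<Sum>b\<in>Basis. y b *\<^sub>R b) \<in> measurable (Pi\<^sub>M (Basis::'a set) (\<lambda>_. lborel)) borel"
    by measurable
  show "integrable lborel (\<lambda>x. \<Prod>b\<in>Basis. f b (x \<bullet> b))"
    unfolding lborel_eq[where 'a='a]
    by (subst integrable_distr_eq[OF m2 m]) (simp only: *, intro product_integrable_prod assms, auto)
  show "(\<integral>x. (\<Prod>b\<in>Basis. f b (x \<bullet> b)) \<partial>lborel) = (\<Prod>b\<in>Basis. (LINT t|lborel. f b t))"
    unfolding lborel_eq[where 'a='a]
    by (subst integral_distr[OF m2 m])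
      (simp only: *, subst product_integral_prod, auto intro: assms)
qed

lemma lborel_affine_integrable_iff:
  fixes f :: "'a::euclidean_space \<Rightarrow> 'b::{banach,second_countable_topology}"
  assumes "c \<noteq> 0" and [measurable]: "f \<in> borel_measurable borel"
  shows "integrable lborel (\<lambda>x. f (t + c *\<^sub>R x)) \<longleftrightarrow> integrable lborel f"
proof -
  have "integrable lborel f \<longleftrightarrow> integrable (density (distr lborel borel (\<lambda>x. t + c *\<^sub>R x)) (\<lambda>_. ennreal (\<bar>c\<bar>^DIM('a)))) f"
    using lborel_affine[OF assms(1), of t] by simp
  also have "\<dots> \<longleftrightarrow> integrable lborel (\<lambda>x. \<bar>c\<bar>^DIM('a) *\<^sub>R f (t + c *\<^sub>R x))"
    using assms(1) by (subst integrable_density) (auto simp: integrable_distr_eq)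
  also have "\<dots> \<longleftrightarrow> integrable lborel (\<lambda>x. f (t + c *\<^sub>R x))"
  proof
    assume "integrable lborel (\<lambda>x. \<bar>c\<bar>^DIM('a) *\<^sub>R f (t + c *\<^sub>R x))"
    then have "integrable lborel (\<lambda>x. inverse (\<bar>c\<bar>^DIM('a)) *\<^sub>R (\<bar>c\<bar>^DIM('a) *\<^sub>R f (t + c *\<^sub>R x)))"
      by - (rule integrable_scaleR_right)
    moreover have "inverse (\<bar>c\<bar>^DIM('a)) *\<^sub>R (\<bar>c\<bar>^DIM('a) *\<^sub>R z) = z" for z :: 'b
      using assms(1) by simp
    ultimately show "integrable lborel (\<lambda>x. f (t + c *\<^sub>R x))"
      by (simp only:)
  qed auto
  finally show ?thesis by simp
qed

lemma lborel_affine_integral: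
  fixes f :: "'a::euclidean_space \<Rightarrow> 'b::{banach,second_countable_topology}"
  assumes "c \<noteq> 0" and [measurable]: "f \<in> borel_measurable borel"
  shows "(LINT x|lborel. f x) = \<bar>c\<bar>^DIM('a) *\<^sub>R (LINT x|lborel. f (t + c *\<^sub>R x))"
proof -
  have "(LINT x|lborel. f x) = (LINT x|density (distr lborel borel (\<lambda>x. t + c *\<^sub>R x)) (\<lambda>_. ennreal (\<bar>c\<bar>^DIM('a))). f x)"
    using lborel_affine[OF assms(1), of t] by simp
  also have "\<dots> = \<bar>c\<bar>^DIM('a) *\<^sub>R (LINT x|lborel. f (t + c *\<^sub>R x))"
    using assms(1) by (subst integral_density) (auto simp: integral_distr)
  finally show ?thesis .
qed

lemma lborel_affine_nn_integral:
  fixes f :: "'a::euclidean_space \<Rightarrow> ennreal"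
  assumes "c \<noteq> 0" and [measurable]: "f \<in> borel_measurable borel"
  shows "(\<integral>\<^sup>+x. f x \<partial>lborel) = ennreal (\<bar>c\<bar>^DIM('a)) * (\<integral>\<^sup>+x. f (t + c *\<^sub>R x) \<partial>lborel)"
proof -
  have "(\<integral>\<^sup>+x. f x \<partial>lborel) = (\<integral>\<^sup>+x. f x \<partial>density (distr lborel borel (\<lambda>x. t + c *\<^sub>R x)) (\<lambda>_. ennreal (\<bar>c\<bar>^DIM('a))))"
    using lborel_affine[OF assms(1), of t] by simp
  also have "\<dots> = ennreal (\<bar>c\<bar>^DIM('a)) * (\<integral>\<^sup>+x. f (t + c *\<^sub>R x) \<partial>lborel)"
    using assms(1) by (subst nn_integral_density) (auto simp: nn_integral_distr nn_integral_cmult)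
  finally show ?thesis .
qed

text \<open>
  A common integrable majorant. It is dominated by the product of the functions \<open>1 / (1 + x\<^sub>i\<^sup>2)\<close>, so its
  integrability reduces to one dimension; Gaussians, their products with polynomials and the
  polyharmonic kernel at a fixed time are all bounded by multiples of it.
\<close>

definition decay :: "'a::euclidean_space \<Rightarrow> real" where
  "decay x = inverse ((1 + (norm x)\<^sup>2) ^ DIM('a))"

lemma decay_pos: "0 < decay x"
  unfolding decay_def by (simp add: add_pos_nonneg)

lemma decay_le_1: "decay x \<le> 1"
  unfolding decay_def by (simp add: inverse_le_1_iff)

lemma decay_measurable [measurable]: "decay \<in> borel_measurable borel"
  unfolding decay_def by measurable

lemma decay_integrable: "integrable lborel (decay :: 'a::euclidean_space \<Rightarrow> real)"
proof (rule Bochner_Integration.integrable_bound)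
  have "integrable lborel (\<lambda>x::real. inverse (1 + x\<^sup>2))"
    using integrable_inverse_1_plus_square by (simp add: set_integrable_def einterval_def)
  then show "integrable lborel (\<lambda>x::'a. \<Prod>b\<in>Basis. inverse (1 + (x \<bullet> b)\<^sup>2))"
    by (rule lborel_integrable_prod(1))
  show "AE x in lborel. norm (decay x) \<le> norm (\<Prod>b\<in>Basis. inverse (1 + ((x::'a) \<bullet> b)\<^sup>2))"
  proof (rule AE_I2)
    fix x :: 'a
    have "(\<Prod>b\<in>Basis. 1 + (x \<bullet> b)\<^sup>2) \<le> (\<Prod>b\<in>(Basis::'a set). 1 + (norm x)\<^sup>2)"
      by (intro prod_mono conjI add_mono) (auto simp: abs_le_square_iff[symmetric] Basis_le_norm)
    moreover have "(\<Prod>b\<in>Basis. 1 + (x \<bullet> b)\<^sup>2) > 0"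
      by (intro prod_pos) (auto simp: add_pos_nonneg)
    ultimately have "decay x \<le> inverse (\<Prod>b\<in>Basis. 1 + (x \<bullet> b)\<^sup>2)"
      unfolding decay_def by (simp add: le_imp_inverse_le)
    then show "norm (decay x) \<le> norm (\<Prod>b\<in>Basis. inverse (1 + (x \<bullet> b)\<^sup>2))"
      using decay_pos[of x] prod_inversef[of "\<lambda>b. 1 + (x \<bullet> b)\<^sup>2" Basis, symmetric] by (simp add: o_def)
  qed
qed (simp add: decay_measurable)

lemma integrable_powr_unit_interval:
  assumes "\<beta> < 1"
  shows "integrable lborel (\<lambda>t::real. indicator {-1..1} t * \<bar>t\<bar> powr (-\<beta>))"
proof -
  let ?g = "\<lambda>t::real. indicator {0..1} t * t powr (-\<beta>)"
  have "(\<lambda>x. x powr (-\<beta>)) absolutely_integrable_on {0..1}"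
    using assms by (intro nonnegative_absolutely_integrable_1 integrable_on_powr_from_0) auto
  then have g: "integrable lborel ?g"
    by (simp add: set_integrable_def integrable_completion)
  then have "integrable lborel (\<lambda>t. ?g (0 + (-1) * t))"
    by (rule lborel_integrable_real_affine) simp
  with g have "integrable lborel (\<lambda>t. ?g t + ?g (0 + (-1) * t))"
    by (rule Bochner_Integration.integrable_add)
  also have "(\<lambda>t. ?g t + ?g (0 + (-1) * t)) = (\<lambda>t::real. indicator {-1..1} t * \<bar>t\<bar> powr (-\<beta>))"
    by (auto simp: fun_eq_iff indicator_def)
  finally show ?thesis .
qed

text \<open>
  Since \<open>|x\<^sub>i| \<le> |x|\<close>, the singularity \<open>|x|\<^sup>-\<^sup>\<alpha>\<close> is at most the product of the one-dimensional
  singularities \<open>|x\<^sub>i|\<^sup>-\<^sup>\<alpha>\<^sup>/\<^sup>n\<close>, each of which is integrable near \<open>0\<close> because \<open>\<alpha> < n\<close>.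
\<close>

lemma integrable_norm_powr_unit_ball:
  fixes \<alpha> :: real
  assumes "0 < \<alpha>" "\<alpha> < DIM('a)"
  shows "integrable lborel (\<lambda>x::'a::euclidean_space. indicator (cball 0 1) x * norm x powr (-\<alpha>))"
proof (rule Bochner_Integration.integrable_bound)
  define \<beta> where "\<beta> = \<alpha> / DIM('a)"
  have "\<beta> < 1" using assms by (simp add: \<beta>_def)
  then show "integrable lborel (\<lambda>x::'a. \<Prod>b\<in>Basis. indicator {-1..1} (x \<bullet> b) * \<bar>x \<bullet> b\<bar> powr (-\<beta>))"
    by (intro lborel_integrable_prod(1) integrable_powr_unit_interval)
  have "AE x in lborel. \<forall>b\<in>(Basis::'a set). x \<bullet> b \<noteq> 0"
  proof (subst AE_finite_all)
    show "\<forall>b\<in>(Basis::'a set). AE x in lborel. x \<bullet> b \<noteq> 0"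
    proof
      fix b :: 'a assume b: "b \<in> Basis"
      then have "negligible {x. b \<bullet> x = 0}" by (intro negligible_hyperplane) auto
      then have "{x. b \<bullet> x = 0} \<in> null_sets lebesgue" by (simp add: negligible_iff_null_sets)
      then have "{x. b \<bullet> x = 0} \<in> null_sets lborel"
        by (subst (asm) null_sets_completion_iff) auto
      then show "AE x in lborel. x \<bullet> b \<noteq> 0" by (rule AE_I') (auto simp: inner_commute)
    qed
  qed auto
  then show "AE x in lborel. norm (indicator (cball 0 1) x * norm x powr (-\<alpha>))
     \<le> norm (\<Prod>b\<in>Basis. indicator {-1..1} ((x::'a) \<bullet> b) * \<bar>x \<bullet> b\<bar> powr (-\<beta>))"
  proof eventually_elim
    case (elim x)
    from elim SOME_Basis have x0: "x \<noteq> 0" by (metis inner_zero_left)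
    show ?case
    proof (cases "norm x \<le> 1")
      case True
      have 1: "\<bar>x \<bullet> b\<bar> \<le> 1" if "b \<in> Basis" for b
        using Basis_le_norm[OF that, of x] True by linarith
      have "norm x powr (-\<alpha>) = (norm x powr (-\<beta>)) ^ DIM('a)"
        using x0 by (simp add: powr_power \<beta>_def)
      also have "\<dots> = (\<Prod>b\<in>(Basis::'a set). norm x powr (-\<beta>))" by simp
      also have "\<dots> \<le> (\<Prod>b\<in>Basis. \<bar>x \<bullet> b\<bar> powr (-\<beta>))"
        using elim assms by (intro prod_mono conjI powr_mono2') (auto simp: \<beta>_def Basis_le_norm)
      also have "\<dots> = (\<Prod>b\<in>Basis. indicator {-1..1} (x \<bullet> b) * \<bar>x \<bullet> b\<bar> powr (-\<beta>))"
        using 1 by (intro prod.cong) (auto simp: abs_le_iff)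
      finally show ?thesis using True by simp
    qed simp
  qed
qed (auto intro!: borel_measurable_times borel_measurable_indicator powr_real_measurable)

section \<open>Gaussians and their polyharmonic images\<close>

text \<open>
  Differentiation under the integral sign; the mean value theorem bounds the difference quotients by
  the integrable majorant of the derivative.
\<close>

lemma DERIV_integral_param:
  fixes f f' :: "real \<Rightarrow> 'a \<Rightarrow> real"
  assumes t0: "a < t0" "t0 < b"
    and int: "\<And>t. a < t \<Longrightarrow> t < b \<Longrightarrow> integrable M (f t)"
    and der: "\<And>t x. a < t \<Longrightarrow> t < b \<Longrightarrow> ((\<lambda>t. f t x) has_real_derivative f' t x) (at t)"
    and bound: "\<And>t x. a < t \<Longrightarrow> t < b \<Longrightarrow> \<bar>f' t x\<bar> \<le> w x"
    and w: "integrable M w" and meas: "f' t0 \<in> borel_measurable M"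
  shows "((\<lambda>t. \<integral>x. f t x \<partial>M) has_real_derivative (\<integral>x. f' t0 x \<partial>M)) (at t0)"
proof -
  have "((\<lambda>t. ((\<integral>x. f t x \<partial>M) - (\<integral>x. f t0 x \<partial>M)) / (t - t0)) \<longlongrightarrow> (\<integral>x. f' t0 x \<partial>M))
      (at t0 within {a<..<b})"
    unfolding tendsto_at_iff_sequentially
  proof (intro allI impI)
    fix X :: "nat \<Rightarrow> real"
    assume X: "\<forall>i. X i \<in> {a<..<b} - {t0}" and lim: "X \<longlonglongrightarrow> t0"
    have "(\<lambda>i. \<integral>x. (f (X i) x - f t0 x) / (X i - t0) \<partial>M) \<longlonglongrightarrow> (\<integral>x. f' t0 x \<partial>M)"
    proof (rule integral_dominated_convergence[where w=w])
      show "(\<lambda>x. (f (X i) x - f t0 x) / (X i - t0)) \<in> borel_measurable M" for i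
        using X t0 int[of "X i"] int[of t0] by auto
      show "AE x in M. norm ((f (X i) x - f t0 x) / (X i - t0)) \<le> w x" for i
      proof (rule AE_I2)
        fix x
        have "norm (f (X i) x - f t0 x) \<le> w x * norm (X i - t0)"
          using X t0 by (intro field_differentiable_bound[of "{a<..<b}" "\<lambda>t. f t x" "\<lambda>t. f' t x"])
            (auto intro!: DERIV_subset[OF der] bound)
        then show "norm ((f (X i) x - f t0 x) / (X i - t0)) \<le> w x"
          using X by (simp add: norm_divide divide_le_eq)
      qed
      show "AE x in M. (\<lambda>i. (f (X i) x - f t0 x) / (X i - t0)) \<longlonglongrightarrow> f' t0 x"
      proof (rule AE_I2)
        fix x
        have "((\<lambda>t. (f t x - f t0 x) / (t - t0)) \<longlongrightarrow> f' t0 x) (at t0 within {a<..<b})"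
          using DERIV_subset[OF der[OF t0], of "{a<..<b}" x] by (simp add: has_field_derivative_iff)
        then show "(\<lambda>i. (f (X i) x - f t0 x) / (X i - t0)) \<longlonglongrightarrow> f' t0 x"
          using X lim unfolding tendsto_at_iff_sequentially by (auto simp: o_def)
      qed
    qed (use w meas in auto)
    moreover have "(\<integral>x. (f (X i) x - f t0 x) / (X i - t0) \<partial>M)
        = ((\<integral>x. f (X i) x \<partial>M) - (\<integral>x. f t0 x \<partial>M)) / (X i - t0)" for i
      using X t0 int[of "X i"] int[of t0] by (auto simp: Bochner_Integration.integral_diff)
    ultimately show "((\<lambda>t. ((\<integral>x. f t x \<partial>M) - (\<integral>x. f t0 x \<partial>M)) / (t - t0)) \<circ> X)
        \<longlonglongrightarrow> (\<integral>x. f' t0 x \<partial>M)"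
      by (simp only: o_def)
  qed
  moreover have "at t0 within {a<..<b} = at t0"
    using t0 by (intro at_within_open) auto
  ultimately show ?thesis by (simp add: has_field_derivative_iff)
qed

text \<open>
  Polynomial functions of two real variables. Only closure under differentiation in the first variable
  and polynomial growth are used, and both follow by rule induction; this is lighter than carrying a
  representation by coefficients.
\<close>

inductive polyfun :: "(real \<Rightarrow> real \<Rightarrow> real) \<Rightarrow> bool" where
  const: "polyfun (\<lambda>s r. c)"
| fst: "polyfun (\<lambda>s r. s)"
| snd: "polyfun (\<lambda>s r. r)"
| add: "polyfun P \<Longrightarrow> polyfun Q \<Longrightarrow> polyfun (\<lambda>s r. P s r + Q s r)"
| mult: "polyfun P \<Longrightarrow> polyfun Q \<Longrightarrow> polyfun (\<lambda>s r. P s r * Q s r)"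

lemma polyfun_diff: "polyfun P \<Longrightarrow> polyfun Q \<Longrightarrow> polyfun (\<lambda>s r. P s r - Q s r)"
  using polyfun.add[of P, OF _ polyfun.mult[OF polyfun.const[of "-1"]]] by fastforce

lemma polyfun_power: "polyfun P \<Longrightarrow> polyfun (\<lambda>s r. P s r ^ k)"
  by (induction k) (auto intro: polyfun.intros)

lemma polyfun_deriv:
  "polyfun P \<Longrightarrow> \<exists>P'. polyfun P' \<and> (\<forall>s r. ((\<lambda>s. P s r) has_real_derivative P' s r) (at s))"
proof (induction rule: polyfun.induct)
  case (const c)
  show ?case by (rule exI[of _ "\<lambda>s r. 0"]) (auto intro: polyfun.intros)
next
  case fst
  show ?case by (rule exI[of _ "\<lambda>s r. 1"]) (auto intro: polyfun.intros)
next
  case snd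
  show ?case by (rule exI[of _ "\<lambda>s r. 0"]) (auto intro: polyfun.intros)
next
  case (add P Q)
  then obtain P' Q' where "polyfun P'" "polyfun Q'"
    "\<And>s r. ((\<lambda>s. P s r) has_real_derivative P' s r) (at s)"
    "\<And>s r. ((\<lambda>s. Q s r) has_real_derivative Q' s r) (at s)" by blast
  then show ?case
    by (intro exI[of _ "\<lambda>s r. P' s r + Q' s r"]) (auto intro: polyfun.intros DERIV_add)
next
  case (mult P Q)
  then obtain P' Q' where *: "polyfun P'" "polyfun Q'"
    "\<And>s r. ((\<lambda>s. P s r) has_real_derivative P' s r) (at s)"
    "\<And>s r. ((\<lambda>s. Q s r) has_real_derivative Q' s r) (at s)" by blast
  with mult.hyps show ?case
    by (intro exI[of _ "\<lambda>s r. P' s r * Q s r + Q' s r * P s r"]) (auto intro: polyfun.intros DERIV_mult)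
qed

lemma polyfun_bound:
  "polyfun P \<Longrightarrow> \<exists>C N. 0 \<le> C \<and> (\<forall>s r. \<bar>P s r\<bar> \<le> C * (1 + \<bar>s\<bar> + \<bar>r\<bar>) ^ N)"
proof (induction rule: polyfun.induct)
  case (const c)
  show ?case by (rule exI[of _ "\<bar>c\<bar>"], rule exI[of _ 0]) auto
next
  case fst
  show ?case by (rule exI[of _ 1], rule exI[of _ 1]) auto
next
  case snd
  show ?case by (rule exI[of _ 1], rule exI[of _ 1]) auto
next
  case (add P Q)
  then obtain C N D K where *: "0 \<le> C" "0 \<le> D"
    "\<And>s r. \<bar>P s r\<bar> \<le> C * (1 + \<bar>s\<bar> + \<bar>r\<bar>) ^ N" "\<And>s r. \<bar>Q s r\<bar> \<le> D * (1 + \<bar>s\<bar> + \<bar>r\<bar>) ^ K" by blast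
  have "\<bar>P s r + Q s r\<bar> \<le> (C + D) * (1 + \<bar>s\<bar> + \<bar>r\<bar>) ^ (N + K)" for s r
  proof -
    have "C * (1 + \<bar>s\<bar> + \<bar>r\<bar>) ^ N \<le> C * (1 + \<bar>s\<bar> + \<bar>r\<bar>) ^ (N + K)"
      using *(1) by (intro mult_left_mono power_increasing) auto
    moreover have "D * (1 + \<bar>s\<bar> + \<bar>r\<bar>) ^ K \<le> D * (1 + \<bar>s\<bar> + \<bar>r\<bar>) ^ (N + K)"
      using *(2) by (intro mult_left_mono power_increasing) auto
    ultimately show ?thesis using *(3,4)[of s r] abs_triangle_ineq[of "P s r" "Q s r"]
      unfolding distrib_right by linarith
  qed
  then show ?case using * by (intro exI[of _ "C + D"] exI[of _ "N + K"]) auto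
next
  case (mult P Q)
  then obtain C N D K where *: "0 \<le> C" "0 \<le> D"
    "\<And>s r. \<bar>P s r\<bar> \<le> C * (1 + \<bar>s\<bar> + \<bar>r\<bar>) ^ N" "\<And>s r. \<bar>Q s r\<bar> \<le> D * (1 + \<bar>s\<bar> + \<bar>r\<bar>) ^ K" by blast
  have "\<bar>P s r * Q s r\<bar> \<le> (C * D) * (1 + \<bar>s\<bar> + \<bar>r\<bar>) ^ (N + K)" for s r
    using mult_mono[OF *(3)[of s r] *(4)[of s r]] * by (simp add: abs_mult power_add mult_ac)
  then show ?case using * by (intro exI[of _ "C * D"] exI[of _ "N + K"]) auto
qed

lemma polyfun_measurable:
  "polyfun P \<Longrightarrow> f \<in> borel_measurable M \<Longrightarrow> g \<in> borel_measurable M \<Longrightarrow>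
     (\<lambda>x. P (f x) (g x)) \<in> borel_measurable M"
  by (induction rule: polyfun.induct) auto

lemma power_times_exp_bounded:
  assumes "c > (0::real)"
  shows "\<exists>C\<ge>0. \<forall>r\<ge>0. (1 + r) ^ k * exp (- c * r) \<le> C"
proof (intro exI[of _ "fact k / c ^ k * exp c"] conjI allI impI)
  fix r :: real assume r: "0 \<le> r"
  define y where "y = c * (1 + r)"
  have "y \<ge> 0" using r assms by (simp add: y_def)
  have "sum (\<lambda>n. y ^ n /\<^sub>R fact n) {k} \<le> (\<Sum>n. y ^ n /\<^sub>R fact n)"
    using \<open>y \<ge> 0\<close> by (intro sum_le_suminf summable_exp_generic) auto
  then have "y ^ k \<le> fact k * exp y"
    by (simp add: exp_def field_simps)
  then have "c ^ k * (1 + r) ^ k \<le> fact k * exp (c * (1 + r))"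
    by (simp only: y_def power_mult_distrib)
  then have "(1 + r) ^ k \<le> fact k / c ^ k * exp (c * (1 + r))"
    using assms by (simp add: pos_le_divide_eq mult.commute)
  then have "(1 + r) ^ k * exp (- c * r) \<le> fact k / c ^ k * exp (c * (1 + r)) * exp (- c * r)"
    by (intro mult_right_mono) auto
  also have "\<dots> = fact k / c ^ k * exp c"
    by (simp add: mult.assoc exp_add[symmetric] algebra_simps)
  finally show "(1 + r) ^ k * exp (- c * r) \<le> fact k / c ^ k * exp c" .
qed (use assms in auto)

lemma gaussian_le_decay:
  assumes "c > (0::real)"
  shows "\<exists>C\<ge>0. \<forall>x::'a::euclidean_space. (1 + (norm x)\<^sup>2) ^ k * exp (- c * (norm x)\<^sup>2) \<le> C * decay x"
proof -
  obtain C where C: "C \<ge> 0" "\<And>r. r \<ge> 0 \<Longrightarrow> (1 + r) ^ (k + DIM('a)) * exp (- c * r) \<le> C"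
    using power_times_exp_bounded[OF assms, of "k + DIM('a)"] by blast
  have "(1 + (norm x)\<^sup>2) ^ k * exp (- c * (norm x)\<^sup>2) \<le> C * decay x" for x :: 'a
  proof -
    have "(1 + (norm x)\<^sup>2) ^ k * exp (- c * (norm x)\<^sup>2)
       = ((1 + (norm x)\<^sup>2) ^ (k + DIM('a)) * exp (- c * (norm x)\<^sup>2)) * decay x"
      unfolding decay_def power_add using add_pos_nonneg[OF zero_less_one zero_le_power2[of "norm x"]] by simp
    also have "\<dots> \<le> C * decay x"
      using C(2)[of "(norm x)\<^sup>2"] decay_pos[of x] by (intro mult_right_mono) auto
    finally show ?thesis .
  qed
  with C(1) show ?thesis by blast
qed

text \<open>
  The characteristic function of the standard normal distribution, rescaled.
\<close>

lemma gaussian_fourier_1d: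
  fixes t \<tau> :: real
  assumes "\<tau> > 0"
  shows "integrable lborel (\<lambda>x. exp (\<i> * of_real (t * x)) * of_real (exp (- \<tau> * x\<^sup>2 / 2)) :: complex)"
    and "(\<integral>x. exp (\<i> * of_real (t * x)) * of_real (exp (- \<tau> * x\<^sup>2 / 2)) \<partial>lborel)
      = (of_real (sqrt (2 * pi / \<tau>) * exp (- t\<^sup>2 / (2 * \<tau>))) :: complex)"
proof -
  let ?f = "\<lambda>t x::real. exp (\<i> * of_real (t * x)) * of_real (exp (- x\<^sup>2 / 2)) :: complex"
  have i: "integrable lborel (?f t)" for t
  proof (rule Bochner_Integration.integrable_bound)
    show "integrable lborel (\<lambda>x. sqrt (2 * pi) * std_normal_density x)"
      by (intro integrable_mult_right integrable_normal_density) auto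
  qed (auto simp: normal_density_def norm_mult norm_exp_i_times)
  have e: "integral\<^sup>L lborel (?f t) = of_real (sqrt (2 * pi) * exp (- t\<^sup>2 / 2))" for t
  proof -
    have "complex_of_real (exp (- t\<^sup>2 / 2)) = char std_normal_distribution t"
      by (simp add: char_std_normal_distribution)
    also have "\<dots> = (\<integral>x. std_normal_density x *\<^sub>R exp (\<i> * of_real (t * x)) \<partial>lborel)"
      unfolding char_def by (subst integral_density) (auto simp: normal_density_nonneg)
    also have "\<dots> = (\<integral>x. of_real (1 / sqrt (2 * pi)) * ?f t x \<partial>lborel)"
      by (intro Bochner_Integration.integral_cong) (auto simp: std_normal_density_def scaleR_conv_of_real)
    also have "\<dots> = of_real (1 / sqrt (2 * pi)) * integral\<^sup>L lborel (?f t)"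
      by simp
    finally show ?thesis by (simp add: field_simps)
  qed
  let ?s = "sqrt \<tau>"
  have s: "?s > 0" "?s\<^sup>2 = \<tau>" using assms by auto
  have eq: "?f (t / ?s) (0 + ?s * x) = exp (\<i> * of_real (t * x)) * of_real (exp (- \<tau> * x\<^sup>2 / 2))" for x
    using s by (simp add: power_mult_distrib)
  show "integrable lborel (\<lambda>x. exp (\<i> * of_real (t * x)) * of_real (exp (- \<tau> * x\<^sup>2 / 2)) :: complex)"
    using lborel_integrable_real_affine[OF i[of "t / ?s"], of ?s 0] s unfolding eq by simp
  have "integral\<^sup>L lborel (?f (t / ?s)) = ?s *\<^sub>R
     (\<integral>x. exp (\<i> * of_real (t * x)) * of_real (exp (- \<tau> * x\<^sup>2 / 2)) \<partial>lborel)"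
    using lborel_integral_real_affine[of ?s "?f (t / ?s)" 0] s unfolding eq by simp
  then show "(\<integral>x. exp (\<i> * of_real (t * x)) * of_real (exp (- \<tau> * x\<^sup>2 / 2)) \<partial>lborel)
      = (of_real (sqrt (2 * pi / \<tau>) * exp (- t\<^sup>2 / (2 * \<tau>))) :: complex)"
    using s unfolding e
    by (simp add: power_divide scaleR_conv_of_real field_simps real_sqrt_divide real_sqrt_mult)
qed

lemma norm_sq_eq_sum_Basis: "(norm (x::'a::euclidean_space))\<^sup>2 = (\<Sum>b\<in>Basis. (x \<bullet> b)\<^sup>2)"
  unfolding power2_norm_eq_inner by (subst euclidean_inner) (simp add: power2_eq_square)

lemma gaussian_fourier:
  fixes \<xi> :: "'a::euclidean_space"
  assumes "\<tau> > 0"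
  shows "(\<integral>x. cos (x \<bullet> \<xi>) * exp (- \<tau> * (norm x)\<^sup>2 / 2) \<partial>lborel)
      = sqrt (2 * pi / \<tau>) ^ DIM('a) * exp (- (norm \<xi>)\<^sup>2 / (2 * \<tau>))"
proof -
  let ?f = "\<lambda>b x. exp (\<i> * of_real ((\<xi> \<bullet> b) * x)) * of_real (exp (- \<tau> * x\<^sup>2 / 2)) :: complex"
  have *: "(\<Prod>b\<in>Basis. ?f b (x \<bullet> b)) = exp (\<i> * of_real (x \<bullet> \<xi>)) * of_real (exp (- \<tau> * (norm x)\<^sup>2 / 2))" for x
    by (simp add: prod.distrib exp_sum[symmetric] norm_sq_eq_sum_Basis euclidean_inner[of x \<xi>]
        sum_distrib_left sum_divide_distrib sum_negf mult_ac flip: of_real_prod)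
  have i: "integrable lborel (\<lambda>x::'a. exp (\<i> * of_real (x \<bullet> \<xi>)) * of_real (exp (- \<tau> * (norm x)\<^sup>2 / 2)) :: complex)"
    using lborel_integrable_prod(1)[of ?f] gaussian_fourier_1d(1)[OF assms] unfolding * by blast
  have "(\<integral>x. exp (\<i> * of_real (x \<bullet> \<xi>)) * of_real (exp (- \<tau> * (norm x)\<^sup>2 / 2)) \<partial>lborel)
      = (\<Prod>b\<in>Basis. of_real (sqrt (2 * pi / \<tau>) * exp (- (\<xi> \<bullet> b)\<^sup>2 / (2 * \<tau>))) :: complex)"
    using lborel_integrable_prod(2)[of ?f] gaussian_fourier_1d[OF assms] unfolding * by simp
  also have "\<dots> = of_real (sqrt (2 * pi / \<tau>) ^ DIM('a) * exp (- (norm \<xi>)\<^sup>2 / (2 * \<tau>)))"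
    by (simp add: prod.distrib exp_sum[symmetric] norm_sq_eq_sum_Basis sum_divide_distrib sum_negf
        flip: of_real_prod)
  finally have "Re (\<integral>x. exp (\<i> * of_real (x \<bullet> \<xi>)) * of_real (exp (- \<tau> * (norm x)\<^sup>2 / 2)) \<partial>lborel)
      = sqrt (2 * pi / \<tau>) ^ DIM('a) * exp (- (norm \<xi>)\<^sup>2 / (2 * \<tau>))"
    by (simp only: Re_complex_of_real)
  moreover have "Re (\<integral>x. exp (\<i> * of_real (x \<bullet> \<xi>)) * of_real (exp (- \<tau> * (norm x)\<^sup>2 / 2)) \<partial>lborel)
     = (\<integral>x. cos (x \<bullet> \<xi>) * exp (- \<tau> * (norm x)\<^sup>2 / 2) \<partial>lborel)"
    by (subst integral_Re[symmetric, OF i]) (simp add: Re_exp)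
  ultimately show ?thesis by simp
qed

lemma polyfun_gaussian_bound:
  assumes "polyfun P" "0 < a" 
  shows "\<exists>C\<ge>0. \<forall>s (x::'a::euclidean_space). a \<le> s \<longrightarrow> s \<le> b \<longrightarrow>
    \<bar>P s ((norm x)\<^sup>2) * exp (- s * (norm x)\<^sup>2 / 2)\<bar> \<le> C * decay x"
proof -
  obtain C N where C: "0 \<le> C" "\<And>s r. \<bar>P s r\<bar> \<le> C * (1 + \<bar>s\<bar> + \<bar>r\<bar>) ^ N"
    using polyfun_bound[OF assms(1)] by blast
  obtain D where D: "0 \<le> D" "\<And>x::'a. (1 + (norm x)\<^sup>2) ^ N * exp (- (a / 2) * (norm x)\<^sup>2) \<le> D * decay x"
    using gaussian_le_decay[of "a / 2" N, where 'a='a] assms by auto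
  have "\<bar>P s ((norm x)\<^sup>2) * exp (- s * (norm x)\<^sup>2 / 2)\<bar> \<le> (C * (1 + \<bar>b\<bar>) ^ N * D) * decay x"
    if s: "a \<le> s" "s \<le> b" for s and x :: 'a
  proof -
    have "s + (norm x)\<^sup>2 \<le> b + (norm x)\<^sup>2 + b * (norm x)\<^sup>2"
      using s mult_nonneg_nonneg[of b, OF _ zero_le_power2[of "norm x"]] assms by linarith
    then have "1 + \<bar>s\<bar> + \<bar>(norm x)\<^sup>2\<bar> \<le> (1 + \<bar>b\<bar>) * (1 + (norm x)\<^sup>2)"
      using s assms by (simp only: distrib_left distrib_right) simp
    then have "\<bar>P s ((norm x)\<^sup>2)\<bar> \<le> C * ((1 + \<bar>b\<bar>) * (1 + (norm x)\<^sup>2)) ^ N"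
      using C(1) by (intro order_trans[OF C(2)] mult_left_mono power_mono) auto
    moreover have "exp (- s * (norm x)\<^sup>2 / 2) \<le> exp (- (a / 2) * (norm x)\<^sup>2)"
      using s by (simp add: mult_right_mono)
    ultimately have "\<bar>P s ((norm x)\<^sup>2) * exp (- s * (norm x)\<^sup>2 / 2)\<bar>
       \<le> C * ((1 + \<bar>b\<bar>) * (1 + (norm x)\<^sup>2)) ^ N * exp (- (a / 2) * (norm x)\<^sup>2)"
      unfolding abs_mult using C(1) by (intro mult_mono) auto
    also have "\<dots> = C * (1 + \<bar>b\<bar>) ^ N * ((1 + (norm x)\<^sup>2) ^ N * exp (- (a / 2) * (norm x)\<^sup>2))"
      by (simp add: power_mult_distrib mult_ac)
    also have "\<dots> \<le> C * (1 + \<bar>b\<bar>) ^ N * (D * decay x)"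
      using C(1) D(2)[of x] by (intro mult_left_mono) auto
    finally show ?thesis by (simp add: mult_ac)
  qed
  with C(1) D(1) show ?thesis by (intro exI[of _ "C * (1 + \<bar>b\<bar>) ^ N * D"]) auto
qed

lemma integrable_bounded_by_decay:
  fixes f :: "'a::euclidean_space \<Rightarrow> real"
  assumes "f \<in> borel_measurable borel" "\<And>x. \<bar>f x\<bar> \<le> C * decay x"
  shows "integrable lborel f"
proof (rule Bochner_Integration.integrable_bound)
  show "integrable lborel (\<lambda>x::'a. C * decay x)"
    by (intro integrable_mult_right decay_integrable)
  show "AE x in lborel. norm (f x) \<le> norm (C * decay x)"
    using assms(2) abs_ge_self order_trans by (intro AE_I2) (simp, blast)
qed (use assms in auto)

text \<open>
  Multiplying the transform by \<open>|\<xi>|\<^sup>2\<close> amounts to applying \<open>-\<Delta>\<close>, and on Gaussians the Laplacian can be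
  traded for a derivative in the width parameter: \<open>exp (- |\<xi>|\<^sup>2 / (2 s))\<close> has \<open>s\<close>-derivative
  \<open>|\<xi>|\<^sup>2 / (2 s\<^sup>2)\<close> times itself. Induction on \<open>j\<close> therefore needs no coordinates and no integration by
  parts: differentiating the identity in \<open>s\<close> and multiplying by \<open>2 s\<^sup>2\<close> raises \<open>j\<close> by one, once the
  contribution of the normalising factor \<open>(2\<pi>/s)\<^sup>n\<^sup>/\<^sup>2\<close> has been compensated.
\<close>

lemma gaussian_polyharmonic_fourier:
  "\<exists>P. polyfun P \<and> (\<forall>s>0. \<forall>\<xi>::'a::euclidean_space.
    (\<integral>x. cos (x \<bullet> \<xi>) * (P s ((norm x)\<^sup>2) * exp (- s * (norm x)\<^sup>2 / 2)) \<partial>lborel)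
      = norm \<xi> ^ (2 * j) * sqrt (2 * pi / s) ^ DIM('a) * exp (- (norm \<xi>)\<^sup>2 / (2 * s)))"
proof (induction j)
  case 0
  show ?case by (rule exI[of _ "\<lambda>s r. 1"]) (use gaussian_fourier in \<open>auto intro: polyfun.intros\<close>)
next
  case (Suc j)
  then obtain P where P: "polyfun P" "\<And>s \<xi>::'a. s > 0 \<Longrightarrow>
    (\<integral>x. cos (x \<bullet> \<xi>) * (P s ((norm x)\<^sup>2) * exp (- s * (norm x)\<^sup>2 / 2)) \<partial>lborel)
      = norm \<xi> ^ (2 * j) * sqrt (2 * pi / s) ^ DIM('a) * exp (- (norm \<xi>)\<^sup>2 / (2 * s))"
    by blast
  from polyfun_deriv[OF P(1)] obtain P' where P': "polyfun P'"
    "\<And>s r. ((\<lambda>s. P s r) has_real_derivative P' s r) (at s)" by blast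
  \<comment> \<open>\<open>Q\<close> is the polynomial factor of the \<open>s\<close>-derivative of \<open>P s r exp (- s r / 2)\<close>.\<close>
  define Q where "Q = (\<lambda>s r. P' s r - r / 2 * P s r)"
  have Q: "polyfun Q"
    using polyfun_diff[OF P'(1) polyfun.mult[OF polyfun.mult[OF polyfun.snd polyfun.const[of "1/2"]] P(1)]]
    by (simp add: Q_def mult_ac)
  let ?n = "real DIM('a)"
  define S where "S = (\<lambda>s r. 2 * s\<^sup>2 * Q s r + ?n * s * P s r)"
  have "polyfun S"
    using polyfun.add[OF polyfun.mult[OF polyfun.mult[OF polyfun.const[of 2] polyfun_power[OF polyfun.fst, of 2]] Q]
       polyfun.mult[OF polyfun.mult[OF polyfun.const[of ?n] polyfun.fst] P(1)]] by (simp add: S_def)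
  moreover have "(\<integral>x. cos (x \<bullet> \<xi>) * (S s ((norm x)\<^sup>2) * exp (- s * (norm x)\<^sup>2 / 2)) \<partial>lborel)
      = norm \<xi> ^ (2 * Suc j) * sqrt (2 * pi / s) ^ DIM('a) * exp (- (norm \<xi>)\<^sup>2 / (2 * s))"
    if s: "s > 0" for s and \<xi> :: 'a
  proof -
    let ?f = "\<lambda>P s x. cos (x \<bullet> \<xi>) * (P s ((norm x)\<^sup>2) * exp (- s * (norm x)\<^sup>2 / 2))"
    have b: "\<exists>C\<ge>0. \<forall>s' (x::'a). s / 2 < s' \<longrightarrow> s' < 2 * s \<longrightarrow> \<bar>?f P s' x\<bar> \<le> C * decay x"
      if pf: "polyfun P" for P
    proof -
      obtain C where C: "C \<ge> 0" "\<And>s' (x::'a). s / 2 \<le> s' \<Longrightarrow> s' \<le> 2 * s \<Longrightarrow>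
        \<bar>P s' ((norm x)\<^sup>2) * exp (- s' * (norm x)\<^sup>2 / 2)\<bar> \<le> C * decay x"
        using polyfun_gaussian_bound[OF pf, of "s / 2" "2 * s", where 'a='a] s by auto
      have "\<bar>?f P s' x\<bar> \<le> C * decay x" if "s / 2 < s'" "s' < 2 * s" for s' x
      proof -
        have "\<bar>?f P s' x\<bar> \<le> 1 * \<bar>P s' ((norm x)\<^sup>2) * exp (- s' * (norm x)\<^sup>2 / 2)\<bar>"
          unfolding abs_mult[of "cos _"] by (intro mult_right_mono) auto
        then show ?thesis using C(2)[of s' x] that by linarith
      qed
      with C(1) show ?thesis by blast
    qed
    have m: "?f P s' \<in> borel_measurable borel" if "polyfun P" for P s'
      using polyfun_measurable[OF that, of "\<lambda>_. s'" borel "\<lambda>x::'a. (norm x)\<^sup>2"] by measurable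
    have i: "integrable lborel (?f P s')" if pf: "polyfun P" "s / 2 < s'" "s' < 2 * s" for P s'
    proof -
      from b[OF pf(1)] obtain C where "\<And>x::'a. \<bar>?f P s' x\<bar> \<le> C * decay x" using pf by blast
      then show ?thesis using m[OF pf(1)] by (intro integrable_bounded_by_decay[where C=C]) auto
    qed
    obtain C where C: "\<And>s' (x::'a). s / 2 < s' \<Longrightarrow> s' < 2 * s \<Longrightarrow> \<bar>?f Q s' x\<bar> \<le> C * decay x"
      using b[OF Q] by blast
    have "((\<lambda>s. \<integral>x. ?f P s x \<partial>lborel) has_real_derivative (\<integral>x. ?f Q s x \<partial>lborel)) (at s)"
    proof (rule DERIV_integral_param[of "s / 2" s "2 * s"])
      show "((\<lambda>s. ?f P s x) has_real_derivative ?f Q s' x) (at s')" for s' x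
        by (auto intro!: derivative_eq_intros P'(2) simp: Q_def algebra_simps)
      show "integrable lborel (\<lambda>x::'a. C * decay x)" by (intro integrable_mult_right decay_integrable)
    qed (use s i[OF P(1)] C m[OF Q] in auto)
    moreover have "((\<lambda>s. \<integral>x. ?f P s x \<partial>lborel) has_real_derivative
      norm \<xi> ^ (2 * j) * sqrt (2 * pi / s) ^ DIM('a) * exp (- (norm \<xi>)\<^sup>2 / (2 * s))
        * ((norm \<xi>)\<^sup>2 / (2 * s\<^sup>2) - ?n / (2 * s))) (at s)"
    proof (rule DERIV_cong_ev[THEN iffD2, OF refl _ refl])
      show "\<forall>\<^sub>F s in nhds s. (\<integral>x. ?f P s x \<partial>lborel)
         = norm \<xi> ^ (2 * j) * ((2 * pi / s) powr (?n / 2)) * exp (- (norm \<xi>)\<^sup>2 / (2 * s))"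
      proof -
        have "\<forall>\<^sub>F s in nhds s. s \<in> {0<..}" using s by (intro eventually_nhds_in_open) auto
        then show ?thesis
        proof eventually_elim
          case (elim s)
          then show ?case
            using P(2)[of s \<xi>] by (simp add: powr_half_sqrt[symmetric] powr_power)
        qed
      qed
      have r: "sqrt (2 * pi / s) ^ DIM('a) = (2 * pi / s) powr (?n / 2)"
        using s by (simp add: powr_half_sqrt[symmetric] powr_power)
      have p: "(2 * pi / s) powr (?n / 2 - 1) = (2 * pi / s) powr (?n / 2) * (s / (2 * pi))"
        using s by (simp add: powr_diff)
      show "((\<lambda>s. norm \<xi> ^ (2 * j) * ((2 * pi / s) powr (?n / 2)) * exp (- (norm \<xi>)\<^sup>2 / (2 * s)))
        has_real_derivative
        norm \<xi> ^ (2 * j) * sqrt (2 * pi / s) ^ DIM('a) * exp (- (norm \<xi>)\<^sup>2 / (2 * s))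
        * ((norm \<xi>)\<^sup>2 / (2 * s\<^sup>2) - ?n / (2 * s))) (at s)"
        unfolding r using s
        by (auto intro!: derivative_eq_intros simp: p) (simp add: field_simps power2_eq_square)
    qed
    ultimately have d: "(\<integral>x. ?f Q s x \<partial>lborel) = 
       norm \<xi> ^ (2 * j) * sqrt (2 * pi / s) ^ DIM('a) * exp (- (norm \<xi>)\<^sup>2 / (2 * s))
        * ((norm \<xi>)\<^sup>2 / (2 * s\<^sup>2) - ?n / (2 * s))"
      by (rule DERIV_unique)
    have "(\<integral>x. ?f S s x \<partial>lborel) = (\<integral>x. 2 * s\<^sup>2 * ?f Q s x + ?n * s * ?f P s x \<partial>lborel)"
      by (simp add: S_def algebra_simps)
    also have "\<dots> = 2 * s\<^sup>2 * (\<integral>x. ?f Q s x \<partial>lborel) + ?n * s * (\<integral>x. ?f P s x \<partial>lborel)"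
      using i[OF P(1), of s] i[OF Q, of s] s
      by (subst Bochner_Integration.integral_add) (auto intro!: integrable_mult_right simp del: integrable_mult_right_iff)
    also have "\<dots> = norm \<xi> ^ (2 * Suc j) * sqrt (2 * pi / s) ^ DIM('a) * exp (- (norm \<xi>)\<^sup>2 / (2 * s))"
      unfolding d P(2)[OF s] using s by (simp add: field_simps power2_eq_square)
    finally show ?thesis .
  qed
  ultimately show ?case by blast
qed

text \<open>
  The function \<open>\<Lambda> = (-\<Delta>)\<^sup>m exp (- |x|\<^sup>2 / 2)\<close>, characterised by its Fourier transform.
\<close>

lemma gaussian_polyharmonic_exists:
  "\<exists>\<Lambda> C N. \<Lambda> \<in> borel_measurable borel \<and> (\<forall>x. \<Lambda> (- x) = \<Lambda> x) \<and> C \<ge> 0 \<and>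
    (\<forall>x::'a::euclidean_space. \<bar>\<Lambda> x\<bar> \<le> C * (1 + (norm x)\<^sup>2) ^ N * exp (- (norm x)\<^sup>2 / 2)) \<and>
    (\<forall>\<xi>. (\<integral>x. cos (x \<bullet> \<xi>) * \<Lambda> x \<partial>lborel)
      = norm \<xi> ^ (2 * m) * (sqrt (2 * pi) ^ DIM('a) * exp (- (norm \<xi>)\<^sup>2 / 2)))"
proof -
  obtain P where P: "polyfun P" "\<And>s \<xi>::'a. s > 0 \<Longrightarrow>
    (\<integral>x. cos (x \<bullet> \<xi>) * (P s ((norm x)\<^sup>2) * exp (- s * (norm x)\<^sup>2 / 2)) \<partial>lborel)
      = norm \<xi> ^ (2 * m) * sqrt (2 * pi / s) ^ DIM('a) * exp (- (norm \<xi>)\<^sup>2 / (2 * s))"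
    using gaussian_polyharmonic_fourier[where 'a='a and j=m] by blast
  obtain C N where C: "0 \<le> C" "\<And>s r. \<bar>P s r\<bar> \<le> C * (1 + \<bar>s\<bar> + \<bar>r\<bar>) ^ N"
    using polyfun_bound[OF P(1)] by blast
  define \<Lambda> where "\<Lambda> = (\<lambda>x::'a. P 1 ((norm x)\<^sup>2) * exp (- (norm x)\<^sup>2 / 2))"
  have "(\<lambda>x::'a. P 1 ((norm x)\<^sup>2)) \<in> borel_measurable borel"
    by (rule polyfun_measurable[OF P(1)]) auto
  then have "\<Lambda> \<in> borel_measurable borel" unfolding \<Lambda>_def by measurable
  moreover have "\<bar>\<Lambda> x\<bar> \<le> C * 2 ^ N * (1 + (norm x)\<^sup>2) ^ N * exp (- (norm x)\<^sup>2 / 2)" for x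
  proof -
    have "\<bar>P 1 ((norm x)\<^sup>2)\<bar> \<le> C * (2 * (1 + (norm x)\<^sup>2)) ^ N"
      using C(1) by (intro order_trans[OF C(2)] mult_left_mono power_mono) auto
    then have "\<bar>P 1 ((norm x)\<^sup>2)\<bar> \<le> C * 2 ^ N * (1 + (norm x)\<^sup>2) ^ N"
      by (simp only: power_mult_distrib mult.assoc)
    then show ?thesis
      unfolding \<Lambda>_def abs_mult by (simp add: mult_right_mono)
  qed
  moreover have "(\<integral>x. cos (x \<bullet> \<xi>) * \<Lambda> x \<partial>lborel)
      = norm \<xi> ^ (2 * m) * (sqrt (2 * pi) ^ DIM('a) * exp (- (norm \<xi>)\<^sup>2 / 2))" for \<xi>
    using P(2)[of 1 \<xi>] by (simp add: \<Lambda>_def)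
  ultimately show ?thesis
    using C(1) by (intro exI[of _ \<Lambda>] exI[of _ "C * 2 ^ N"] exI[of _ N]) (auto simp: \<Lambda>_def)
qed

section \<open>Integrability of the polyharmonic kernel\<close>

lemma integrable_mult_bounded:
  fixes f h :: "'a::euclidean_space \<Rightarrow> real"
  assumes "integrable lborel f" "h \<in> borel_measurable borel" "\<And>x. \<bar>h x\<bar> \<le> 1"
  shows "integrable lborel (\<lambda>x. h x * f x)"
proof (rule Bochner_Integration.integrable_bound[OF assms(1)])
  show "(\<lambda>x. h x * f x) \<in> borel_measurable lborel"
    using borel_measurable_integrable[OF assms(1)] assms(2) by measurable
  have "norm (h x * f x) \<le> norm (f x)" for x
    using assms(3)[of x] by (simp add: abs_mult mult_left_le_one_le)
  then show "AE x in lborel. norm (h x * f x) \<le> norm (f x)" by simp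
qed

lemma exp_power_le_decay:
  assumes "t > (0::real)" "m > 0"
  shows "\<exists>C\<ge>0. \<forall>x::'a::euclidean_space. (1 + (norm x)\<^sup>2) ^ k * exp (- t * norm x ^ (2 * m)) \<le> C * decay x"
proof -
  obtain C where C: "C \<ge> 0" "\<And>x::'a. (1 + (norm x)\<^sup>2) ^ k * exp (- t * (norm x)\<^sup>2) \<le> C * decay x"
    using gaussian_le_decay[OF assms(1), of k] by blast
  have "(1 + (norm x)\<^sup>2) ^ k * exp (- t * norm x ^ (2 * m)) \<le> (exp t * C) * decay x" for x :: 'a
  proof -
    have "(norm x)\<^sup>2 - 1 \<le> ((norm x)\<^sup>2) ^ m"
    proof (cases "(norm x)\<^sup>2 \<le> 1")
      case False
      then have "((norm x)\<^sup>2) ^ 1 \<le> ((norm x)\<^sup>2) ^ m"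
        using assms by (intro power_increasing) auto
      then show ?thesis by simp
    qed (simp add: order_trans[of _ 0])
    then have "t * (norm x)\<^sup>2 - t \<le> t * norm x ^ (2 * m)"
      using mult_left_mono[of "(norm x)\<^sup>2 - 1" "((norm x)\<^sup>2) ^ m" t] assms
      unfolding power_mult by (simp add: algebra_simps)
    then have "exp (- t * norm x ^ (2 * m)) \<le> exp t * exp (- t * (norm x)\<^sup>2)"
      by (simp add: exp_add[symmetric])
    then have "(1 + (norm x)\<^sup>2) ^ k * exp (- t * norm x ^ (2 * m))
       \<le> exp t * ((1 + (norm x)\<^sup>2) ^ k * exp (- t * (norm x)\<^sup>2))"
      by (simp add: mult.left_commute[of "exp t"] mult_left_mono)
    also have "\<dots> \<le> exp t * (C * decay x)"
      using C(2)[of x] by (intro mult_left_mono) auto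
    finally show ?thesis by (simp add: mult.assoc)
  qed
  with C(1) show ?thesis by (intro exI[of _ "exp t * C"]) auto
qed

lemma exp_power_integrable:
  assumes "t > (0::real)" "m > 0"
  shows "integrable lborel (\<lambda>x::'a::euclidean_space. exp (- t * norm x ^ (2 * m)))"
proof -
  obtain C where "\<And>x::'a. (1 + (norm x)\<^sup>2) ^ 0 * exp (- t * norm x ^ (2 * m)) \<le> C * decay x"
    using exp_power_le_decay[OF assms, of 0] by blast
  then show ?thesis by (intro integrable_bounded_by_decay[where C=C]) auto
qed

lemma decay_shift:
  assumes "norm v \<le> L"
  shows "decay (x + v) \<le> (2 + 2 * L\<^sup>2) ^ DIM('a) * decay (x::'a::euclidean_space)"
proof -
  have "norm x \<le> norm (x + v) + norm v"
    using norm_triangle_ineq4[of "x + v" v] by simp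
  then have "norm x \<le> norm (x + v) + L" using assms by linarith
  then have "(norm x)\<^sup>2 \<le> (norm (x + v) + L)\<^sup>2" by (intro power_mono) auto
  also have "\<dots> \<le> 2 * (norm (x + v))\<^sup>2 + 2 * L\<^sup>2"
    using sum_squares_bound[of "norm (x + v)" L] by (simp add: power2_sum)
  finally have "(norm x)\<^sup>2 \<le> 2 * (norm (x + v))\<^sup>2 + 2 * L\<^sup>2" .
  moreover have "(2 + 2 * L\<^sup>2) * (1 + (norm (x + v))\<^sup>2)
      = 2 + 2 * L\<^sup>2 + 2 * (norm (x + v))\<^sup>2 + 2 * (L\<^sup>2 * (norm (x + v))\<^sup>2)"
    by (simp add: algebra_simps)
  moreover have "0 \<le> L\<^sup>2 * (norm (x + v))\<^sup>2" by simp
  ultimately have "1 + (norm x)\<^sup>2 \<le> (2 + 2 * L\<^sup>2) * (1 + (norm (x + v))\<^sup>2)"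
    by linarith
  then have "(1 + (norm x)\<^sup>2) ^ DIM('a) \<le> ((2 + 2 * L\<^sup>2) * (1 + (norm (x + v))\<^sup>2)) ^ DIM('a)"
    by (intro power_mono) auto
  moreover have "(1 + (norm x)\<^sup>2) ^ DIM('a) > 0" "(1 + (norm (x + v))\<^sup>2) ^ DIM('a) > 0"
    by (auto simp: add_pos_nonneg)
  ultimately show ?thesis
    unfolding decay_def power_mult_distrib by (simp add: field_simps)
qed

text \<open>
  Decay of the kernel follows from the smoothness of \<open>exp (- |\<xi>|\<^sup>2\<^sup>m)\<close>. Smoothness is exploited through
  finite differences rather than derivatives: translation by a vector \<open>a\<close> with \<open>x \<bullet> a = \<pi>\<close> flips the sign
  of \<open>cos (x \<bullet> \<xi>)\<close>, so each difference multiplies the Fourier integral at \<open>x\<close> by \<open>-2\<close>, while translation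
  invariance of Lebesgue measure replaces integration by parts. Choosing \<open>a\<close> parallel to \<open>x\<close>, of length
  \<open>\<pi> / |x|\<close>, turns the bound \<open>O(|a|\<^sup>k)\<close> for a \<open>k\<close>-th difference into decay of order \<open>|x|\<^sup>-\<^sup>k\<close>.
\<close>

definition forward_diff :: "'a \<Rightarrow> ('a \<Rightarrow> real) \<Rightarrow> 'a::real_vector \<Rightarrow> real" where
  "forward_diff a h x = h (x + a) - h x"

lemma fourier_forward_diff:
  fixes h :: "'a::euclidean_space \<Rightarrow> real"
  assumes h: "integrable lborel h" and a: "x \<bullet> a = pi"
  shows "integrable lborel ((forward_diff a ^^ k) h) \<and>
    (\<integral>\<xi>. cos (x \<bullet> \<xi>) * (forward_diff a ^^ k) h \<xi> \<partial>lborel) = (-2) ^ k * (\<integral>\<xi>. cos (x \<bullet> \<xi>) * h \<xi> \<partial>lborel)"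
proof (induction k)
  case (Suc k)
  define g where "g = (forward_diff a ^^ k) h"
  have g: "integrable lborel g"
    and IH: "(\<integral>\<xi>. cos (x \<bullet> \<xi>) * g \<xi> \<partial>lborel) = (-2) ^ k * (\<integral>\<xi>. cos (x \<bullet> \<xi>) * h \<xi> \<partial>lborel)"
    using Suc by (auto simp: g_def)
  have m[measurable]: "g \<in> borel_measurable borel" using borel_measurable_integrable[OF g] by simp
  have ga: "integrable lborel (\<lambda>\<xi>. g (\<xi> + a))"
    using lborel_affine_integrable_iff[of 1 g a] g by (simp add: add.commute)
  have c: "integrable lborel (\<lambda>\<xi>. cos (x \<bullet> \<xi>) * f \<xi>)" if "integrable lborel f" for f :: "'a \<Rightarrow> real"
    by (rule integrable_mult_bounded[OF that]) auto
  have "(\<integral>\<xi>. cos (x \<bullet> \<xi>) * g \<xi> \<partial>lborel) = (\<integral>\<xi>. cos (x \<bullet> (a + 1 *\<^sub>R \<xi>)) * g (a + 1 *\<^sub>R \<xi>) \<partial>lborel)"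
    by (subst lborel_affine_integral[of 1 _ a]) auto
  also have "\<dots> = - (\<integral>\<xi>. cos (x \<bullet> \<xi>) * g (\<xi> + a) \<partial>lborel)"
    by (simp add: inner_add_right a cos_add add.commute)
  finally have "(\<integral>\<xi>. cos (x \<bullet> \<xi>) * g (\<xi> + a) \<partial>lborel) = - (\<integral>\<xi>. cos (x \<bullet> \<xi>) * g \<xi> \<partial>lborel)"
    by simp
  moreover have "(\<integral>\<xi>. cos (x \<bullet> \<xi>) * forward_diff a g \<xi> \<partial>lborel) =
    (\<integral>\<xi>. cos (x \<bullet> \<xi>) * g (\<xi> + a) \<partial>lborel) - (\<integral>\<xi>. cos (x \<bullet> \<xi>) * g \<xi> \<partial>lborel)"
    unfolding forward_diff_def right_diff_distrib
    by (rule Bochner_Integration.integral_diff[OF c[OF ga] c[OF g]])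
  moreover have "integrable lborel (forward_diff a g)"
    unfolding forward_diff_def using ga g by (rule Bochner_Integration.integrable_diff)
  ultimately show ?case using IH by (simp add: g_def)
qed (use h in auto)

lemma forward_diff_Suc: "(forward_diff a ^^ Suc k) h x = (forward_diff a ^^ k) h (x + a) - (forward_diff a ^^ k) h x"
  by (simp add: forward_diff_def)

lemma forward_diff_line:
  "(forward_diff (\<delta> *\<^sub>R e) ^^ k) h (x + s *\<^sub>R e) = (forward_diff \<delta> ^^ k) (\<lambda>s. h (x + s *\<^sub>R e)) s"
proof (induction k arbitrary: s)
  case (Suc k)
  have "x + s *\<^sub>R e + \<delta> *\<^sub>R e = x + (s + \<delta>) *\<^sub>R e"
    by (simp add: scaleR_add_left add.assoc)
  then show ?case by (simp only: forward_diff_Suc Suc)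
qed simp

lemma forward_diff_translate:
  "(forward_diff \<delta> ^^ k) (\<lambda>s. f (s + c)) s = (forward_diff \<delta> ^^ k) f (s + c)"
proof (induction k arbitrary: s)
  case (Suc k)
  have "s + \<delta> + c = s + c + \<delta>" by (simp add: add_ac)
  then show ?case by (simp only: forward_diff_Suc Suc)
qed simp

text \<open>
  A \<open>k\<close>-th difference is controlled by the \<open>k\<close>-th derivative: apply the mean value theorem once and the
  induction hypothesis to the differenced sequence of derivatives.
\<close>

lemma forward_diff_bound:
  fixes F :: "nat \<Rightarrow> real \<Rightarrow> real"
  assumes "\<And>j s. (F j has_real_derivative F (Suc j) s) (at s)" "\<delta> \<ge> 0"
    and "\<And>s. s0 \<le> s \<Longrightarrow> s \<le> s0 + real k * \<delta> \<Longrightarrow> \<bar>F k s\<bar> \<le> M"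
  shows "\<bar>(forward_diff \<delta> ^^ k) (F 0) s0\<bar> \<le> \<delta> ^ k * M"
  using assms
proof (induction k arbitrary: F M)
  case (Suc k)
  define G where "G = (\<lambda>j s. F j (s + \<delta>) - F j s)"
  have "\<bar>(forward_diff \<delta> ^^ k) (G 0) s0\<bar> \<le> \<delta> ^ k * (M * \<delta>)"
  proof (rule Suc.IH)
    fix j s
    show "(G j has_real_derivative G (Suc j) s) (at s)"
      unfolding G_def
      by (intro DERIV_diff Suc.prems(1) DERIV_shift[THEN iffD1])
  next
    fix s assume s: "s0 \<le> s" "s \<le> s0 + real k * \<delta>"
    have "norm (F k (s + \<delta>) - F k s) \<le> M * norm ((s + \<delta>) - s)"
    proof (rule field_differentiable_bound[where S="{s..s+\<delta>}" and f'="F (Suc k)"])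
      fix z assume z: "z \<in> {s..s+\<delta>}"
      show "(F k has_field_derivative F (Suc k) z) (at z within {s..s + \<delta>})"
        using Suc.prems(1) DERIV_subset by blast
      show "norm (F (Suc k) z) \<le> M"
        using Suc.prems(3)[of z] z s by (simp add: algebra_simps)
    qed (use Suc.prems(2) in auto)
    then show "\<bar>G k s\<bar> \<le> M * \<delta>" using Suc.prems(2) by (simp add: G_def)
  qed fact
  moreover have "(forward_diff \<delta> ^^ Suc k) (F 0) = (forward_diff \<delta> ^^ k) (G 0)"
    by (simp only: funpow_Suc_right o_apply) (simp add: G_def forward_diff_def[abs_def])
  ultimately show ?case by (simp add: mult_ac)
qed simp

text \<open>
  The derivatives of \<open>exp (- |\<xi>|\<^sup>2\<^sup>m)\<close> along a line. If \<open>s\<close> is the coordinate along the line and \<open>b\<close> the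
  squared distance of the line from the origin, then \<open>|\<xi>|\<^sup>2 = s\<^sup>2 + b\<close>.
\<close>

lemma exp_power_derivatives:
  "\<exists>P. (\<forall>j. polyfun (P j)) \<and> P 0 = (\<lambda>s b. 1) \<and>
     (\<forall>j s b. ((\<lambda>s. P j s b * exp (- ((s\<^sup>2 + b) ^ m))) has_real_derivative
        P (Suc j) s b * exp (- ((s\<^sup>2 + b) ^ m))) (at s))"
proof -
  have "\<exists>P'. polyfun P' \<and> (\<forall>s b. ((\<lambda>s. P s b * exp (- ((s\<^sup>2 + b) ^ m))) has_real_derivative
        P' s b * exp (- ((s\<^sup>2 + b) ^ m))) (at s))" if P: "polyfun P" for P
  proof -
    obtain P' where P': "polyfun P'" "\<And>s r. ((\<lambda>s. P s r) has_real_derivative P' s r) (at s)"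
      using polyfun_deriv[OF P] by blast
    have "polyfun (\<lambda>s b. P' s b - P s b * (real m * ((s\<^sup>2 + b) ^ (m - 1)) * (2 * s)))"
      by (intro polyfun_diff polyfun.mult P' P polyfun.const polyfun_power polyfun.add polyfun.fst polyfun.snd)
    moreover have "((\<lambda>s. P s b * exp (- ((s\<^sup>2 + b) ^ m))) has_real_derivative
        (P' s b - P s b * (real m * ((s\<^sup>2 + b) ^ (m - 1)) * (2 * s))) * exp (- ((s\<^sup>2 + b) ^ m))) (at s)" for s b
      by (auto intro!: derivative_eq_intros P'(2) simp: algebra_simps)
    ultimately show ?thesis by (intro exI[of _ "\<lambda>s b. P' s b - P s b * (real m * ((s\<^sup>2 + b) ^ (m - 1)) * (2 * s))"]) auto
  qed
  then have "\<forall>P\<in>Collect polyfun. \<exists>P'. polyfun P' \<and>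
      (\<forall>s b. ((\<lambda>s. P s b * exp (- ((s\<^sup>2 + b) ^ m))) has_real_derivative
        P' s b * exp (- ((s\<^sup>2 + b) ^ m))) (at s))"
    by simp
  from bchoice[OF this] obtain D where D: "\<And>P. polyfun P \<Longrightarrow> polyfun (D P)"
    "\<And>P s b. polyfun P \<Longrightarrow> ((\<lambda>s. P s b * exp (- ((s\<^sup>2 + b) ^ m))) has_real_derivative
        D P s b * exp (- ((s\<^sup>2 + b) ^ m))) (at s)" by auto
  have "polyfun ((D ^^ j) (\<lambda>s b. 1))" for j
    by (induction j) (auto intro: D polyfun.intros)
  then show ?thesis
    by (intro exI[of _ "\<lambda>j. (D ^^ j) (\<lambda>s b. 1)"]) (auto intro: D)
qed

text \<open>
  The bound is uniform in the direction \<open>e\<close> and in the base point because the derivatives are polynomials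
  in \<open>s\<close> and \<open>b\<close>, both controlled by \<open>|\<xi>|\<close>, times the exponential. The restriction \<open>\<delta> \<le> L\<close> keeps all points
  that enter the difference within bounded distance of \<open>\<xi>\<close>, where \<open>decay\<close> changes by a bounded factor.
\<close>

lemma exp_power_forward_diff_bound:
  assumes m: "m > 0"
  shows "\<exists>C\<ge>0. \<forall>\<delta> e (\<xi>::'a::euclidean_space). 0 \<le> \<delta> \<longrightarrow> \<delta> \<le> L \<longrightarrow> norm e = 1 \<longrightarrow>
    \<bar>(forward_diff (\<delta> *\<^sub>R e) ^^ k) (\<lambda>\<xi>. exp (- (norm \<xi> ^ (2 * m)))) \<xi>\<bar> \<le> \<delta> ^ k * (C * decay \<xi>)"
proof -
  obtain P where P: "\<And>j. polyfun (P j)" "P 0 = (\<lambda>s b. 1)"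
     "\<And>j s b. ((\<lambda>s. P j s b * exp (- ((s\<^sup>2 + b) ^ m))) has_real_derivative
        P (Suc j) s b * exp (- ((s\<^sup>2 + b) ^ m))) (at s)"
    using exp_power_derivatives[of m] by blast
  obtain C N where C: "0 \<le> C" "\<And>s r. \<bar>P k s r\<bar> \<le> C * (1 + \<bar>s\<bar> + \<bar>r\<bar>) ^ N"
    using polyfun_bound[OF P(1)] by blast
  obtain D where D: "0 \<le> D"
    "\<And>x::'a. (1 + (norm x)\<^sup>2) ^ N * exp (- 1 * norm x ^ (2 * m)) \<le> D * decay x"
    using exp_power_le_decay[OF _ m, of 1 N, where 'a='a] by auto
  define E where "E = C * 2 ^ N * D * (2 + 2 * (real k * L)\<^sup>2) ^ DIM('a)"
  have "\<bar>(forward_diff (\<delta> *\<^sub>R e) ^^ k) (\<lambda>\<xi>. exp (- (norm \<xi> ^ (2 * m)))) \<xi>\<bar> \<le> \<delta> ^ k * (E * decay \<xi>)"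
    if \<delta>: "0 \<le> \<delta>" "\<delta> \<le> L" and e: "norm e = 1" for \<delta> e and \<xi> :: 'a
  proof -
    define c where "c = \<xi> \<bullet> e"
    define b where "b = (norm \<xi>)\<^sup>2 - c\<^sup>2"
    have nsq: "(norm (\<xi> + s *\<^sub>R e))\<^sup>2 = (s + c)\<^sup>2 + b" for s
    proof -
      have "(norm (\<xi> + s *\<^sub>R e))\<^sup>2 = (norm \<xi>)\<^sup>2 + 2 * (s * c) + s\<^sup>2 * (norm e)\<^sup>2"
        unfolding power2_norm_eq_inner c_def
        by (simp add: inner_add_left inner_add_right inner_commute[of e \<xi>] power2_eq_square
            algebra_simps)
      then show ?thesis using e by (simp add: b_def power2_sum)
    qed
    have b: "b \<ge> 0"
      using power_mono[OF Cauchy_Schwarz_ineq2[of \<xi> e], of 2] e by (simp add: b_def c_def)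
    define F where "F = (\<lambda>j s. P j s b * exp (- ((s\<^sup>2 + b) ^ m)))"
    have h: "exp (- (norm (\<xi> + s *\<^sub>R e) ^ (2 * m))) = F 0 (s + c)" for s
      by (simp add: F_def P(2) power_mult nsq)
    have "(forward_diff (\<delta> *\<^sub>R e) ^^ k) (\<lambda>\<xi>. exp (- (norm \<xi> ^ (2 * m)))) \<xi>
        = (forward_diff (\<delta> *\<^sub>R e) ^^ k) (\<lambda>\<xi>. exp (- (norm \<xi> ^ (2 * m)))) (\<xi> + 0 *\<^sub>R e)" by simp
    also have "\<dots> = (forward_diff \<delta> ^^ k) (F 0) (0 + c)"
      unfolding forward_diff_line h forward_diff_translate ..
    finally have eq: "(forward_diff (\<delta> *\<^sub>R e) ^^ k) (\<lambda>\<xi>. exp (- (norm \<xi> ^ (2 * m)))) \<xi> = (forward_diff \<delta> ^^ k) (F 0) c"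
      by simp
    have "\<bar>(forward_diff \<delta> ^^ k) (F 0) c\<bar> \<le> \<delta> ^ k * (E * decay \<xi>)"
    proof (rule forward_diff_bound)
      show "(F j has_real_derivative F (Suc j) s) (at s)" for j s
        unfolding F_def by (rule P(3))
      fix s assume s: "c \<le> s" "s \<le> c + real k * \<delta>"
      define \<eta> where "\<eta> = \<xi> + (s - c) *\<^sub>R e"
      have n: "(norm \<eta>)\<^sup>2 = s\<^sup>2 + b" using nsq[of "s - c"] by (simp add: \<eta>_def)
      have "1 + \<bar>s\<bar> + \<bar>b\<bar> \<le> 2 * (1 + (norm \<eta>)\<^sup>2)"
      proof -
        have "2 * \<bar>s\<bar> \<le> s\<^sup>2 + 1"
          using zero_le_power2[of "\<bar>s\<bar> - 1"] by (simp add: power2_diff)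
        moreover have "\<bar>b\<bar> = b" using b by simp
        moreover have "2 * (1 + (s\<^sup>2 + b)) = 2 + 2 * s\<^sup>2 + 2 * b" by simp
        moreover have "0 \<le> s\<^sup>2" by simp
        ultimately show ?thesis unfolding n using b by linarith
      qed
      then have "\<bar>P k s b\<bar> \<le> C * (2 * (1 + (norm \<eta>)\<^sup>2)) ^ N"
        using C(1) by (intro order_trans[OF C(2)] mult_left_mono power_mono) auto
      then have "\<bar>F k s\<bar> \<le> C * (2 * (1 + (norm \<eta>)\<^sup>2)) ^ N * exp (- 1 * norm \<eta> ^ (2 * m))"
        unfolding F_def abs_mult by (simp add: power_mult n mult_right_mono)
      also have "\<dots> = C * 2 ^ N * ((1 + (norm \<eta>)\<^sup>2) ^ N * exp (- 1 * norm \<eta> ^ (2 * m)))"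
        by (simp only: power_mult_distrib mult_ac)
      also have "\<dots> \<le> C * 2 ^ N * (D * decay \<eta>)"
        using C(1) D(2)[of \<eta>] by (intro mult_left_mono) auto
      also have "\<dots> \<le> C * 2 ^ N * (D * ((2 + 2 * (real k * L)\<^sup>2) ^ DIM('a) * decay \<xi>))"
      proof -
        have "real k * \<delta> \<le> real k * L" using \<delta> by (intro mult_left_mono) auto
        then have "norm ((s - c) *\<^sub>R e) \<le> real k * L" using s e by simp
        then show ?thesis unfolding \<eta>_def
          using C(1) D(1) by (intro mult_left_mono decay_shift) auto
      qed
      finally show "\<bar>F k s\<bar> \<le> E * decay \<xi>" by (simp add: E_def mult_ac)
    qed (use \<delta> in auto)
    then show ?thesis by (simp only: eq)
  qed
  moreover have "E \<ge> 0" using C(1) D(1) by (auto simp: E_def intro!: mult_nonneg_nonneg)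
  ultimately show ?thesis by blast
qed

text \<open>
  Differences of order \<open>2n\<close> give the decay \<open>|x|\<^sup>-\<^sup>2\<^sup>n\<close> away from the unit ball; inside it the trivial bound by
  the integral of \<open>exp (- |\<xi>|\<^sup>2\<^sup>m)\<close> suffices.
\<close>

lemma exp_power_fourier_decay:
  assumes m: "m > 0"
  shows "\<exists>C\<ge>0. \<forall>x::'a::euclidean_space.
    \<bar>\<integral>\<xi>. cos (x \<bullet> \<xi>) * exp (- (norm \<xi> ^ (2 * m))) \<partial>lborel\<bar> \<le> C * decay x"
proof -
  let ?h = "\<lambda>\<xi>::'a. exp (- (norm \<xi> ^ (2 * m)))"
  let ?I = "\<lambda>x::'a. \<integral>\<xi>. cos (x \<bullet> \<xi>) * ?h \<xi> \<partial>lborel"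
  let ?k = "2 * DIM('a)"
  have h: "integrable lborel ?h" using exp_power_integrable[OF zero_less_one m, where 'a='a] by simp
  obtain C where C: "C \<ge> 0" "\<And>\<delta> e \<xi>::'a. 0 \<le> \<delta> \<Longrightarrow> \<delta> \<le> pi \<Longrightarrow> norm e = 1 \<Longrightarrow>
    \<bar>(forward_diff (\<delta> *\<^sub>R e) ^^ ?k) ?h \<xi>\<bar> \<le> \<delta> ^ ?k * (C * decay \<xi>)"
    using exp_power_forward_diff_bound[OF m, of pi ?k, where 'a='a] by blast
  define J where "J = integral\<^sup>L lborel (decay :: 'a \<Rightarrow> real)"
  have J: "J \<ge> 0" unfolding J_def using decay_pos by (intro integral_nonneg_AE) (auto intro: less_imp_le)
  define H where "H = (\<integral>\<xi>. ?h \<xi> \<partial>lborel)"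
  have H: "H \<ge> 0" unfolding H_def by (intro integral_nonneg_AE) auto
  have cosle: "\<bar>cos y * z\<bar> \<le> \<bar>z\<bar>" for y z :: real
    using mult_right_mono[of "\<bar>cos y\<bar>" 1 "\<bar>z\<bar>"] by (simp add: abs_mult)
  have bound: "\<bar>?I x\<bar> \<le> (2 ^ DIM('a) * (H + pi ^ ?k * C * J)) * decay x" for x
  proof (cases "norm x \<le> 1")
    case True
    have "\<bar>?I x\<bar> \<le> H"
      unfolding H_def using h cosle[of _ "?h _"]
      by (intro order_trans[OF integral_abs_bound] Bochner_Integration.integral_mono')
        auto
    also have "H \<le> (2 ^ DIM('a) * H) * decay x"
    proof -
      have "(1 + (norm x)\<^sup>2) ^ DIM('a) \<le> 2 ^ DIM('a)"
        using True by (intro power_mono) (auto simp: power_le_one)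
      then have "1 \<le> 2 ^ DIM('a) * decay x"
        unfolding decay_def by (simp add: divide_inverse[symmetric] le_divide_eq add_pos_nonneg)
      then show ?thesis using mult_left_mono[OF _ H, of 1 "2 ^ DIM('a) * decay x"] by (simp add: mult_ac)
    qed
    also have "\<dots> \<le> (2 ^ DIM('a) * (H + pi ^ ?k * C * J)) * decay x"
      using J C(1) decay_pos[of x] by (intro mult_right_mono mult_left_mono) auto
    finally show ?thesis .
  next
    case False
    define e where "e = x /\<^sub>R norm x"
    define \<delta> where "\<delta> = pi / norm x"
    have x: "norm x > 1" using False by simp
    then have x0: "x \<noteq> 0" by auto
    have e: "norm e = 1" using x0 by (simp add: e_def)
    have \<delta>: "0 \<le> \<delta>" "\<delta> \<le> pi" using x by (auto simp: \<delta>_def divide_le_eq mult_le_cancel_left1)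
    have "x \<bullet> (\<delta> *\<^sub>R e) = pi" using x0 by (simp add: e_def \<delta>_def dot_square_norm power2_eq_square)
    note F = fourier_forward_diff[OF h this, of ?k]
    let ?g = "(forward_diff (\<delta> *\<^sub>R e) ^^ ?k) ?h"
    have "2 ^ ?k * \<bar>?I x\<bar> = \<bar>\<integral>\<xi>. cos (x \<bullet> \<xi>) * ?g \<xi> \<partial>lborel\<bar>"
      using F by (simp add: abs_mult power_abs)
    also have "\<dots> \<le> (\<integral>\<xi>. \<bar>cos (x \<bullet> \<xi>) * ?g \<xi>\<bar> \<partial>lborel)" by (rule integral_abs_bound)
    also have "\<dots> \<le> (\<integral>\<xi>. \<delta> ^ ?k * (C * decay (\<xi> :: 'a)) \<partial>lborel)"
    proof (rule Bochner_Integration.integral_mono')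
      show "integrable lborel (\<lambda>\<xi>::'a. \<delta> ^ ?k * (C * decay \<xi>))"
        by (intro integrable_mult_right decay_integrable)
      show "\<bar>cos (x \<bullet> \<xi>) * ?g \<xi>\<bar> \<le> \<delta> ^ ?k * (C * decay \<xi>)" for \<xi>
        by (rule order_trans[OF cosle]) (intro C(2) \<delta> e)
      show "0 \<le> \<delta> ^ ?k * (C * decay \<xi>)" for \<xi> :: 'a
        using \<delta> C(1) decay_pos[of \<xi>] by simp
    qed
    also have "\<dots> = \<delta> ^ ?k * C * J" by (simp add: J_def)
    finally have 1: "2 ^ ?k * \<bar>?I x\<bar> \<le> \<delta> ^ ?k * C * J" .
    have "\<bar>?I x\<bar> \<le> 2 ^ ?k * \<bar>?I x\<bar>"
      by (simp add: mult_le_cancel_right1)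
    also note 1
    also have "\<delta> ^ ?k = pi ^ ?k * inverse (((norm x)\<^sup>2) ^ DIM('a))"
      by (simp add: \<delta>_def power_divide divide_inverse power_mult power_mult_distrib power_inverse)
    also have "inverse (((norm x)\<^sup>2) ^ DIM('a)) \<le> 2 ^ DIM('a) * decay x"
    proof -
      have "1 \<le> (norm x)\<^sup>2" using x by simp
      then have "(1 + (norm x)\<^sup>2) ^ DIM('a) \<le> (2 * (norm x)\<^sup>2) ^ DIM('a)"
        by (intro power_mono) auto
      moreover have "(1 + (norm x)\<^sup>2) ^ DIM('a) > 0" "((norm x)\<^sup>2) ^ DIM('a) > 0"
        using x0 by (auto simp: add_pos_nonneg)
      ultimately show ?thesis unfolding decay_def power_mult_distrib by (simp add: field_simps)
    qed
    finally have "\<bar>?I x\<bar> \<le> pi ^ ?k * (2 ^ DIM('a) * decay x) * C * J"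
      using C(1) J by (simp add: mult_right_mono mult_left_mono)
    also have "\<dots> \<le> (2 ^ DIM('a) * (H + pi ^ ?k * C * J)) * decay x"
      using H decay_pos[of x] by (simp add: algebra_simps)
    finally show ?thesis .
  qed
  show ?thesis using bound H J C(1)
    by (intro exI[of _ "2 ^ DIM('a) * (H + pi ^ ?k * C * J)"]) auto
qed

lemma integrable_lborel_pair_mult:
  fixes f :: "'a::euclidean_space \<Rightarrow> real" and g :: "'b::euclidean_space \<Rightarrow> real"
  assumes f: "integrable lborel f" and g: "integrable lborel g"
  shows "integrable (lborel \<Otimes>\<^sub>M lborel) (\<lambda>(x, y). f x * g y)"
proof (rule lborel_pair.Fubini_integrable)
  have [measurable]: "f \<in> borel_measurable borel" "g \<in> borel_measurable borel"
    using borel_measurable_integrable[OF f] borel_measurable_integrable[OF g] by auto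
  show "(\<lambda>(x, y). f x * g y) \<in> borel_measurable (lborel \<Otimes>\<^sub>M lborel)" by measurable
qed (use f g in \<open>auto simp: abs_mult\<close>)

lemma polyharmonic_kernel_eq:
  fixes x :: "real ^ 'n"
  assumes "m > 0" "t > 0"
  shows "polyharmonic_kernel m t x =
    (\<integral>\<xi>. cos (x \<bullet> \<xi>) * exp (- t * norm \<xi> ^ (2 * m)) \<partial>lborel) / (2 * pi) ^ CARD('n)"
proof -
  let ?f = "\<lambda>\<xi>. exp (\<i> * complex_of_real (x \<bullet> \<xi>)) * complex_of_real (exp (- t * norm \<xi> ^ (2 * m)))"
  have i: "integrable lborel ?f"
  proof (rule Bochner_Integration.integrable_bound)
    show "integrable lborel (\<lambda>\<xi>::real^'n. exp (- t * norm \<xi> ^ (2 * m)))"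
      using assms by (intro exp_power_integrable) auto
  qed (auto simp: norm_mult)
  have "Re (integral\<^sup>L lborel ?f) = (\<integral>\<xi>. cos (x \<bullet> \<xi>) * exp (- t * norm \<xi> ^ (2 * m)) \<partial>lborel)"
    by (subst integral_Re[symmetric, OF i]) (simp add: Re_exp)
  moreover have "Re (z / (2 * complex_of_real pi) ^ CARD('n)) = Re z / (2 * pi) ^ CARD('n)" for z
    using Re_divide_of_real[of z "(2 * pi) ^ CARD('n)"] by simp
  ultimately show ?thesis
    unfolding polyharmonic_kernel_def inverse_fourier_def by simp
qed

text \<open>
  Parabolic self-similarity. It makes the \<open>L\<^sup>1\<close> norm of the kernel independent of time, so that
  nothing is lost in the time integral as \<open>t\<close> tends to \<open>0\<close>.
\<close>

lemma polyharmonic_kernel_scale: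
  fixes x :: "real ^ 'n"
  assumes m: "m > 0" and t: "t > 0"
  defines "c \<equiv> t powr (- 1 / (2 * m))"
  shows "polyharmonic_kernel m t x = c ^ CARD('n) * polyharmonic_kernel m 1 (c *\<^sub>R x)"
proof -
  have c: "c > 0" using t by (simp add: c_def)
  have tc: "t * c ^ (2 * m) = 1"
  proof -
    have "c ^ (2 * m) = c powr real (2 * m)" using powr_realpow[OF c, of "2 * m"] by simp
    also have "\<dots> = inverse t"
      unfolding c_def powr_powr using t m by (simp add: powr_minus)
    finally show ?thesis using t by simp
  qed
  have "(\<integral>\<xi>. cos (x \<bullet> \<xi>) * exp (- t * norm \<xi> ^ (2 * m)) \<partial>lborel)
     = c ^ CARD('n) * (\<integral>\<xi>. cos (x \<bullet> (0 + c *\<^sub>R \<xi>)) * exp (- t * norm (0 + c *\<^sub>R \<xi>) ^ (2 * m)) \<partial>lborel)"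
    using c by (subst lborel_affine_integral[of c _ 0]) auto
  also have "(\<lambda>\<xi>::real ^ 'n. - t * norm (0 + c *\<^sub>R \<xi>) ^ (2 * m)) = (\<lambda>\<xi>. - 1 * norm \<xi> ^ (2 * m))"
    using c tc by (simp add: power_mult_distrib mult.assoc[symmetric])
  finally show ?thesis
    using m t by (simp add: polyharmonic_kernel_eq inner_scaleR_left)
qed

lemma polyharmonic_kernel_measurable [measurable]:
  fixes g :: "'a \<Rightarrow> real ^ 'n"
  assumes [measurable]: "f \<in> borel_measurable M" "g \<in> borel_measurable M"
  shows "(\<lambda>x. polyharmonic_kernel m (f x) (g x)) \<in> borel_measurable M"
  unfolding polyharmonic_kernel_def inverse_fourier_def by measurable

lemma polyharmonic_kernel_nn_integral:
  assumes m: "m > 0"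
  shows "\<exists>K\<ge>0. \<forall>t>0. \<forall>z::real ^ 'n.
    (\<integral>\<^sup>+x. ennreal \<bar>polyharmonic_kernel m t (x - z)\<bar> \<partial>lborel) \<le> ennreal K \<and>
    (\<integral>\<^sup>+x. ennreal \<bar>polyharmonic_kernel m t (z - x)\<bar> \<partial>lborel) \<le> ennreal K"
proof -
  obtain C where C: "C \<ge> 0" "\<And>x::real ^ 'n.
      \<bar>\<integral>\<xi>. cos (x \<bullet> \<xi>) * exp (- (norm \<xi> ^ (2 * m))) \<partial>lborel\<bar> \<le> C * decay x"
    using exp_power_fourier_decay[OF m, where 'a="real ^ 'n"] by blast
  let ?k = "polyharmonic_kernel m 1 :: real ^ 'n \<Rightarrow> real"
  define K where "K = (\<integral>x. \<bar>?k x\<bar> \<partial>lborel)"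
  have "\<bar>?k x\<bar> \<le> (C / (2 * pi) ^ CARD('n)) * decay x" for x
    using C(2)[of x] m by (simp add: polyharmonic_kernel_eq divide_right_mono)
  then have i: "integrable lborel (\<lambda>x. \<bar>?k x\<bar>)"
    by (intro integrable_bounded_by_decay[where C="C / (2 * pi) ^ CARD('n)"]) auto
  have *: "(\<integral>\<^sup>+x. ennreal \<bar>polyharmonic_kernel m t (\<epsilon> *\<^sub>R (x - z))\<bar> \<partial>lborel) = ennreal K"
    if t: "t > 0" and e: "\<bar>\<epsilon>\<bar> = 1" for t \<epsilon> and z :: "real ^ 'n"
  proof -
    define c where "c = t powr (- 1 / (2 * m))"
    have c: "c > 0" using t by (simp add: c_def)
    have "(\<integral>\<^sup>+x. ennreal \<bar>?k x\<bar> \<partial>lborel) = ennreal (\<bar>\<epsilon> * c\<bar> ^ CARD('n)) *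
        (\<integral>\<^sup>+x. ennreal \<bar>?k (- ((\<epsilon> * c) *\<^sub>R z) + (\<epsilon> * c) *\<^sub>R x)\<bar> \<partial>lborel)"
      using c e by (subst lborel_affine_nn_integral[of "\<epsilon> * c" _ "- ((\<epsilon> * c) *\<^sub>R z)"]) auto
    also have "\<dots> = (\<integral>\<^sup>+x. ennreal (c ^ CARD('n)) * ennreal \<bar>?k (- ((\<epsilon> * c) *\<^sub>R z) + (\<epsilon> * c) *\<^sub>R x)\<bar> \<partial>lborel)"
      using c e by (subst nn_integral_cmult) (auto simp: abs_mult)
    also have "\<dots> = (\<integral>\<^sup>+x. ennreal \<bar>polyharmonic_kernel m t (\<epsilon> *\<^sub>R (x - z))\<bar> \<partial>lborel)"
      using c polyharmonic_kernel_scale[OF m t, folded c_def, where 'n='n]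
      by (intro nn_integral_cong) (simp add: ennreal_mult[symmetric] abs_mult scaleR_diff_right mult.commute)
    finally show ?thesis
      unfolding K_def using nn_integral_eq_integral[OF i] by simp
  qed
  have "K \<ge> 0" by (simp add: K_def)
  then show ?thesis
    using *[of _ 1] *[of _ "-1"] by (intro exI[of _ K]) auto
qed

text \<open>
  Only the transform of \<open>F\<close> enters, never that of the kernel: inserting the Fourier integral of the kernel
  and exchanging the integrals avoids inverting the transform of the kernel. Evenness removes the sine
  part.
\<close>

lemma polyharmonic_kernel_convolution:
  fixes F :: "real ^ 'n \<Rightarrow> real"
  assumes m: "m > 0" and r: "r > 0" and F: "integrable lborel F" and even: "\<And>x. F (- x) = F x"
  shows "(\<integral>x. F x * polyharmonic_kernel m r (x - y) \<partial>lborel) =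
    (\<integral>\<xi>. exp (- r * norm \<xi> ^ (2 * m)) * (cos (y \<bullet> \<xi>) * (\<integral>x. cos (x \<bullet> \<xi>) * F x \<partial>lborel)) \<partial>lborel)
      / (2 * pi) ^ CARD('n)"
proof -
  have [measurable]: "F \<in> borel_measurable borel"
    using borel_measurable_integrable[OF F] by simp
  let ?e = "\<lambda>\<xi>::real^'n. exp (- r * norm \<xi> ^ (2 * m))"
  have e: "integrable lborel ?e" using r m by (intro exp_power_integrable) auto
  have ce: "integrable lborel (\<lambda>x. h x * F x)" if "\<And>x. \<bar>h x\<bar> \<le> 1" "h \<in> borel_measurable borel" for h
    by (rule integrable_mult_bounded[OF F that(2,1)])
  have inner: "(\<integral>x. cos ((x - y) \<bullet> \<xi>) * F x \<partial>lborel) = cos (y \<bullet> \<xi>) * (\<integral>x. cos (x \<bullet> \<xi>) * F x \<partial>lborel)" for \<xi>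
  proof -
    have "(\<integral>x. sin (x \<bullet> \<xi>) * F x \<partial>lborel) = (\<integral>x. sin ((0 + (-1) *\<^sub>R x) \<bullet> \<xi>) * F (0 + (-1) *\<^sub>R x) \<partial>lborel)"
      by (subst lborel_affine_integral[of "-1" _ 0]) auto
    also have "\<dots> = - (\<integral>x. sin (x \<bullet> \<xi>) * F x \<partial>lborel)" by (simp add: even)
    finally have s: "(\<integral>x. sin (x \<bullet> \<xi>) * F x \<partial>lborel) = 0" by simp
    have "(\<integral>x. cos ((x - y) \<bullet> \<xi>) * F x \<partial>lborel)
      = (\<integral>x. cos (y \<bullet> \<xi>) * (cos (x \<bullet> \<xi>) * F x) + sin (y \<bullet> \<xi>) * (sin (x \<bullet> \<xi>) * F x) \<partial>lborel)"
      by (simp add: inner_diff_left cos_diff algebra_simps)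
    also have "\<dots> = cos (y \<bullet> \<xi>) * (\<integral>x. cos (x \<bullet> \<xi>) * F x \<partial>lborel) + sin (y \<bullet> \<xi>) * (\<integral>x. sin (x \<bullet> \<xi>) * F x \<partial>lborel)"
      by (subst Bochner_Integration.integral_add) (auto intro!: integrable_mult_right ce)
    finally show ?thesis using s by simp
  qed
  let ?G = "\<lambda>x \<xi>. ?e \<xi> * (cos ((x - y) \<bullet> \<xi>) * F x)"
  have "integrable (lborel \<Otimes>\<^sub>M lborel) (\<lambda>(x, \<xi>). F x * ?e \<xi>)"
    by (rule integrable_lborel_pair_mult[OF F e])
  then have G: "integrable (lborel \<Otimes>\<^sub>M lborel) (\<lambda>(x, \<xi>). ?G x \<xi>)"
  proof (rule Bochner_Integration.integrable_bound)
    show "AE z in lborel \<Otimes>\<^sub>M lborel. norm (case z of (x, \<xi>) \<Rightarrow> ?G x \<xi>) \<le> norm (case z of (x, \<xi>) \<Rightarrow> F x * ?e \<xi>)"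
      by (intro AE_I2) (auto simp: abs_mult mult_ac intro!: mult_left_mono mult_left_le_one_le)
  qed measurable
  have "(\<integral>x. F x * polyharmonic_kernel m r (x - y) \<partial>lborel) * (2 * pi) ^ CARD('n)
     = (\<integral>x. (\<integral>\<xi>. ?G x \<xi> \<partial>lborel) \<partial>lborel)"
    unfolding Bochner_Integration.integral_mult_left_zero[symmetric]
  proof (rule Bochner_Integration.integral_cong[OF refl])
    fix x
    have "(\<integral>\<xi>. ?G x \<xi> \<partial>lborel) = (\<integral>\<xi>. F x * (cos ((x - y) \<bullet> \<xi>) * ?e \<xi>) \<partial>lborel)"
      by (simp add: mult_ac)
    then show "F x * polyharmonic_kernel m r (x - y) * (2 * pi) ^ CARD('n) = (\<integral>\<xi>. ?G x \<xi> \<partial>lborel)"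
      using m r by (simp add: polyharmonic_kernel_eq)
  qed
  also have "\<dots> = (\<integral>\<xi>. (\<integral>x. ?G x \<xi> \<partial>lborel) \<partial>lborel)"
    by (rule lborel_pair.Fubini_integral[OF G, symmetric])
  also have "\<dots> = (\<integral>\<xi>. ?e \<xi> * (cos (y \<bullet> \<xi>) * (\<integral>x. cos (x \<bullet> \<xi>) * F x \<partial>lborel)) \<partial>lborel)"
    by (simp add: inner)
  finally show ?thesis by (simp add: eq_divide_eq)
qed

section \<open>The backward equation on the Fourier side\<close>

lemma continuous_pair_bounded:
  fixes f g :: "real \<Rightarrow> real"
  assumes "continuous_on UNIV f" "continuous_on UNIV g"
  shows "\<exists>E\<ge>0. \<forall>s\<in>{a..b}. \<bar>f s\<bar> \<le> E \<and> \<bar>g s\<bar> \<le> E"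
proof -
  have "bounded (f ` {a..b})" "bounded (g ` {a..b})"
    by (auto intro!: compact_imp_bounded compact_continuous_image continuous_on_subset[OF assms(1)]
        continuous_on_subset[OF assms(2)])
  then obtain E1 E2 where "\<forall>s\<in>{a..b}. \<bar>f s\<bar> \<le> E1" "\<forall>s\<in>{a..b}. \<bar>g s\<bar> \<le> E2"
    unfolding bounded_iff by auto
  then show ?thesis by (intro exI[of _ "max 0 (max E1 E2)"]) (auto simp: le_max_iff_disj)
qed

text \<open>
  A test function \<open>\<psi>\<close> together with \<open>\<Lambda> = (-\<Delta>)\<^sup>m \<psi>\<close> and its transform \<open>\<psi>h\<close>. The relation between
  \<open>\<psi>\<close> and \<open>\<Lambda>\<close> is imposed through their transforms only, which is all that the pairing with the semigroup
  sees; the inversion formula for \<open>\<psi>\<close> recovers its values at the end.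
\<close>

locale polyharmonic_test =
  fixes m :: nat and \<psi> \<Lambda> \<psi>h :: "real ^ 'n \<Rightarrow> real" and C :: real
  assumes m: "m > 0"
    and meas [measurable]: "\<psi> \<in> borel_measurable borel" "\<Lambda> \<in> borel_measurable borel"
      "\<psi>h \<in> borel_measurable borel"
    and bound: "\<And>x. \<bar>\<psi> x\<bar> \<le> C * decay x" "\<And>x. \<bar>\<Lambda> x\<bar> \<le> C * decay x"
      "\<And>\<xi>. \<bar>\<psi>h \<xi>\<bar> \<le> C * decay \<xi>" "\<And>\<xi>. norm \<xi> ^ (2 * m) * \<bar>\<psi>h \<xi>\<bar> \<le> C * decay \<xi>"
    and even: "\<And>x. \<psi> (- x) = \<psi> x" "\<And>x. \<Lambda> (- x) = \<Lambda> x"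
    and fourier: "\<And>\<xi>. (\<integral>x. cos (x \<bullet> \<xi>) * \<psi> x \<partial>lborel) = \<psi>h \<xi>"
      "\<And>\<xi>. (\<integral>x. cos (x \<bullet> \<xi>) * \<Lambda> x \<partial>lborel) = norm \<xi> ^ (2 * m) * \<psi>h \<xi>"
    and inversion: "\<And>y. (\<integral>\<xi>. cos (y \<bullet> \<xi>) * \<psi>h \<xi> \<partial>lborel) = (2 * pi) ^ CARD('n) * \<psi> y"
begin

lemma C_nonneg: "C \<ge> 0"
proof -
  have "0 \<le> C * decay (0 :: real^'n)" using bound(1)[of 0] abs_ge_zero order_trans by blast
  then show ?thesis using decay_pos[of "0 :: real^'n"] by (simp add: zero_le_mult_iff)
qed

lemma test_functions_integrable: "integrable lborel \<psi>" "integrable lborel \<Lambda>" "integrable lborel \<psi>h"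
  using integrable_bounded_by_decay[OF meas(1) bound(1)] integrable_bounded_by_decay[OF meas(2) bound(2)]
    integrable_bounded_by_decay[OF meas(3) bound(3)] by auto

text \<open>
  For fixed \<open>\<xi>\<close> the time integrand is the derivative of \<open>- \<eta>(s) exp (- (s-\<tau>) |\<xi>|\<^sup>2\<^sup>m)\<close>; as \<open>\<eta>\<close> vanishes at
  \<open>T\<close>, only the value \<open>\<eta>(\<tau>)\<close> at the lower end survives, and Fourier inversion restores \<open>\<psi>\<close>.
\<close>

lemma backward_evolution:
  fixes \<eta> \<eta>' :: "real \<Rightarrow> real"
  assumes der: "\<And>s. (\<eta> has_real_derivative \<eta>' s) (at s)" and cont: "continuous_on UNIV \<eta>'"
    and T: "\<eta> T = 0" "\<tau> < T"
  shows "(\<integral>s. indicator {\<tau><..<T} s *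
      (\<integral>x. (\<eta> s * \<Lambda> x - \<eta>' s * \<psi> x) * polyharmonic_kernel m (s - \<tau>) (x - y) \<partial>lborel) \<partial>lborel)
    = \<eta> \<tau> * \<psi> y"
proof -
  let ?q = "\<lambda>\<xi>::real ^ 'n. norm \<xi> ^ (2 * m)"
  let ?c = "(2 * pi) ^ CARD('n)"
  have cont\<eta>: "continuous_on UNIV \<eta>"
    using der by (intro DERIV_continuous_on) (auto intro: has_field_derivative_at_within)
  have [measurable]: "\<eta> \<in> borel_measurable borel" "\<eta>' \<in> borel_measurable borel"
    using cont\<eta> cont by (auto intro: borel_measurable_continuous_onI)
  define H where "H = (\<lambda>s \<xi>. indicator {\<tau><..<T} s * (exp (- (s - \<tau>) * ?q \<xi>) * (\<eta> s * ?q \<xi> - \<eta>' s))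
     * (cos (y \<bullet> \<xi>) * \<psi>h \<xi>))"
  have inner: "indicator {\<tau><..<T} s *
      (\<integral>x. (\<eta> s * \<Lambda> x - \<eta>' s * \<psi> x) * polyharmonic_kernel m (s - \<tau>) (x - y) \<partial>lborel)
     = (\<integral>\<xi>. H s \<xi> \<partial>lborel) / ?c" for s
  proof (cases "s \<in> {\<tau><..<T}")
    case True
    have "(\<integral>x. (\<eta> s * \<Lambda> x - \<eta>' s * \<psi> x) * polyharmonic_kernel m (s - \<tau>) (x - y) \<partial>lborel)
       = (\<integral>\<xi>. exp (- (s - \<tau>) * ?q \<xi>) * (cos (y \<bullet> \<xi>) *
          (\<integral>x. cos (x \<bullet> \<xi>) * (\<eta> s * \<Lambda> x - \<eta>' s * \<psi> x) \<partial>lborel)) \<partial>lborel) / ?c"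
      using True m test_functions_integrable even by (intro polyharmonic_kernel_convolution) auto
    also have "(\<lambda>\<xi>. \<integral>x. cos (x \<bullet> \<xi>) * (\<eta> s * \<Lambda> x - \<eta>' s * \<psi> x) \<partial>lborel) = (\<lambda>\<xi>. (\<eta> s * ?q \<xi> - \<eta>' s) * \<psi>h \<xi>)"
    proof
      fix \<xi>
      have "(\<integral>x. cos (x \<bullet> \<xi>) * (\<eta> s * \<Lambda> x - \<eta>' s * \<psi> x) \<partial>lborel)
        = (\<integral>x. \<eta> s * (cos (x \<bullet> \<xi>) * \<Lambda> x) - \<eta>' s * (cos (x \<bullet> \<xi>) * \<psi> x) \<partial>lborel)"
        by (simp add: algebra_simps)
      also have "\<dots> = \<eta> s * (?q \<xi> * \<psi>h \<xi>) - \<eta>' s * \<psi>h \<xi>"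
        using integrable_mult_bounded[OF test_functions_integrable(1), of "\<lambda>x. cos (x \<bullet> \<xi>)"]
          integrable_mult_bounded[OF test_functions_integrable(2), of "\<lambda>x. cos (x \<bullet> \<xi>)"]
        by (simp add: fourier)
      finally show "(\<integral>x. cos (x \<bullet> \<xi>) * (\<eta> s * \<Lambda> x - \<eta>' s * \<psi> x) \<partial>lborel) = (\<eta> s * ?q \<xi> - \<eta>' s) * \<psi>h \<xi>"
        by (simp add: algebra_simps)
    qed
    finally show ?thesis using True by (simp add: H_def mult_ac)
  qed (simp add: H_def)
  obtain E where E: "E \<ge> 0" "\<And>s. s \<in> {\<tau>..T} \<Longrightarrow> \<bar>\<eta> s\<bar> \<le> E" "\<And>s. s \<in> {\<tau>..T} \<Longrightarrow> \<bar>\<eta>' s\<bar> \<le> E"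
    using continuous_pair_bounded[OF cont\<eta> cont, of \<tau> T] by blast
  have Hint: "integrable (lborel \<Otimes>\<^sub>M lborel) (\<lambda>(s, \<xi>). H s \<xi>)"
  proof (rule Bochner_Integration.integrable_bound)
    show "integrable (lborel \<Otimes>\<^sub>M lborel) (\<lambda>(s, \<xi>). indicator {\<tau><..<T} s * (2 * E * C * decay (\<xi>::real^'n)))"
      using T by (intro integrable_lborel_pair_mult integrable_mult_right decay_integrable integrable_real_indicator) auto
    have "\<bar>H s \<xi>\<bar> \<le> indicator {\<tau><..<T} s * (2 * E * C * decay \<xi>)" for s \<xi>
    proof (cases "s \<in> {\<tau><..<T}")
      case True
      have "\<bar>\<eta> s * ?q \<xi> - \<eta>' s\<bar> * \<bar>\<psi>h \<xi>\<bar> \<le> (\<bar>\<eta> s\<bar> * ?q \<xi> + \<bar>\<eta>' s\<bar>) * \<bar>\<psi>h \<xi>\<bar>"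
        using abs_triangle_ineq4[of "\<eta> s * ?q \<xi>" "\<eta>' s"] by (intro mult_right_mono) (auto simp: abs_mult)
      also have "\<dots> = \<bar>\<eta> s\<bar> * (?q \<xi> * \<bar>\<psi>h \<xi>\<bar>) + \<bar>\<eta>' s\<bar> * \<bar>\<psi>h \<xi>\<bar>" by (simp add: algebra_simps)
      also have "\<dots> \<le> E * (C * decay \<xi>) + E * (C * decay \<xi>)"
        using True E(1) by (intro add_mono mult_mono[OF E(2) bound(4)] mult_mono[OF E(3) bound(3)]) auto
      finally have 1: "\<bar>\<eta> s * ?q \<xi> - \<eta>' s\<bar> * \<bar>\<psi>h \<xi>\<bar> \<le> 2 * E * C * decay \<xi>"
        by (simp add: mult_ac)
      have "exp (- (s - \<tau>) * ?q \<xi>) * \<bar>cos (y \<bullet> \<xi>)\<bar> \<le> 1 * 1"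
        using True by (intro mult_mono) (auto intro!: mult_nonpos_nonneg)
      then have "exp (- (s - \<tau>) * ?q \<xi>) * \<bar>cos (y \<bullet> \<xi>)\<bar> \<le> 1" by simp
      then have "(exp (- (s - \<tau>) * ?q \<xi>) * \<bar>cos (y \<bullet> \<xi>)\<bar>) * (\<bar>\<eta> s * ?q \<xi> - \<eta>' s\<bar> * \<bar>\<psi>h \<xi>\<bar>)
         \<le> 1 * (2 * E * C * decay \<xi>)"
        by (rule mult_mono[OF _ 1]) auto
      then show ?thesis using True by (simp add: H_def abs_mult mult_ac)
    qed (simp add: H_def)
    moreover have "indicator {\<tau><..<T} s * (2 * E * C * decay \<xi>) \<ge> 0" for s and \<xi> :: "real^'n"
      using E(1) C_nonneg decay_pos[of \<xi>] by simp
    ultimately show "AE z in lborel \<Otimes>\<^sub>M lborel. norm (case z of (s, \<xi>) \<Rightarrow> H s \<xi>)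
      \<le> norm (case z of (s, \<xi>) \<Rightarrow> indicator {\<tau><..<T} s * (2 * E * C * decay \<xi>))"
      by (intro AE_I2) (auto split: prod.split)
  qed (unfold H_def, measurable)
  have time: "(\<integral>s. H s \<xi> \<partial>lborel) = \<eta> \<tau> * (cos (y \<bullet> \<xi>) * \<psi>h \<xi>)" for \<xi>
  proof -
    let ?g = "\<lambda>s. exp (- (s - \<tau>) * ?q \<xi>) * (\<eta> s * ?q \<xi> - \<eta>' s)"
    have "(\<integral>s. indicator {\<tau><..<T} s * ?g s \<partial>lborel) = (\<integral>s. ?g s * indicator {\<tau>..T} s \<partial>lborel)"
    proof (rule integral_cong_AE)
      show "AE s in lborel. indicator {\<tau><..<T} s * ?g s = ?g s * indicator {\<tau>..T} s"
        using AE_lborel_singleton[of \<tau>] AE_lborel_singleton[of T]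
        by eventually_elim (auto simp: indicator_def)
    qed measurable
    also have "\<dots> = (- \<eta> T * exp (- (T - \<tau>) * ?q \<xi>)) - (- \<eta> \<tau> * exp (- (\<tau> - \<tau>) * ?q \<xi>))"
    proof (rule integral_FTC_Icc_real)
      show "((\<lambda>s. - \<eta> s * exp (- (s - \<tau>) * ?q \<xi>)) has_real_derivative ?g s) (at s)" for s
        by (auto intro!: derivative_eq_intros der simp: algebra_simps)
      show "isCont ?g s" for s
        using cont cont\<eta> by (intro continuous_intros) (auto simp: continuous_on_eq_continuous_at)
    qed (use T in auto)
    finally have "(\<integral>s. indicator {\<tau><..<T} s * ?g s \<partial>lborel) = \<eta> \<tau>" using T by simp
    then show ?thesis unfolding H_def by simp
  qed
  have "(\<integral>s. (\<integral>\<xi>. H s \<xi> \<partial>lborel) \<partial>lborel) = (\<integral>\<xi>. (\<integral>s. H s \<xi> \<partial>lborel) \<partial>lborel)"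
    by (rule lborel_pair.Fubini_integral[OF Hint, symmetric])
  also have "\<dots> = \<eta> \<tau> * (?c * \<psi> y)"
    unfolding time by (simp add: inversion)
  finally show ?thesis unfolding inner by simp
qed

end

section \<open>Absolute integrability over space-time\<close>

lemma nn_integral_lborel_pair:
  fixes g :: "'a::euclidean_space \<Rightarrow> 'b::euclidean_space \<Rightarrow> ennreal"
  assumes "(\<lambda>(s, x). g s x) \<in> borel_measurable (borel \<Otimes>\<^sub>M borel)"
  shows "(\<integral>\<^sup>+p. g (fst p) (snd p) \<partial>lborel) = (\<integral>\<^sup>+s. (\<integral>\<^sup>+x. g s x \<partial>lborel) \<partial>lborel)"
proof -
  have "(\<lambda>(s, x). g s x) \<in> borel_measurable (lborel \<Otimes>\<^sub>M lborel)"
    using assms by (simp cong: measurable_cong_sets)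
  from lborel.nn_integral_fst[OF this] show ?thesis
    by (simp add: lborel_prod split_beta')
qed

text \<open>
  The weight splits into an integrable part \<open>V1\<close>, which is paired with the bound \<open>decay \<le> 1\<close>, and a bounded
  part \<open>c\<close>, which is paired with the integrability of \<open>decay\<close>. Either way the kernel contributes only its
  \<open>L\<^sup>1\<close> norm, whence the bound does not depend on \<open>r\<close>. The weight \<open>|y|\<^sup>-\<^sup>\<alpha>\<close> is split at the unit sphere.
\<close>

lemma weighted_convolution_nn_integral:
  fixes V V1 :: "real ^ 'n \<Rightarrow> real"
  assumes m: "m > 0" and [measurable]: "V \<in> borel_measurable borel"
    and V1: "integrable lborel V1" "\<And>y. 0 \<le> V1 y" and V: "\<And>y. 0 \<le> V y" "\<And>y. V y \<le> V1 y + c"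
    and c: "c \<ge> 0"
  shows "\<exists>K\<ge>0. \<forall>r>0. (\<integral>\<^sup>+x. (\<integral>\<^sup>+y. ennreal (decay x * \<bar>polyharmonic_kernel m r (x - y)\<bar> * V y) \<partial>lborel) \<partial>lborel)
     \<le> ennreal K"
proof -
  have [measurable]: "V1 \<in> borel_measurable borel"
    using borel_measurable_integrable[OF V1(1)] by simp
  obtain K where K: "K \<ge> 0" "\<And>t z::real^'n. t > 0 \<Longrightarrow>
    (\<integral>\<^sup>+x. ennreal \<bar>polyharmonic_kernel m t (x - z)\<bar> \<partial>lborel) \<le> ennreal K"
    "\<And>t z::real^'n. t > 0 \<Longrightarrow>
    (\<integral>\<^sup>+x. ennreal \<bar>polyharmonic_kernel m t (z - x)\<bar> \<partial>lborel) \<le> ennreal K"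
    using polyharmonic_kernel_nn_integral[OF m, where 'n='n] by blast
  define I where "I = (\<integral>y. V1 y \<partial>lborel)"
  define J where "J = integral\<^sup>L lborel (decay :: real^'n \<Rightarrow> real)"
  have I: "I \<ge> 0" "(\<integral>\<^sup>+y. ennreal (V1 y) \<partial>lborel) = ennreal I"
    using V1 by (auto simp: I_def nn_integral_eq_integral)
  have J: "J \<ge> 0" "(\<integral>\<^sup>+y. ennreal (decay (y::real^'n)) \<partial>lborel) = ennreal J"
    by (auto simp: J_def nn_integral_eq_integral decay_pos[THEN less_imp_le] decay_integrable)
  have "(\<integral>\<^sup>+x. (\<integral>\<^sup>+y. ennreal (decay x * \<bar>polyharmonic_kernel m r (x - y)\<bar> * V y) \<partial>lborel) \<partial>lborel)
     \<le> ennreal (K * I + c * (K * J))" if r: "r > 0" for r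
  proof -
    let ?k = "\<lambda>x y::real^'n. ennreal \<bar>polyharmonic_kernel m r (x - y)\<bar>"
    have "(\<integral>\<^sup>+x. (\<integral>\<^sup>+y. ennreal (decay x * \<bar>polyharmonic_kernel m r (x - y)\<bar> * V y) \<partial>lborel) \<partial>lborel)
       \<le> (\<integral>\<^sup>+x. (\<integral>\<^sup>+y. ennreal (V1 y) * ?k x y + ennreal c * (ennreal (decay x) * ?k x y) \<partial>lborel) \<partial>lborel)"
    proof (intro nn_integral_mono)
      fix x y :: "real^'n"
      have "decay x * \<bar>polyharmonic_kernel m r (x - y)\<bar> * V y
         \<le> decay x * \<bar>polyharmonic_kernel m r (x - y)\<bar> * (V1 y + c)"
        using V decay_pos[of x] by (intro mult_left_mono) auto
      also have "\<dots> = decay x * (\<bar>polyharmonic_kernel m r (x - y)\<bar> * V1 y)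
          + c * (decay x * \<bar>polyharmonic_kernel m r (x - y)\<bar>)"
        by (simp add: algebra_simps)
      also have "decay x * (\<bar>polyharmonic_kernel m r (x - y)\<bar> * V1 y) \<le> 1 * (\<bar>polyharmonic_kernel m r (x - y)\<bar> * V1 y)"
        using V1 decay_le_1[of x] by (intro mult_right_mono) auto
      finally have "ennreal (decay x * \<bar>polyharmonic_kernel m r (x - y)\<bar> * V y)
         \<le> ennreal (V1 y * \<bar>polyharmonic_kernel m r (x - y)\<bar> + c * (decay x * \<bar>polyharmonic_kernel m r (x - y)\<bar>))"
        by (intro ennreal_leI) (simp add: mult_ac)
      also have "\<dots> = ennreal (V1 y) * ?k x y + ennreal c * (ennreal (decay x) * ?k x y)"
        using V1 c decay_pos[of x] by (simp add: ennreal_plus ennreal_mult)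
      finally show "ennreal (decay x * \<bar>polyharmonic_kernel m r (x - y)\<bar> * V y)
         \<le> ennreal (V1 y) * ?k x y + ennreal c * (ennreal (decay x) * ?k x y)" .
    qed
    also have "\<dots> = (\<integral>\<^sup>+x. (\<integral>\<^sup>+y. ennreal (V1 y) * ?k x y \<partial>lborel) \<partial>lborel)
        + ennreal c * (\<integral>\<^sup>+x. ennreal (decay x) * (\<integral>\<^sup>+y. ?k x y \<partial>lborel) \<partial>lborel)"
      by (simp add: nn_integral_add nn_integral_cmult)
    also have "(\<integral>\<^sup>+x. (\<integral>\<^sup>+y. ennreal (V1 y) * ?k x y \<partial>lborel) \<partial>lborel)
        = (\<integral>\<^sup>+y. ennreal (V1 y) * (\<integral>\<^sup>+x. ?k x y \<partial>lborel) \<partial>lborel)"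
      by (subst lborel_pair.Fubini') (simp_all add: nn_integral_cmult)
    also have "\<dots> \<le> (\<integral>\<^sup>+y. ennreal (V1 y) * ennreal K \<partial>lborel)"
      using K(2)[OF r] by (intro nn_integral_mono mult_left_mono) auto
    also have "\<dots> = ennreal (K * I)"
      using I K(1) by (subst nn_integral_multc) (auto simp: ennreal_mult mult.commute)
    also have "(\<integral>\<^sup>+x. ennreal (decay x) * (\<integral>\<^sup>+y. ?k x y \<partial>lborel) \<partial>lborel)
       \<le> (\<integral>\<^sup>+x. ennreal (decay (x::real^'n)) * ennreal K \<partial>lborel)"
      using K(3)[OF r] by (intro nn_integral_mono mult_left_mono) auto
    also have "\<dots> = ennreal (K * J)"
      using J K(1) by (subst nn_integral_multc) (auto simp: ennreal_mult mult.commute)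
    finally show ?thesis
      using K(1) I(1) J(1) c by (simp add: ennreal_plus ennreal_mult add_mono mult_left_mono)
  qed
  then show ?thesis using K(1) I(1) J(1) c by (intro exI[of _ "K * I + c * (K * J)"]) auto
qed

text \<open>
  Extending the kernel by zero to nonpositive times builds the constraint \<open>\<tau> < t\<close> of the Duhamel integral
  into the integrand, so that Fubini's theorem applies on a full product space.
\<close>

definition causal_kernel :: "nat \<Rightarrow> real \<Rightarrow> real ^ 'n \<Rightarrow> real" where
  "causal_kernel m r z = (if 0 < r then polyharmonic_kernel m r z else 0)"

lemma causal_kernel_measurable [measurable]:
  fixes g :: "'a \<Rightarrow> real ^ 'n"
  assumes [measurable]: "f \<in> borel_measurable M" "g \<in> borel_measurable M"
  shows "(\<lambda>x. causal_kernel m (f x) (g x)) \<in> borel_measurable M"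
  unfolding causal_kernel_def by measurable

lemma measurable_fst_borel: "fst \<in> borel_measurable (borel :: ('a::second_countable_topology \<times> 'b::second_countable_topology) measure)"
  and measurable_snd_borel: "snd \<in> borel_measurable (borel :: ('a::second_countable_topology \<times> 'b::second_countable_topology) measure)"
  by (auto intro!: borel_measurable_continuous_onI continuous_intros)

lemma measurable_pair_lborel:
  fixes M :: "'a::euclidean_space measure" and N :: "'b::euclidean_space measure"
  assumes "sets M = sets borel" "sets N = sets borel"
  shows "f \<in> measurable borel L \<Longrightarrow> (\<lambda>z. f (fst z)) \<in> measurable (M \<Otimes>\<^sub>M N) L"
    and "g \<in> measurable borel L \<Longrightarrow> (\<lambda>z. g (snd z)) \<in> measurable (M \<Otimes>\<^sub>M N) L"
  using assms
  by (auto intro!: measurable_compose[OF measurable_fst] measurable_compose[OF measurable_snd]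
      cong: measurable_cong_sets)

text \<open>
  The Duhamel term tested in \<open>(s,x)\<close>: absolute integrability over all pairs \<open>(s,x)\<close>, \<open>(\<tau>,y)\<close>. The spatial
  integrals are performed first, for fixed times.
\<close>

lemma integrable_source_pairing:
  fixes V :: "real ^ 'n \<Rightarrow> real" and A f :: "real \<times> (real ^ 'n) \<Rightarrow> real"
  assumes [measurable]: "A \<in> borel_measurable borel" "f \<in> borel_measurable borel" "V \<in> borel_measurable borel"
    and K: "K \<ge> 0" "\<And>r. r > 0 \<Longrightarrow> (\<integral>\<^sup>+x. (\<integral>\<^sup>+y. ennreal (decay x * \<bar>polyharmonic_kernel m r (x - y)\<bar> * V y) \<partial>lborel) \<partial>lborel)
     \<le> ennreal K"
    and A: "\<And>s x. \<bar>A (s, x)\<bar> \<le> indicator {0<..<T} s * (a * decay x)" and a: "a \<ge> 0"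
    and f: "\<And>s x. \<bar>f (s, x)\<bar> \<le> indicator {0<..<T} s * V x" and V: "\<And>x. V x \<ge> 0"
  shows "integrable (lborel \<Otimes>\<^sub>M lborel) (\<lambda>(p, q). A p * causal_kernel m (fst p - fst q) (snd p - snd q) * f q)"
proof (rule integrableI_bounded)
  let ?G = "\<lambda>s x \<tau> y. ennreal (indicator {0<..<T} s * indicator {0<..<T} \<tau> * a * (decay x * \<bar>causal_kernel m (s - \<tau>) (x - y)\<bar> * V y))"
  note [measurable] = measurable_pair_lborel(1)[OF sets_lborel sets_lborel measurable_fst_borel]
    measurable_pair_lborel(1)[OF sets_lborel sets_lborel measurable_snd_borel]
    measurable_pair_lborel(1)[OF sets_lborel sets_lborel assms(1)]
    measurable_pair_lborel(2)[OF sets_lborel sets_lborel assms(2)]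
    measurable_pair_lborel(2)[OF sets_lborel sets_lborel measurable_fst_borel]
    measurable_pair_lborel(2)[OF sets_lborel sets_lborel measurable_snd_borel]
  have Z: "(\<lambda>(p, q). A p * causal_kernel m (fst p - fst q) (snd p - snd q) * f q) \<in> borel_measurable (lborel \<Otimes>\<^sub>M lborel)"
    unfolding case_prod_beta by measurable
  show "(\<lambda>(p, q). A p * causal_kernel m (fst p - fst q) (snd p - snd q) * f q) \<in> borel_measurable (lborel \<Otimes>\<^sub>M lborel)"
    by (rule Z)
  have "(\<integral>\<^sup>+z. ennreal (norm (case z of (p, q) \<Rightarrow> A p * causal_kernel m (fst p - fst q) (snd p - snd q) * f q)) \<partial>(lborel \<Otimes>\<^sub>M lborel))
     = (\<integral>\<^sup>+p. (\<integral>\<^sup>+q. ennreal (norm (A p * causal_kernel m (fst p - fst q) (snd p - snd q) * f q)) \<partial>lborel) \<partial>lborel)"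
    using lborel.nn_integral_fst[of "\<lambda>z. ennreal (norm (case_prod (\<lambda>p q. A p * causal_kernel m (fst p - fst q) (snd p - snd q) * f q) z))" lborel] Z
    by simp
  also have "\<dots> \<le> (\<integral>\<^sup>+p. (\<integral>\<^sup>+q. ?G (fst p) (snd p) (fst q) (snd q) \<partial>lborel) \<partial>lborel)"
  proof (intro nn_integral_mono ennreal_leI)
    fix p q :: "real \<times> (real ^ 'n)"
    obtain s x where p: "p = (s, x)" by force
    obtain \<tau> y where q: "q = (\<tau>, y)" by force
    have "norm (A p * causal_kernel m (fst p - fst q) (snd p - snd q) * f q)
      \<le> (indicator {0<..<T} s * (a * decay x)) * \<bar>causal_kernel m (s - \<tau>) (x - y)\<bar> * (indicator {0<..<T} \<tau> * V y)"
      unfolding p q using A[of s x] f[of \<tau> y] a decay_pos[of x]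
      by (auto simp: abs_mult intro!: mult_mono mult_nonneg_nonneg)
    then show "norm (A p * causal_kernel m (fst p - fst q) (snd p - snd q) * f q)
      \<le> indicator {0<..<T} (fst p) * indicator {0<..<T} (fst q) * a * (decay (snd p) * \<bar>causal_kernel m (fst p - fst q) (snd p - snd q)\<bar> * V (snd q))"
      by (simp add: p q mult_ac)
  qed
  also have "\<dots> = (\<integral>\<^sup>+s. (\<integral>\<^sup>+x. (\<integral>\<^sup>+\<tau>. (\<integral>\<^sup>+y. ?G s x \<tau> y \<partial>lborel) \<partial>lborel) \<partial>lborel) \<partial>lborel)"
  proof -
    have "(\<integral>\<^sup>+q. ?G s x (fst q) (snd q) \<partial>lborel) = (\<integral>\<^sup>+\<tau>. (\<integral>\<^sup>+y. ?G s x \<tau> y \<partial>lborel) \<partial>lborel)" for s x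
      by (rule nn_integral_lborel_pair) measurable
    moreover have "(\<integral>\<^sup>+p. (\<integral>\<^sup>+\<tau>. (\<integral>\<^sup>+y. ?G (fst p) (snd p) \<tau> y \<partial>lborel) \<partial>lborel) \<partial>lborel)
       = (\<integral>\<^sup>+s. (\<integral>\<^sup>+x. (\<integral>\<^sup>+\<tau>. (\<integral>\<^sup>+y. ?G s x \<tau> y \<partial>lborel) \<partial>lborel) \<partial>lborel) \<partial>lborel)"
      by (rule nn_integral_lborel_pair) measurable
    ultimately show ?thesis by (simp only:)
  qed
  also have "\<dots> = (\<integral>\<^sup>+s. (\<integral>\<^sup>+\<tau>. (\<integral>\<^sup>+x. (\<integral>\<^sup>+y. ?G s x \<tau> y \<partial>lborel) \<partial>lborel) \<partial>lborel) \<partial>lborel)"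
    by (intro nn_integral_cong lborel_pair.Fubini') measurable
  also have "\<dots> \<le> (\<integral>\<^sup>+s. (\<integral>\<^sup>+\<tau>. ennreal (a * K) * indicator {0<..<T} s * indicator {0<..<T} \<tau> \<partial>lborel) \<partial>lborel)"
  proof (intro nn_integral_mono)
    fix s \<tau> :: real
    show "(\<integral>\<^sup>+x. (\<integral>\<^sup>+y. ?G s x \<tau> y \<partial>lborel) \<partial>lborel) \<le> ennreal (a * K) * indicator {0<..<T} s * indicator {0<..<T} \<tau>"
    proof (cases "s \<in> {0<..<T} \<and> \<tau> \<in> {0<..<T} \<and> \<tau> < s")
      case True
      then have "(\<integral>\<^sup>+x. (\<integral>\<^sup>+y. ?G s x \<tau> y \<partial>lborel) \<partial>lborel)
        = ennreal a * (\<integral>\<^sup>+x. (\<integral>\<^sup>+y. ennreal (decay x * \<bar>polyharmonic_kernel m (s - \<tau>) (x - y)\<bar> * V y) \<partial>lborel) \<partial>lborel)"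
        using a by (simp add: ennreal_mult' causal_kernel_def nn_integral_cmult)
      also have "\<dots> \<le> ennreal a * ennreal K"
        using True K(2)[of "s - \<tau>"] by (intro mult_left_mono) auto
      finally show ?thesis using True a K(1) by (simp add: ennreal_mult)
    next
      case False
      then have "indicator {0<..<T} s * indicator {0<..<T} \<tau> * a * (decay x * \<bar>causal_kernel m (s - \<tau>) (x - y)\<bar> * V y) = 0" for x y
        by (auto simp: causal_kernel_def)
      then show ?thesis by (simp only:) simp
    qed
  qed
  also have "\<dots> = ennreal (a * K) * (ennreal (max 0 T) * ennreal (max 0 T))"
    by (cases "T \<ge> 0") (simp_all add: nn_integral_cmult nn_integral_multc mult_ac)
  also have "\<dots> < \<infinity>"
    by (simp add: ennreal_mult_less_top)
  finally show "(\<integral>\<^sup>+z. ennreal (norm (case z of (p, q) \<Rightarrow> A p * causal_kernel m (fst p - fst q) (snd p - snd q) * f q)) \<partial>(lborel \<Otimes>\<^sub>M lborel)) < \<infinity>" .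
qed

text \<open>
  The analogue for the initial datum, which enters as a source at time \<open>0\<close>.
\<close>

lemma integrable_initial_pairing:
  fixes V v :: "real ^ 'n \<Rightarrow> real" and A :: "real \<times> (real ^ 'n) \<Rightarrow> real"
  assumes [measurable]: "A \<in> borel_measurable borel" "v \<in> borel_measurable borel" "V \<in> borel_measurable borel"
    and K: "K \<ge> 0" "\<And>r. r > 0 \<Longrightarrow> (\<integral>\<^sup>+x. (\<integral>\<^sup>+y. ennreal (decay x * \<bar>polyharmonic_kernel m r (x - y)\<bar> * V y) \<partial>lborel) \<partial>lborel)
     \<le> ennreal K"
    and A: "\<And>s x. \<bar>A (s, x)\<bar> \<le> indicator {0<..<T} s * (a * decay x)" and a: "a \<ge> 0"
    and v: "\<And>x. \<bar>v x\<bar> \<le> V x"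
  shows "integrable (lborel \<Otimes>\<^sub>M lborel) (\<lambda>(p, y). A p * causal_kernel m (fst p) (snd p - y) * v y)"
proof (rule integrableI_bounded)
  have V: "V x \<ge> 0" for x using order_trans[OF abs_ge_zero v] .
  let ?G = "\<lambda>s x y. ennreal (indicator {0<..<T} s * a * (decay x * \<bar>causal_kernel m s (x - y)\<bar> * V y))"
  note [measurable] = measurable_pair_lborel(1)[OF sets_lborel sets_lborel measurable_fst_borel]
    measurable_pair_lborel(1)[OF sets_lborel sets_lborel measurable_snd_borel]
    measurable_pair_lborel(1)[OF sets_lborel sets_lborel assms(1)]
    measurable_pair_lborel(2)[OF sets_lborel sets_lborel assms(2)]
  have Z: "(\<lambda>(p, y). A p * causal_kernel m (fst p) (snd p - y) * v y) \<in> borel_measurable (lborel \<Otimes>\<^sub>M lborel)"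
    unfolding case_prod_beta by measurable
  show "(\<lambda>(p, y). A p * causal_kernel m (fst p) (snd p - y) * v y) \<in> borel_measurable (lborel \<Otimes>\<^sub>M lborel)"
    by (rule Z)
  have "(\<integral>\<^sup>+z. ennreal (norm (case z of (p, y) \<Rightarrow> A p * causal_kernel m (fst p) (snd p - y) * v y)) \<partial>(lborel \<Otimes>\<^sub>M lborel))
     = (\<integral>\<^sup>+p. (\<integral>\<^sup>+y. ennreal (norm (A p * causal_kernel m (fst p) (snd p - y) * v y)) \<partial>lborel) \<partial>lborel)"
    using lborel.nn_integral_fst[of "\<lambda>z. ennreal (norm (case_prod (\<lambda>p y. A p * causal_kernel m (fst p) (snd p - y) * v y) z))" lborel] Z
    by simp
  also have "\<dots> \<le> (\<integral>\<^sup>+p. (\<integral>\<^sup>+y. ?G (fst p) (snd p) y \<partial>lborel) \<partial>lborel)"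
  proof (intro nn_integral_mono ennreal_leI)
    fix p :: "real \<times> (real ^ 'n)" and y
    obtain s x where p: "p = (s, x)" by force
    have "norm (A p * causal_kernel m (fst p) (snd p - y) * v y)
      \<le> (indicator {0<..<T} s * (a * decay x)) * \<bar>causal_kernel m s (x - y)\<bar> * V y"
      unfolding p using A[of s x] v[of y] a decay_pos[of x]
      by (auto simp: abs_mult intro!: mult_mono mult_nonneg_nonneg)
    then show "norm (A p * causal_kernel m (fst p) (snd p - y) * v y)
      \<le> indicator {0<..<T} (fst p) * a * (decay (snd p) * \<bar>causal_kernel m (fst p) (snd p - y)\<bar> * V y)"
      by (simp add: p mult_ac)
  qed
  also have "\<dots> = (\<integral>\<^sup>+s. (\<integral>\<^sup>+x. (\<integral>\<^sup>+y. ?G s x y \<partial>lborel) \<partial>lborel) \<partial>lborel)"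
    by (rule nn_integral_lborel_pair[of "\<lambda>s x. \<integral>\<^sup>+y. ?G s x y \<partial>lborel"]) measurable
  also have "\<dots> \<le> (\<integral>\<^sup>+s. ennreal (a * K) * indicator {0<..<T} s \<partial>lborel)"
  proof (intro nn_integral_mono)
    fix s :: real
    show "(\<integral>\<^sup>+x. (\<integral>\<^sup>+y. ?G s x y \<partial>lborel) \<partial>lborel) \<le> ennreal (a * K) * indicator {0<..<T} s"
    proof (cases "s \<in> {0<..<T}")
      case True
      then have "(\<integral>\<^sup>+x. (\<integral>\<^sup>+y. ?G s x y \<partial>lborel) \<partial>lborel)
        = ennreal a * (\<integral>\<^sup>+x. (\<integral>\<^sup>+y. ennreal (decay x * \<bar>polyharmonic_kernel m s (x - y)\<bar> * V y) \<partial>lborel) \<partial>lborel)"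
        using a by (simp add: ennreal_mult' causal_kernel_def nn_integral_cmult)
      also have "\<dots> \<le> ennreal a * ennreal K"
        using True K(2)[of s] by (intro mult_left_mono) auto
      finally show ?thesis using True a K(1) by (simp add: ennreal_mult)
    qed simp
  qed
  also have "\<dots> = ennreal (a * K) * ennreal (max 0 T)"
    by (cases "T \<ge> 0") (simp_all add: nn_integral_cmult)
  also have "\<dots> < \<infinity>"
    by (simp add: ennreal_mult_less_top)
  finally show "(\<integral>\<^sup>+z. ennreal (norm (case z of (p, y) \<Rightarrow> A p * causal_kernel m (fst p) (snd p - y) * v y)) \<partial>(lborel \<Otimes>\<^sub>M lborel)) < \<infinity>" .
qed

section \<open>From the Duhamel formula to the tested identity\<close>

lemma continuous_on_bcontfun_curve:
  fixes u :: "real \<Rightarrow> ('a::metric_space \<Rightarrow>\<^sub>C real)"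
  assumes "continuous_on {0..} u"
  shows "continuous_on UNIV (\<lambda>p. apply_bcontfun (u (max 0 (fst p))) (snd p))"
proof -
  define U where "U = (\<lambda>s. u (max 0 s))"
  have U: "continuous_on UNIV U"
    unfolding U_def by (rule continuous_on_compose2[OF assms]) (auto intro!: continuous_intros)
  have "((\<lambda>p. apply_bcontfun (U (fst p)) (snd p)) \<longlongrightarrow> apply_bcontfun (U s) x) (at (s, x))" for s x
  proof (rule Lim_null_comparison[THEN LIM_zero_cancel])
    have "((\<lambda>p. U (fst p)) \<longlongrightarrow> U s) (at (s, x))"
      using U by (intro isCont_tendsto_compose[where g=U])
        (auto simp: continuous_on_eq_continuous_at intro!: tendsto_eq_intros)
    then have "((\<lambda>p. dist (U (fst p)) (U s)) \<longlongrightarrow> 0) (at (s, x))"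
      by (rule tendsto_dist_iff[THEN iffD1])
    moreover have "((\<lambda>p. apply_bcontfun (U s) (snd p)) \<longlongrightarrow> apply_bcontfun (U s) x) (at (s, x))"
      by (rule continuous_on_tendsto_compose[of UNIV "apply_bcontfun (U s)"])
        (auto intro!: tendsto_eq_intros continuous_on_apply_bcontfun)
    then have "((\<lambda>p. \<bar>apply_bcontfun (U s) (snd p) - apply_bcontfun (U s) x\<bar>) \<longlongrightarrow> 0) (at (s, x))"
      by (intro tendsto_rabs_zero LIM_zero)
    ultimately show "((\<lambda>p. dist (U (fst p)) (U s) + \<bar>apply_bcontfun (U s) (snd p) - apply_bcontfun (U s) x\<bar>)
       \<longlongrightarrow> 0) (at (s, x))"
      by (auto intro: tendsto_eq_intros)
    have "norm (apply_bcontfun (U (fst p)) (snd p) - apply_bcontfun (U s) x)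
       \<le> dist (U (fst p)) (U s) + \<bar>apply_bcontfun (U s) (snd p) - apply_bcontfun (U s) x\<bar>" for p
      using dist_bounded[of "U (fst p)" "snd p" "U s"] by (simp add: dist_real_def)
    then show "\<forall>\<^sub>F p in at (s, x). norm (apply_bcontfun (U (fst p)) (snd p) - apply_bcontfun (U s) x)
       \<le> dist (U (fst p)) (U s) + \<bar>apply_bcontfun (U s) (snd p) - apply_bcontfun (U s) x\<bar>"
      by simp
  qed
  then show ?thesis
    unfolding U_def by (simp add: continuous_on_eq_continuous_at isCont_def)
qed

context polyharmonic_test
begin

text \<open>
  The space-time form of the backward evolution: integrated against the kernel issuing from \<open>(\<tau>,y)\<close>, the
  function \<open>\<eta> \<Lambda> - \<eta>' \<psi>\<close> returns \<open>\<eta>(\<tau>) \<psi>(y)\<close>.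
\<close>

lemma causal_kernel_tested:
  fixes \<eta> \<eta>' :: "real \<Rightarrow> real" and T :: real
  defines "A \<equiv> \<lambda>p. indicator {0<..<T} (fst p) * (\<eta> (fst p) * \<Lambda> (snd p) - \<eta>' (fst p) * \<psi> (snd p))"
  assumes der: "\<And>s. (\<eta> has_real_derivative \<eta>' s) (at s)" and cont: "continuous_on UNIV \<eta>'"
    and T: "\<eta> T = 0" "\<tau> < T" "0 \<le> \<tau>"
    and int: "integrable lborel (\<lambda>p. A p * causal_kernel m (fst p - \<tau>) (snd p - y))"
  shows "(\<integral>p. A p * causal_kernel m (fst p - \<tau>) (snd p - y) \<partial>lborel) = \<eta> \<tau> * \<psi> y"
proof -
  let ?g = "\<lambda>p. A p * causal_kernel m (fst p - \<tau>) (snd p - y)"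
  have "integral\<^sup>L lborel ?g = (\<integral>s. (\<integral>x. ?g (s, x) \<partial>lborel) \<partial>lborel)"
    using lborel_pair.integral_fst'[of ?g] int by (simp add: lborel_prod)
  also have "(\<lambda>s. \<integral>x. ?g (s, x) \<partial>lborel) = (\<lambda>s. indicator {\<tau><..<T} s *
      (\<integral>x. (\<eta> s * \<Lambda> x - \<eta>' s * \<psi> x) * polyharmonic_kernel m (s - \<tau>) (x - y) \<partial>lborel))"
  proof
    fix s
    show "(\<integral>x. ?g (s, x) \<partial>lborel) = indicator {\<tau><..<T} s *
      (\<integral>x. (\<eta> s * \<Lambda> x - \<eta>' s * \<psi> x) * polyharmonic_kernel m (s - \<tau>) (x - y) \<partial>lborel)"
    proof (cases "s \<in> {\<tau><..<T}")
      case True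
      then show ?thesis using T by (simp add: A_def causal_kernel_def)
    next
      case False
      then have "(\<lambda>x. ?g (s, x)) = (\<lambda>_. 0)" by (auto simp: A_def causal_kernel_def)
      then show ?thesis using False by (simp only:) simp
    qed
  qed
  also have "(\<integral>s. indicator {\<tau><..<T} s *
      (\<integral>x. (\<eta> s * \<Lambda> x - \<eta>' s * \<psi> x) * polyharmonic_kernel m (s - \<tau>) (x - y) \<partial>lborel) \<partial>lborel) = \<eta> \<tau> * \<psi> y"
    by (rule backward_evolution[OF der cont T(1,2)])
  finally show ?thesis .
qed

text \<open>
  Multiply the Duhamel formula by \<open>A = \<eta> \<Lambda> - \<eta>' \<psi>\<close>, integrate over space-time, and exchange the order of
  integration: the kernel is then integrated against \<open>A\<close>, which gives \<open>\<eta> \<psi>\<close> at the source point, and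
  \<open>\<eta>(0) \<psi>\<close> for the initial datum. The definition of mild solutions uses iterated integrals, which agree with
  the product integral at almost every \<open>(s,x)\<close>; that is enough under the outer integral.
\<close>

lemma mild_solution_tested:
  fixes u0 :: "(real ^ 'n) \<Rightarrow>\<^sub>C real" and \<eta> \<eta>' :: "real \<Rightarrow> real" and \<alpha> p T :: real
  defines "A \<equiv> \<lambda>p. indicator {0<..<T} (fst p) * (\<eta> (fst p) * \<Lambda> (snd p) - \<eta>' (fst p) * \<psi> (snd p))"
  defines "f \<equiv> \<lambda>u q. indicator {0<..<T} (fst q) * (norm (snd q) powr (- \<alpha>) * \<bar>apply_bcontfun (u (fst q)) (snd q)\<bar> powr p)"
  assumes sol: "global_mild_solution m \<alpha> p u0 u"
    and \<alpha>: "0 < \<alpha>" "\<alpha> < real CARD('n)" and p: "0 < p"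
    and der: "\<And>s. (\<eta> has_real_derivative \<eta>' s) (at s)" and cont: "continuous_on UNIV \<eta>'"
    and T: "\<eta> T = 0" "0 < T"
  shows "integrable lborel (\<lambda>q. f u q * (\<eta> (fst q) * \<psi> (snd q)))"
    and "integrable lborel (\<lambda>q. A q * apply_bcontfun (u (fst q)) (snd q))"
    and "(\<integral>q. f u q * (\<eta> (fst q) * \<psi> (snd q)) \<partial>lborel) + \<eta> 0 * (\<integral>x. apply_bcontfun u0 x * \<psi> x \<partial>lborel)
      = (\<integral>q. A q * apply_bcontfun (u (fst q)) (snd q) \<partial>lborel)"
proof -
  have u: "continuous_on {0..} u"
    and duhamel: "\<And>t x. t > 0 \<Longrightarrow> apply_bcontfun (u t) x =
        polyharmonic_semigroup m t (apply_bcontfun u0) x +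
        (LINT \<tau>:{0<..<t}|lborel. polyharmonic_semigroup m (t - \<tau>)
           (\<lambda>y. norm y powr (- \<alpha>) * \<bar>apply_bcontfun (u \<tau>) y\<bar> powr p) x)"
    using sol unfolding global_mild_solution_def by auto
  note [measurable] = measurable_fst_borel measurable_snd_borel
  \<comment> \<open>Freezing the curve at time \<open>0\<close> for negative times makes it jointly continuous on the whole space
      and does not change products with the indicator of \<open>(0, T)\<close>.\<close>
  define U where "U = (\<lambda>p. apply_bcontfun (u (max 0 (fst p))) (snd p))"
  have Um [measurable]: "U \<in> borel_measurable borel"
    unfolding U_def by (intro borel_measurable_continuous_onI continuous_on_bcontfun_curve u)
  have cont\<eta>: "continuous_on UNIV \<eta>"
    using der by (intro DERIV_continuous_on) (auto intro: has_field_derivative_at_within)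
  have [measurable]: "\<eta> \<in> borel_measurable borel" "\<eta>' \<in> borel_measurable borel"
    using cont\<eta> cont by (auto intro: borel_measurable_continuous_onI)
  have [measurable]: "A \<in> borel_measurable borel" unfolding A_def by measurable
  have fU: "f u = (\<lambda>q. indicator {0<..<T} (fst q) * (norm (snd q) powr (- \<alpha>) * \<bar>U q\<bar> powr p))"
    by (auto simp: f_def U_def fun_eq_iff indicator_def)
  have [measurable]: "f u \<in> borel_measurable borel" unfolding fU by measurable
  have AU: "A q * apply_bcontfun (u (fst q)) (snd q) = A q * U q" for q
    by (auto simp: A_def U_def indicator_def)
  obtain E where E: "E \<ge> 0" "\<And>s. s \<in> {0..T} \<Longrightarrow> \<bar>\<eta> s\<bar> \<le> E" "\<And>s. s \<in> {0..T} \<Longrightarrow> \<bar>\<eta>' s\<bar> \<le> E"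
    using continuous_pair_bounded[OF cont\<eta> cont, of 0 T] by blast
  define a where "a = 2 * E * C"
  have a: "a \<ge> 0" using E(1) C_nonneg by (simp add: a_def)
  have A: "\<bar>A (s, x)\<bar> \<le> indicator {0<..<T} s * (a * decay x)" for s x
  proof (cases "s \<in> {0<..<T}")
    case True
    have "\<bar>\<eta> s * \<Lambda> x\<bar> \<le> E * (C * decay x)" "\<bar>\<eta>' s * \<psi> x\<bar> \<le> E * (C * decay x)"
      unfolding abs_mult using True E(1)
      by (auto intro!: mult_mono[OF E(2) bound(2)] mult_mono[OF E(3) bound(1)])
    then have "\<bar>\<eta> s * \<Lambda> x - \<eta>' s * \<psi> x\<bar> \<le> a * decay x"
      using abs_triangle_ineq4[of "\<eta> s * \<Lambda> x" "\<eta>' s * \<psi> x"] by (simp add: a_def mult_ac)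
    then show ?thesis using True by (simp add: A_def)
  qed (simp add: A_def)
  obtain M where M: "M > 0" "\<And>s. s \<in> {0..T} \<Longrightarrow> norm (u s) \<le> M"
  proof -
    have "bounded (u ` {0..T})"
      by (auto intro!: compact_imp_bounded compact_continuous_image continuous_on_subset[OF u])
    then show thesis using that unfolding bounded_pos by auto
  qed
  define V where "V = (\<lambda>y::real^'n. M powr p * norm y powr (- \<alpha>))"
  have [measurable]: "V \<in> borel_measurable borel" unfolding V_def by measurable
  have Vf: "\<bar>f u (s, x)\<bar> \<le> indicator {0<..<T} s * V x" for s x
  proof (cases "s \<in> {0<..<T}")
    case True
    then have "\<bar>apply_bcontfun (u s) x\<bar> \<le> M"
      using norm_bounded[of "u s" x] M(2)[of s] by simp
    then have "\<bar>apply_bcontfun (u s) x\<bar> powr p \<le> M powr p"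
      using p by (intro powr_mono2) auto
    then have "norm x powr (- \<alpha>) * \<bar>apply_bcontfun (u s) x\<bar> powr p \<le> norm x powr (- \<alpha>) * M powr p"
      by (intro mult_left_mono) auto
    then show ?thesis using True by (simp add: f_def V_def mult.commute abs_mult)
  qed (simp add: f_def)
  obtain K where K: "K \<ge> 0" "\<And>r. r > 0 \<Longrightarrow> (\<integral>\<^sup>+x. (\<integral>\<^sup>+y. ennreal (decay x * \<bar>polyharmonic_kernel m r (x - y)\<bar> * V y) \<partial>lborel) \<partial>lborel)
     \<le> ennreal K"
  proof -
    let ?V1 = "\<lambda>y::real^'n. M powr p * (indicator (cball 0 1) y * norm y powr (- \<alpha>))"
    have "\<exists>K\<ge>0. \<forall>r>0. (\<integral>\<^sup>+x. (\<integral>\<^sup>+y. ennreal (decay x * \<bar>polyharmonic_kernel m r (x - y)\<bar> * V y) \<partial>lborel) \<partial>lborel)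
     \<le> ennreal K"
    proof (rule weighted_convolution_nn_integral[OF m, of V ?V1 "M powr p"])
      show "integrable lborel ?V1"
        using \<alpha> by (intro integrable_mult_right integrable_norm_powr_unit_ball) auto
      fix y :: "real^'n"
      have "norm y powr (- \<alpha>) \<le> indicator (cball 0 1) y * norm y powr (- \<alpha>) + 1"
      proof (cases "norm y \<le> 1")
        case False
        then have "norm y powr (- \<alpha>) \<le> norm y powr 0"
          using \<alpha> by (intro powr_mono) auto
        then show ?thesis using False by (auto split: if_splits)
      qed simp
      then have "M powr p * norm y powr (- \<alpha>) \<le> M powr p * (indicator (cball 0 1) y * norm y powr (- \<alpha>) + 1)"
        by (intro mult_left_mono) auto
      then show "V y \<le> ?V1 y + M powr p" by (simp add: V_def distrib_left)
    qed (auto simp: V_def)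
    then show thesis using that by blast
  qed
  obtain K0 where K0: "K0 \<ge> 0" "\<And>r. r > 0 \<Longrightarrow> (\<integral>\<^sup>+x. (\<integral>\<^sup>+y. ennreal (decay x * \<bar>polyharmonic_kernel m r (x - (y::real^'n))\<bar> * norm u0) \<partial>lborel) \<partial>lborel)
     \<le> ennreal K0"
    using weighted_convolution_nn_integral[OF m, of "\<lambda>_::real^'n. norm u0" "\<lambda>_. 0" "norm u0"] by auto
  have u0m [measurable]: "apply_bcontfun u0 \<in> borel_measurable borel"
    by (intro borel_measurable_continuous_onI continuous_on_apply_bcontfun)
  let ?Z = "\<lambda>p q. A p * causal_kernel m (fst p - fst q) (snd p - snd q) * f u q"
  let ?Y = "\<lambda>p y. A p * causal_kernel m (fst p) (snd p - y) * apply_bcontfun u0 y"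
  have Z: "integrable (lborel \<Otimes>\<^sub>M lborel) (\<lambda>(p, q). ?Z p q)"
    by (rule integrable_source_pairing[OF _ _ _ K A a Vf]) (auto simp: V_def)
  have Z0: "integrable (lborel \<Otimes>\<^sub>M lborel) (\<lambda>(p, y). ?Y p y)"
    using integrable_initial_pairing[where V="\<lambda>_. norm u0" and v="apply_bcontfun u0" and A=A, OF _ _ _ K0 A a]
      norm_bounded[of u0] by simp
  \<comment> \<open>Where \<open>f\<close> vanishes the section need not be integrable, but then both sides are zero.\<close>
  have src: "AE q in lborel. (\<integral>p. ?Z p q \<partial>lborel) = f u q * (\<eta> (fst q) * \<psi> (snd q))"
    using lborel_pair.AE_integrable_snd[OF Z]
  proof eventually_elim
    case (elim q)
    show ?case
    proof (cases "f u q = 0")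
      case False
      then have q: "0 < fst q" "fst q < T" by (auto simp: f_def indicator_def split: if_splits)
      have "integrable lborel (\<lambda>p. A p * causal_kernel m (fst p - fst q) (snd p - snd q))"
        using elim False by simp
      from causal_kernel_tested[OF der cont T(1) q(2) _ this[unfolded A_def]] q
      show ?thesis by (simp add: A_def mult_ac)
    qed simp
  qed
  have src0: "AE y in lborel. (\<integral>p. ?Y p y \<partial>lborel) = \<eta> 0 * (apply_bcontfun u0 y * \<psi> y)"
    using lborel_pair.AE_integrable_snd[OF Z0]
  proof eventually_elim
    case (elim y)
    show ?case
    proof (cases "apply_bcontfun u0 y = 0")
      case False
      have "integrable lborel (\<lambda>p. A p * causal_kernel m (fst p - 0) (snd p - y))"
        using elim False by simp
      from causal_kernel_tested[OF der cont T(1) T(2) _ this[unfolded A_def]]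
      show ?thesis by (simp add: A_def mult_ac)
    qed simp
  qed
  \<comment> \<open>Integrating out the source point first gives back the Duhamel formula, multiplied by \<open>A\<close>.\<close>
  have sol': "AE p in lborel. (\<integral>y. ?Y p y \<partial>lborel) + (\<integral>q. ?Z p q \<partial>lborel) = A p * U p"
    using lborel_pair.AE_integrable_fst[OF Z]
  proof eventually_elim
    case (elim z)
    obtain s x where px: "z = (s, x)" by force
    show ?case
    proof (cases "s \<in> {0<..<T}")
      case False
      then have "A z = 0" by (simp add: A_def px)
      then show ?thesis by simp
    next
      case True
      have 0: "(\<integral>y. ?Y z y \<partial>lborel) = A z * polyharmonic_semigroup m s (apply_bcontfun u0) x"
        using True by (simp add: px causal_kernel_def polyharmonic_semigroup_def mult.assoc)
      have "(\<integral>q. ?Z z q \<partial>lborel) = (\<integral>\<tau>. (\<integral>y. ?Z z (\<tau>, y) \<partial>lborel) \<partial>lborel)"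
        using lborel_pair.integral_fst'[of "?Z z"] elim by (simp add: lborel_prod)
      also have "\<dots> = (\<integral>\<tau>. A z * (indicator {0<..<s} \<tau> *\<^sub>R polyharmonic_semigroup m (s - \<tau>)
           (\<lambda>y. norm y powr (- \<alpha>) * \<bar>apply_bcontfun (u \<tau>) y\<bar> powr p) x) \<partial>lborel)"
      proof (intro Bochner_Integration.integral_cong refl)
        fix \<tau>
        show "(\<integral>y. ?Z z (\<tau>, y) \<partial>lborel) = A z * (indicator {0<..<s} \<tau> *\<^sub>R polyharmonic_semigroup m (s - \<tau>)
           (\<lambda>y. norm y powr (- \<alpha>) * \<bar>apply_bcontfun (u \<tau>) y\<bar> powr p) x)"
        proof (cases "\<tau> \<in> {0<..<s}")
          case \<tau>: True
          then show ?thesis using True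
            by (simp add: px causal_kernel_def f_def polyharmonic_semigroup_def mult.assoc)
        next
          case \<tau>: False
          then have "(\<lambda>y. ?Z z (\<tau>, y)) = (\<lambda>_. 0)" by (auto simp: px causal_kernel_def f_def)
          then show ?thesis using \<tau> by (simp only:) simp
        qed
      qed
      also have "\<dots> = A z * (LINT \<tau>:{0<..<s}|lborel. polyharmonic_semigroup m (s - \<tau>)
           (\<lambda>y. norm y powr (- \<alpha>) * \<bar>apply_bcontfun (u \<tau>) y\<bar> powr p) x)"
        by (simp add: set_lebesgue_integral_def)
      finally have 1: "(\<integral>q. ?Z z q \<partial>lborel) = A z * (LINT \<tau>:{0<..<s}|lborel. polyharmonic_semigroup m (s - \<tau>)
           (\<lambda>y. norm y powr (- \<alpha>) * \<bar>apply_bcontfun (u \<tau>) y\<bar> powr p) x)" .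
      have "U z = apply_bcontfun (u s) x" using True by (simp add: U_def px)
      then show ?thesis
        unfolding 0 1 using duhamel[of s x] True by (simp add: distrib_left)
    qed
  qed
  have i1: "integrable lborel (\<lambda>p. \<integral>q. ?Z p q \<partial>lborel)" and i0: "integrable lborel (\<lambda>p. \<integral>y. ?Y p y \<partial>lborel)"
    and j1: "integrable lborel (\<lambda>q. \<integral>p. ?Z p q \<partial>lborel)" and j0: "integrable lborel (\<lambda>y. \<integral>p. ?Y p y \<partial>lborel)"
    by (rule lborel_pair.integrable_fst[OF Z] lborel_pair.integrable_fst[OF Z0]
        lborel_pair.integrable_snd[OF Z] lborel_pair.integrable_snd[OF Z0])+
  have mf: "(\<lambda>q. f u q * (\<eta> (fst q) * \<psi> (snd q))) \<in> borel_measurable lborel"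
    and m0: "(\<lambda>y. \<eta> 0 * (apply_bcontfun u0 y * \<psi> y)) \<in> borel_measurable lborel"
    and mA: "(\<lambda>p. A p * U p) \<in> borel_measurable lborel"
    by measurable
  show "integrable lborel (\<lambda>q. f u q * (\<eta> (fst q) * \<psi> (snd q)))"
    using j1 integrable_cong_AE[OF borel_measurable_integrable[OF j1] mf src] by simp
  show "integrable lborel (\<lambda>q. A q * apply_bcontfun (u (fst q)) (snd q))"
    unfolding AU
    using Bochner_Integration.integrable_add[OF i0 i1]
      integrable_cong_AE[OF borel_measurable_integrable[OF Bochner_Integration.integrable_add[OF i0 i1]] mA sol'] by simp
  have "(\<integral>q. A q * U q \<partial>lborel) = (\<integral>p. (\<integral>y. ?Y p y \<partial>lborel) + (\<integral>q. ?Z p q \<partial>lborel) \<partial>lborel)"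
    using integral_cong_AE[OF borel_measurable_integrable[OF Bochner_Integration.integrable_add[OF i0 i1]] mA sol'] by simp
  also have "\<dots> = (\<integral>p. (\<integral>y. ?Y p y \<partial>lborel) \<partial>lborel) + (\<integral>p. (\<integral>q. ?Z p q \<partial>lborel) \<partial>lborel)"
    by (rule Bochner_Integration.integral_add[OF i0 i1])
  also have "(\<integral>p. (\<integral>y. ?Y p y \<partial>lborel) \<partial>lborel) = (\<integral>y. (\<integral>p. ?Y p y \<partial>lborel) \<partial>lborel)"
    by (rule lborel_pair.Fubini_integral[OF Z0, symmetric])
  also have "\<dots> = (\<integral>y. \<eta> 0 * (apply_bcontfun u0 y * \<psi> y) \<partial>lborel)"
    by (rule integral_cong_AE[OF borel_measurable_integrable[OF j0] m0 src0])
  also have "(\<integral>p. (\<integral>q. ?Z p q \<partial>lborel) \<partial>lborel) = (\<integral>q. (\<integral>p. ?Z p q \<partial>lborel) \<partial>lborel)"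
    by (rule lborel_pair.Fubini_integral[OF Z, symmetric])
  also have "\<dots> = (\<integral>q. f u q * (\<eta> (fst q) * \<psi> (snd q)) \<partial>lborel)"
    by (rule integral_cong_AE[OF borel_measurable_integrable[OF j1] mf src])
  finally show "(\<integral>q. f u q * (\<eta> (fst q) * \<psi> (snd q)) \<partial>lborel) + \<eta> 0 * (\<integral>x. apply_bcontfun u0 x * \<psi> x \<partial>lborel)
      = (\<integral>q. A q * apply_bcontfun (u (fst q)) (snd q) \<partial>lborel)"
    unfolding AU by (simp add: mult.assoc)
qed

end

section \<open>Gaussian test functions and nonexistence\<close>

text \<open>
  Young's inequality with a nonoptimal constant: either the nonlinear term already dominates, or \<open>v\<close> lies
  below the threshold \<open>(b/w)\<^sup>1\<^sup>/\<^sup>(\<^sup>p\<^sup>-\<^sup>1\<^sup>)\<close> at which the two terms balance.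
\<close>

lemma young_threshold:
  fixes b w v p :: real
  assumes p: "p > 1" and "b \<ge> 0" "w > 0" "v \<ge> 0"
  shows "b * v \<le> w * v powr p + b * (b / w) powr (1 / (p - 1))"
proof (cases "b \<le> w * v powr (p - 1)")
  case True
  then have "b * v \<le> (w * v powr (p - 1)) * v"
    using assms by (intro mult_right_mono) auto
  also have "\<dots> = w * v powr p"
    using assms powr_add[of v "p - 1" 1] by (cases "v = 0") (auto simp: mult.assoc)
  finally show ?thesis
    using mult_nonneg_nonneg[OF assms(2) powr_ge_zero[of "b / w" "1 / (p - 1)"]] by linarith
next
  case False
  then have "v powr (p - 1) \<le> b / w"
    using assms by (simp add: pos_le_divide_eq mult.commute)
  then have "(v powr (p - 1)) powr (1 / (p - 1)) \<le> (b / w) powr (1 / (p - 1))"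
    using p by (intro powr_mono2) auto
  then have "v \<le> (b / w) powr (1 / (p - 1))"
    using assms by (cases "v = 0") (auto simp: powr_powr)
  then have "b * v \<le> b * (b / w) powr (1 / (p - 1))"
    using assms by (intro mult_left_mono) auto
  moreover have "0 \<le> w * v powr p" using assms by simp
  ultimately show ?thesis by linarith
qed

text \<open>
  The Gaussian of width \<open>R\<close> is an admissible test function, with \<open>(-\<Delta>)\<^sup>m\<close> of it obtained by scaling. Its
  inversion formula is the Gaussian Fourier integral once more, read with the roles of \<open>x\<close> and \<open>\<xi>\<close> exchanged.
\<close>

lemma scaled_gaussian_test:
  fixes \<Lambda> :: "real ^ 'n \<Rightarrow> real"
  assumes m: "m > 0" and R: "R > 0"
    and meas [measurable]: "\<Lambda> \<in> borel_measurable borel" and even: "\<And>x. \<Lambda> (- x) = \<Lambda> x"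
    and C: "C \<ge> 0" and bound: "\<And>x. \<bar>\<Lambda> x\<bar> \<le> C * (1 + (norm x)\<^sup>2) ^ N * exp (- (norm x)\<^sup>2 / 2)"
    and ft: "\<And>\<xi>. (\<integral>x. cos (x \<bullet> \<xi>) * \<Lambda> x \<partial>lborel)
      = norm \<xi> ^ (2 * m) * (sqrt (2 * pi) ^ CARD('n) * exp (- (norm \<xi>)\<^sup>2 / 2))"
  shows "\<exists>C. polyharmonic_test m (\<lambda>x. exp (- (norm (x /\<^sub>R R))\<^sup>2 / 2)) (\<lambda>x. \<Lambda> (x /\<^sub>R R) / R ^ (2 * m))
    (\<lambda>\<xi>. R ^ CARD('n) * (sqrt (2 * pi) ^ CARD('n) * exp (- (norm (R *\<^sub>R \<xi>))\<^sup>2 / 2))) C"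
proof -
  let ?s = "sqrt (2 * pi) ^ CARD('n)"
  let ?\<psi>h = "\<lambda>\<xi>::real^'n. R ^ CARD('n) * (?s * exp (- (norm (R *\<^sub>R \<xi>))\<^sup>2 / 2))"
  define c where "c = R\<^sup>2 / 2"
  define d where "d = inverse (R\<^sup>2) / 2"
  have cd: "c > 0" "d > 0" using R by (auto simp: c_def d_def)
  have e1: "exp (- (norm (R *\<^sub>R \<xi>))\<^sup>2 / 2) = exp (- c * (norm \<xi>)\<^sup>2)" for \<xi> :: "real^'n"
    by (simp add: c_def power_mult_distrib)
  have e2: "exp (- (norm (x /\<^sub>R R))\<^sup>2 / 2) = exp (- d * (norm x)\<^sup>2)" for x :: "real^'n"
    by (simp add: d_def power_mult_distrib power_inverse)
  obtain C1 where C1: "C1 \<ge> 0" "\<And>x::real^'n. (1 + (norm x)\<^sup>2) ^ 0 * exp (- d * (norm x)\<^sup>2) \<le> C1 * decay x"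
    using gaussian_le_decay[OF cd(2)] by blast
  obtain C2 where C2: "C2 \<ge> 0" "\<And>x::real^'n. (1 + (norm x)\<^sup>2) ^ N * exp (- d * (norm x)\<^sup>2) \<le> C2 * decay x"
    using gaussian_le_decay[OF cd(2)] by blast
  obtain C3 where C3: "C3 \<ge> 0" "\<And>x::real^'n. (1 + (norm x)\<^sup>2) ^ m * exp (- c * (norm x)\<^sup>2) \<le> C3 * decay x"
    using gaussian_le_decay[OF cd(1)] by blast
  define L where "L = C / R ^ (2 * m) * (1 + inverse (R\<^sup>2)) ^ N * C2"
  define G where "G = R ^ CARD('n) * ?s * C3"
  have L: "L \<ge> 0" and G: "G \<ge> 0" using C R C2(1) C3(1) by (auto simp: L_def G_def)
  have bL: "\<bar>\<Lambda> (x /\<^sub>R R) / R ^ (2 * m)\<bar> \<le> L * decay x" for x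
  proof -
    have "1 + (norm (x /\<^sub>R R))\<^sup>2 \<le> (1 + inverse (R\<^sup>2)) * (1 + (norm x)\<^sup>2)"
      by (simp add: power_mult_distrib power_inverse algebra_simps)
    then have "(1 + (norm (x /\<^sub>R R))\<^sup>2) ^ N \<le> ((1 + inverse (R\<^sup>2)) * (1 + (norm x)\<^sup>2)) ^ N"
      by (intro power_mono) auto
    then have "C * (1 + (norm (x /\<^sub>R R))\<^sup>2) ^ N * exp (- (norm (x /\<^sub>R R))\<^sup>2 / 2)
      \<le> C * ((1 + inverse (R\<^sup>2)) * (1 + (norm x)\<^sup>2)) ^ N * exp (- (norm (x /\<^sub>R R))\<^sup>2 / 2)"
      using C by (intro mult_right_mono mult_left_mono) auto
    then have "\<bar>\<Lambda> (x /\<^sub>R R)\<bar> \<le> C * (1 + inverse (R\<^sup>2)) ^ N * ((1 + (norm x)\<^sup>2) ^ N * exp (- d * (norm x)\<^sup>2))"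
      using bound[of "x /\<^sub>R R"] unfolding e2 power_mult_distrib by (simp only: mult.assoc)
    also have "\<dots> \<le> C * (1 + inverse (R\<^sup>2)) ^ N * (C2 * decay x)"
      using C R C2(2)[of x] by (intro mult_left_mono) auto
    finally have "\<bar>\<Lambda> (x /\<^sub>R R)\<bar> / R ^ (2 * m) \<le> (C * (1 + inverse (R\<^sup>2)) ^ N * (C2 * decay x)) / R ^ (2 * m)"
      using R by (intro divide_right_mono) auto
    then show ?thesis using R by (simp add: L_def mult_ac)
  qed
  have np: "(norm \<xi>) ^ (2 * m) \<le> (1 + (norm \<xi>)\<^sup>2) ^ m" "1 \<le> (1 + (norm \<xi>)\<^sup>2) ^ m" for \<xi> :: "real^'n"
    unfolding power_mult by (auto intro!: power_mono one_le_power)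
  have bh: "a * \<bar>?\<psi>h \<xi>\<bar> \<le> G * decay \<xi>" if "0 \<le> a" "a \<le> (1 + (norm \<xi>)\<^sup>2) ^ m" for \<xi> :: "real^'n" and a
  proof -
    have "a * \<bar>?\<psi>h \<xi>\<bar> = R ^ CARD('n) * ?s * (a * exp (- c * (norm \<xi>)\<^sup>2))"
      using R unfolding e1 by (simp add: abs_mult)
    also have "a * exp (- c * (norm \<xi>)\<^sup>2) \<le> (1 + (norm \<xi>)\<^sup>2) ^ m * exp (- c * (norm \<xi>)\<^sup>2)"
      using that by (intro mult_right_mono) auto
    also note C3(2)[of \<xi>]
    finally show ?thesis using R by (simp add: G_def mult_left_mono mult_ac)
  qed
  define B where "B = C1 + L + G"
  have B: "z \<le> C1 * decay x \<Longrightarrow> z \<le> B * decay x" "z \<le> L * decay x \<Longrightarrow> z \<le> B * decay x"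
    "z \<le> G * decay x \<Longrightarrow> z \<le> B * decay x" for z and x :: "real^'n"
  proof -
    have "C1 * decay x \<le> B * decay x" "L * decay x \<le> B * decay x" "G * decay x \<le> B * decay x"
      using C1(1) L G decay_pos[of x] by (auto simp: B_def intro!: mult_right_mono)
    then show "z \<le> C1 * decay x \<Longrightarrow> z \<le> B * decay x" "z \<le> L * decay x \<Longrightarrow> z \<le> B * decay x"
      "z \<le> G * decay x \<Longrightarrow> z \<le> B * decay x"
      by linarith+
  qed
  have "polyharmonic_test m (\<lambda>x. exp (- (norm (x /\<^sub>R R))\<^sup>2 / 2)) (\<lambda>x. \<Lambda> (x /\<^sub>R R) / R ^ (2 * m)) ?\<psi>h B"
  proof
    show "\<bar>exp (- (norm (x /\<^sub>R R))\<^sup>2 / 2)\<bar> \<le> B * decay x" for x :: "real^'n"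
      using C1(2)[of x] unfolding e2 by (intro B(1)) simp
    show "\<bar>\<Lambda> (x /\<^sub>R R) / R ^ (2 * m)\<bar> \<le> B * decay x" for x
      by (intro B(2) bL)
    show "\<bar>?\<psi>h \<xi>\<bar> \<le> B * decay \<xi>" for \<xi> :: "real^'n"
      using bh[of 1 \<xi>] np(2)[of \<xi>] by (intro B(3)) simp
    show "norm \<xi> ^ (2 * m) * \<bar>?\<psi>h \<xi>\<bar> \<le> B * decay \<xi>" for \<xi> :: "real^'n"
      using bh[of "norm \<xi> ^ (2 * m)" \<xi>] np(1)[of \<xi>] by (intro B(3)) simp
    show "\<Lambda> (- x /\<^sub>R R) / R ^ (2 * m) = \<Lambda> (x /\<^sub>R R) / R ^ (2 * m)" for x
      using even[of "x /\<^sub>R R"] by simp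
    have "sqrt (2 * pi / inverse (R\<^sup>2)) = R * sqrt (2 * pi)"
    proof -
      have "2 * pi / inverse (R\<^sup>2) = R\<^sup>2 * (2 * pi)" by (simp add: divide_inverse)
      then show ?thesis using R by (simp only: real_sqrt_mult real_sqrt_abs abs_of_pos)
    qed
    then have gs: "sqrt (2 * pi / inverse (R\<^sup>2)) ^ CARD('n) = R ^ CARD('n) * ?s"
      by (simp only: power_mult_distrib)
    have e3: "exp (- inverse (R\<^sup>2) * (norm x)\<^sup>2 / 2) = exp (- d * (norm x)\<^sup>2)"
      "exp (- (norm x)\<^sup>2 / (2 * inverse (R\<^sup>2))) = exp (- c * (norm x)\<^sup>2)" for x :: "real^'n"
      using R by (simp_all add: d_def c_def field_simps)
    show "(\<integral>x. cos (x \<bullet> \<xi>) * exp (- (norm (x /\<^sub>R R))\<^sup>2 / 2) \<partial>lborel) = ?\<psi>h \<xi>" for \<xi> :: "real^'n"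
      using gaussian_fourier[of "inverse (R\<^sup>2)" \<xi>] R unfolding e2 e1 e3
      by (simp add: gs mult.assoc)
    show "(\<integral>x. cos (x \<bullet> \<xi>) * (\<Lambda> (x /\<^sub>R R) / R ^ (2 * m)) \<partial>lborel) = norm \<xi> ^ (2 * m) * ?\<psi>h \<xi>" for \<xi>
    proof -
      have "(\<integral>x. cos (x \<bullet> \<xi>) * (\<Lambda> (x /\<^sub>R R) / R ^ (2 * m)) \<partial>lborel)
        = R ^ CARD('n) * (\<integral>x. cos ((0 + R *\<^sub>R x) \<bullet> \<xi>) * (\<Lambda> ((0 + R *\<^sub>R x) /\<^sub>R R) / R ^ (2 * m)) \<partial>lborel)"
        using R by (subst lborel_affine_integral[of R _ 0]) auto
      also have "(\<lambda>x. cos ((0 + R *\<^sub>R x) \<bullet> \<xi>) * (\<Lambda> ((0 + R *\<^sub>R x) /\<^sub>R R) / R ^ (2 * m)))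
        = (\<lambda>x. (cos (x \<bullet> (R *\<^sub>R \<xi>)) * \<Lambda> x) / R ^ (2 * m))"
        using R by auto
      also have "R ^ CARD('n) * (\<integral>x. (cos (x \<bullet> (R *\<^sub>R \<xi>)) * \<Lambda> x) / R ^ (2 * m) \<partial>lborel) = norm \<xi> ^ (2 * m) * ?\<psi>h \<xi>"
        using R ft[of "R *\<^sub>R \<xi>"] by (simp add: power_mult_distrib)
      finally show ?thesis .
    qed
    show "(\<integral>\<xi>. cos (y \<bullet> \<xi>) * ?\<psi>h \<xi> \<partial>lborel) = (2 * pi) ^ CARD('n) * exp (- (norm (y /\<^sub>R R))\<^sup>2 / 2)" for y :: "real^'n"
    proof -
      have "(\<integral>\<xi>. cos (y \<bullet> \<xi>) * ?\<psi>h \<xi> \<partial>lborel) = R ^ CARD('n) * ?s *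
          (\<integral>\<xi>. cos (\<xi> \<bullet> y) * exp (- R\<^sup>2 * (norm \<xi>)\<^sup>2 / 2) \<partial>lborel)"
      proof -
        have "(\<lambda>\<xi>. cos (y \<bullet> \<xi>) * ?\<psi>h \<xi>)
          = (\<lambda>\<xi>. (R ^ CARD('n) * ?s) * (cos (\<xi> \<bullet> y) * exp (- R\<^sup>2 * (norm \<xi>)\<^sup>2 / 2)))"
          by (simp add: inner_commute[of y] power_mult_distrib mult_ac)
        then show ?thesis by (simp only: integral_mult_right_zero)
      qed
      also have "\<dots> = R ^ CARD('n) * ?s * (sqrt (2 * pi / R\<^sup>2) ^ CARD('n) * exp (- (norm y)\<^sup>2 / (2 * R\<^sup>2)))"
        using R by (subst gaussian_fourier) auto
      also have "sqrt (2 * pi / R\<^sup>2) ^ CARD('n) = ?s / R ^ CARD('n)"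
        using R by (simp add: real_sqrt_divide power_divide)
      also have "exp (- (norm y)\<^sup>2 / (2 * R\<^sup>2)) = exp (- (norm (y /\<^sub>R R))\<^sup>2 / 2)"
        using R unfolding e2 by (simp add: d_def field_simps)
      also have "R ^ CARD('n) * ?s * (?s / R ^ CARD('n) * exp (- (norm (y /\<^sub>R R))\<^sup>2 / 2))
        = (?s * ?s) * exp (- (norm (y /\<^sub>R R))\<^sup>2 / 2)"
        using R by simp
      also have "?s * ?s = (2 * pi) ^ CARD('n)"
        unfolding power_mult_distrib[symmetric] by simp
      finally show ?thesis .
    qed
  qed (use m even in auto)
  then show ?thesis by blast
qed

text \<open>
  Bounds the error term left by Young's inequality, in the rescaled variable \<open>z = x/R\<close>.
\<close>

lemma profile_le_decay:
  fixes \<alpha> \<beta> C :: real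
  assumes "\<alpha> > 0" "\<beta> > 0" "C > 0"
  shows "\<exists>D\<ge>0. \<forall>z::'a::euclidean_space. (C * (1 + (norm z)\<^sup>2) ^ N) *
    ((C * (1 + (norm z)\<^sup>2) ^ N) * norm z powr \<alpha>) powr \<beta> * exp (- (norm z)\<^sup>2 / 2) \<le> D * decay z"
proof -
  \<comment> \<open>All real powers of \<open>1 + |z|\<^sup>2\<close> are rounded up to integer ones, which the Gaussian absorbs.\<close>
  obtain L :: nat where L: "\<alpha> \<le> real L" using real_arch_simple by blast
  obtain Q :: nat where Q: "real (N + L) * \<beta> \<le> real Q" using real_arch_simple by blast
  obtain D where D: "D \<ge> 0" "\<And>z::'a. (1 + (norm z)\<^sup>2) ^ (N + Q) * exp (- (1 / 2) * (norm z)\<^sup>2) \<le> D * decay z"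
    using gaussian_le_decay[of "1 / 2" "N + Q", where 'a='a] by auto
  have "(C * (1 + (norm z)\<^sup>2) ^ N) * ((C * (1 + (norm z)\<^sup>2) ^ N) * norm z powr \<alpha>) powr \<beta> * exp (- (norm z)\<^sup>2 / 2)
      \<le> (C * C powr \<beta> * D) * decay z" for z :: 'a
  proof -
    let ?r = "1 + (norm z)\<^sup>2"
    have r: "?r \<ge> 1" "?r > 0" by (auto simp: add_pos_nonneg)
    have "norm z \<le> ?r"
    proof -
      have "2 * norm z \<le> (norm z)\<^sup>2 + 1"
        using sum_squares_bound[of "norm z" 1] by simp
      moreover have "0 \<le> norm z" by simp
      ultimately show ?thesis by linarith
    qed
    then have "norm z powr \<alpha> \<le> ?r powr \<alpha>" using assms by (intro powr_mono2) auto
    also have "\<dots> \<le> ?r powr real L" using L r by (intro powr_mono) auto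
    also have "\<dots> = ?r ^ L" using r by (simp add: powr_realpow)
    finally have "(C * ?r ^ N) * norm z powr \<alpha> \<le> (C * ?r ^ N) * ?r ^ L"
      using assms r by (intro mult_left_mono) auto
    also have "\<dots> = C * ?r ^ (N + L)" by (simp add: power_add)
    finally have "((C * ?r ^ N) * norm z powr \<alpha>) powr \<beta> \<le> (C * ?r ^ (N + L)) powr \<beta>"
      using assms r by (intro powr_mono2) auto
    also have "\<dots> = C powr \<beta> * ?r powr (real (N + L) * \<beta>)"
      using assms r by (simp add: powr_mult powr_powr flip: powr_realpow)
    also have "\<dots> \<le> C powr \<beta> * ?r powr real Q"
      using Q r by (intro mult_left_mono powr_mono) auto
    also have "\<dots> = C powr \<beta> * ?r ^ Q" using r by (simp add: powr_realpow)
    finally have "(C * ?r ^ N) * ((C * ?r ^ N) * norm z powr \<alpha>) powr \<beta> * exp (- (norm z)\<^sup>2 / 2)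
       \<le> (C * ?r ^ N) * (C powr \<beta> * ?r ^ Q) * exp (- (norm z)\<^sup>2 / 2)"
      using assms r by (intro mult_right_mono mult_left_mono) auto
    also have "\<dots> = C * C powr \<beta> * (?r ^ (N + Q) * exp (- (1 / 2) * (norm z)\<^sup>2))"
      by (simp add: power_add mult_ac)
    also have "\<dots> \<le> C * C powr \<beta> * (D * decay z)"
      using assms D(2)[of z] by (intro mult_left_mono) auto
    finally show ?thesis by (simp add: mult_ac)
  qed
  then show ?thesis using D(1) assms by (intro exI[of _ "C * C powr \<beta> * D"]) auto
qed

theorem theorem2p6:
  fixes m :: nat and \<alpha> p :: real and u0 :: "(real ^ 'n) \<Rightarrow>\<^sub>C real"
  assumes "0 < \<alpha>" and "\<alpha> < min (real CARD('n)) (2 * real m)"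
    and "1 < p" and "p < 1 + (2 * real m - \<alpha>) / real CARD('n)"
    and "u0 \<in> C0" and "integrable lborel (apply_bcontfun u0)"
    and "(LINT x|lborel. apply_bcontfun u0 x) > 0"
  shows "\<not> (\<exists>u. global_mild_solution m \<alpha> p u0 u)"
proof
  assume "\<exists>u. global_mild_solution m \<alpha> p u0 u"
  then obtain u where sol: "global_mild_solution m \<alpha> p u0 u" by blast
  note \<alpha> = assms(1,2) and p = assms(3,4)
  have m: "m > 0" using \<alpha> by (cases m) auto
  define \<beta> where "\<beta> = 1 / (p - 1)"
  have \<beta>: "\<beta> > 0" using p by (simp add: \<beta>_def)
  obtain \<Lambda> :: "real ^ 'n \<Rightarrow> real" and C N where \<Lambda>: "\<Lambda> \<in> borel_measurable borel" "\<And>x. \<Lambda> (- x) = \<Lambda> x"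
    "C \<ge> 0" "\<And>x. \<bar>\<Lambda> x\<bar> \<le> C * (1 + (norm x)\<^sup>2) ^ N * exp (- (norm x)\<^sup>2 / 2)"
    "\<And>\<xi>. (\<integral>x. cos (x \<bullet> \<xi>) * \<Lambda> x \<partial>lborel)
      = norm \<xi> ^ (2 * m) * (sqrt (2 * pi) ^ CARD('n) * exp (- (norm \<xi>)\<^sup>2 / 2))"
    using gaussian_polyharmonic_exists[of m, where 'a="real ^ 'n"] by auto
  \<comment> \<open>With \<open>k \<ge> p / (p - 1)\<close> the cut-off \<open>\<eta> = (1 - s/T)\<^sup>k\<close> satisfies \<open>|\<eta>'| \<le> (k/T) \<eta>\<^sup>1\<^sup>/\<^sup>p\<close>, the power of \<open>\<eta>\<close>
      that Young's inequality can absorb into \<open>\<eta> |u|\<^sup>p\<close>.\<close>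
  obtain k :: nat where k: "p / (p - 1) \<le> real k" using real_arch_simple by blast
  have k0: "k > 0"
  proof (rule ccontr)
    assume "\<not> k > 0"
    then have "p / (p - 1) \<le> 0" using k by simp
    moreover have "p / (p - 1) > 0" using p by simp
    ultimately show False by linarith
  qed
  have k1: "real k / p \<le> real (k - 1)"
  proof -
    have "p \<le> real k * (p - 1)" using k p by (simp add: pos_divide_le_eq)
    then have "real k \<le> (real k - 1) * p" by (simp add: algebra_simps)
    then show ?thesis using p k0 by (simp add: pos_divide_le_eq of_nat_diff)
  qed
  define h where "h = (\<lambda>z::real ^ 'n. (C + real k) * (1 + (norm z)\<^sup>2) ^ N)"
  define J where "J = (\<lambda>z::real ^ 'n. h z * (h z * norm z powr \<alpha>) powr \<beta> * exp (- (norm z)\<^sup>2 / 2))"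
  have h: "h z > 0" for z using \<Lambda>(3) k0 unfolding h_def
    by (intro mult_pos_pos zero_less_power add_pos_nonneg add_nonneg_pos) auto
  obtain D where D: "D \<ge> 0" "\<And>z. J z \<le> D * decay z"
    using profile_le_decay[of \<alpha> \<beta> "C + real k" N, where 'a="real ^ 'n"] \<alpha>(1) \<beta> \<Lambda>(3) k0
    unfolding J_def h_def by auto
  have J0: "J z \<ge> 0" for z unfolding J_def using h[of z] by simp
  have Jm [measurable]: "J \<in> borel_measurable borel" unfolding J_def h_def by measurable
  have Ji: "integrable lborel J"
    using D(2) J0 by (intro integrable_bounded_by_decay[where C=D]) auto
  define I where "I = (\<integral>z. J z \<partial>lborel)"
  define \<gamma> where "\<gamma> = (2 * real m - \<alpha>) * \<beta> - real CARD('n)"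
  have \<gamma>: "\<gamma> > 0"
  proof -
    have "(p - 1) * real CARD('n) < 2 * real m - \<alpha>"
      using p(2) by (simp add: field_simps)
    then show ?thesis using p by (simp add: \<gamma>_def \<beta>_def field_simps)
  qed
  have key: "(\<integral>x. apply_bcontfun u0 x * exp (- (norm (x /\<^sub>R R))\<^sup>2 / 2) \<partial>lborel) \<le> R powr (- \<gamma>) * I" if R: "R > 0" for R
  proof -
    \<comment> \<open>Parabolic scaling: \<open>\<eta>'\<close> and \<open>(-\<Delta>)\<^sup>m\<close> applied to the Gaussian of width \<open>R\<close> are both of order \<open>1/T\<close>.\<close>
    define T where "T = R ^ (2 * m)"
    have T: "T > 0" using R by (simp add: T_def)
    define \<psi> where "\<psi> = (\<lambda>x::real ^ 'n. exp (- (norm (x /\<^sub>R R))\<^sup>2 / 2))"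
    define \<Lambda>R where "\<Lambda>R = (\<lambda>x. \<Lambda> (x /\<^sub>R R) / R ^ (2 * m))"
    define \<eta> where "\<eta> = (\<lambda>s. (1 - s / T) ^ k)"
    define \<eta>' where "\<eta>' = (\<lambda>s. - (real k / T) * (1 - s / T) ^ (k - 1))"
    obtain C' where "polyharmonic_test m \<psi> \<Lambda>R
       (\<lambda>\<xi>. R ^ CARD('n) * (sqrt (2 * pi) ^ CARD('n) * exp (- (norm (R *\<^sub>R \<xi>))\<^sup>2 / 2))) C'"
      using scaled_gaussian_test[OF m R \<Lambda>] unfolding \<psi>_def \<Lambda>R_def by blast
    then interpret polyharmonic_test m \<psi> \<Lambda>R
       "\<lambda>\<xi>. R ^ CARD('n) * (sqrt (2 * pi) ^ CARD('n) * exp (- (norm (R *\<^sub>R \<xi>))\<^sup>2 / 2))" C' .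
    have der: "(\<eta> has_real_derivative \<eta>' s) (at s)" for s
      unfolding \<eta>_def \<eta>'_def using T by (auto intro!: derivative_eq_intros)
    have cont: "continuous_on UNIV \<eta>'"
      unfolding \<eta>'_def using T by (auto intro!: continuous_intros)
    have \<eta>T: "\<eta> T = 0" and \<eta>0: "\<eta> 0 = 1" using T k0 by (auto simp: \<eta>_def)
    let ?f = "\<lambda>q. indicator {0<..<T} (fst q) * (norm (snd q) powr (- \<alpha>) * \<bar>apply_bcontfun (u (fst q)) (snd q)\<bar> powr p)"
    let ?A = "\<lambda>q. indicator {0<..<T} (fst q) * (\<eta> (fst q) * \<Lambda>R (snd q) - \<eta>' (fst q) * \<psi> (snd q))"
    have weak: "integrable lborel (\<lambda>q. ?f q * (\<eta> (fst q) * \<psi> (snd q)))"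
      "integrable lborel (\<lambda>q. ?A q * apply_bcontfun (u (fst q)) (snd q))"
      "(\<integral>q. ?f q * (\<eta> (fst q) * \<psi> (snd q)) \<partial>lborel) + \<eta> 0 * (\<integral>x. apply_bcontfun u0 x * \<psi> x \<partial>lborel)
      = (\<integral>q. ?A q * apply_bcontfun (u (fst q)) (snd q) \<partial>lborel)"
      using mild_solution_tested[OF sol _ _ _ der cont \<eta>T T] \<alpha> p by auto
    define d where "d = (\<lambda>x. R powr (- (2 * real m)) * (R powr (\<alpha> - 2 * real m)) powr \<beta> * J (x /\<^sub>R R))"
    have d0: "d x \<ge> 0" for x using J0 by (simp add: d_def)
    have pointwise: "?A (s, x) * apply_bcontfun (u s) x - ?f (s, x) * (\<eta> s * \<psi> x) \<le> indicator {0<..<T} s * d x"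
      if x: "x \<noteq> 0" for s x
    proof (cases "s \<in> {0<..<T}")
      case True
      define v where "v = \<bar>apply_bcontfun (u s) x\<bar>"
      define \<theta> where "\<theta> = 1 - s / T"
      have \<theta>: "0 < \<theta>" "\<theta> < 1" using True T by (auto simp: \<theta>_def)
      \<comment> \<open>\<open>r = \<eta>\<^sup>1\<^sup>/\<^sup>p\<close>; applying Young's inequality to \<open>r |u|\<close> makes the error independent of the time \<open>s\<close>.\<close>
      define r where "r = \<theta> powr (real k / p)"
      have r: "\<eta> s = r powr p" "\<eta> s \<le> r" "\<theta> ^ (k - 1) \<le> r" "r \<ge> 0"
      proof -
        show "\<eta> s = r powr p" using \<theta> p by (simp add: \<eta>_def r_def powr_powr powr_realpow flip: \<theta>_def)
        have "\<theta> ^ (k - 1) = \<theta> powr real (k - 1)" using \<theta> by (simp add: powr_realpow)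
        also have "\<dots> \<le> r" unfolding r_def using k1 \<theta> by (intro powr_mono') auto
        finally show r1: "\<theta> ^ (k - 1) \<le> r" .
        have "\<eta> s \<le> \<theta> ^ (k - 1)" unfolding \<eta>_def \<theta>_def[symmetric]
          using \<theta> by (intro power_decreasing) auto
        with r1 show "\<eta> s \<le> r" by linarith
        show "r \<ge> 0" by (simp add: r_def)
      qed
      let ?z = "x /\<^sub>R R"
      define b where "b = h ?z * \<psi> x / T"
      have \<psi>: "\<psi> x > 0" by (simp add: \<psi>_def)
      have b: "b \<ge> 0" unfolding b_def using h[of ?z] \<psi> T by simp
      have "\<bar>\<eta> s * \<Lambda>R x - \<eta>' s * \<psi> x\<bar> \<le> \<eta> s * \<bar>\<Lambda>R x\<bar> + \<bar>\<eta>' s\<bar> * \<psi> x"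
        using abs_triangle_ineq4[of "\<eta> s * \<Lambda>R x" "\<eta>' s * \<psi> x"] \<psi> r(1) by (simp add: abs_mult)
      also have "\<dots> \<le> r * (C * (1 + (norm ?z)\<^sup>2) ^ N * \<psi> x / T) + r * (real k * \<psi> x / T)"
      proof (rule add_mono)
        have "\<bar>\<Lambda>R x\<bar> \<le> C * (1 + (norm ?z)\<^sup>2) ^ N * \<psi> x / T"
          using \<Lambda>(4)[of ?z] R by (simp add: \<Lambda>R_def T_def \<psi>_def divide_right_mono)
        then show "\<eta> s * \<bar>\<Lambda>R x\<bar> \<le> r * (C * (1 + (norm ?z)\<^sup>2) ^ N * \<psi> x / T)"
          using r by (intro mult_mono) auto
        have "\<bar>\<eta>' s\<bar> = \<theta> ^ (k - 1) * (real k / T)"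
          using \<theta> T by (simp add: \<eta>'_def abs_mult power_abs flip: \<theta>_def)
        then have "\<bar>\<eta>' s\<bar> * \<psi> x = \<theta> ^ (k - 1) * (real k * \<psi> x / T)" by simp
        also have "\<dots> \<le> r * (real k * \<psi> x / T)"
          using r \<psi> T by (intro mult_right_mono) auto
        finally show "\<bar>\<eta>' s\<bar> * \<psi> x \<le> r * (real k * \<psi> x / T)" .
      qed
      also have "\<dots> \<le> r * b"
      proof -
        have "1 \<le> (1 + (norm ?z)\<^sup>2) ^ N" by (intro one_le_power) auto
        then have "C * (1 + (norm ?z)\<^sup>2) ^ N + real k \<le> h ?z"
          using mult_left_mono[of 1 "(1 + (norm ?z)\<^sup>2) ^ N" "real k"] by (simp add: h_def distrib_right)
        then have "(C * (1 + (norm ?z)\<^sup>2) ^ N + real k) * (\<psi> x / T) \<le> h ?z * (\<psi> x / T)"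
          using \<psi> T by (intro mult_right_mono) auto
        then have "C * (1 + (norm ?z)\<^sup>2) ^ N * \<psi> x / T + real k * \<psi> x / T \<le> b"
          by (simp only: b_def distrib_right times_divide_eq_right add_divide_distrib)
        then show ?thesis unfolding distrib_left[symmetric] using r(4) by (rule mult_left_mono)
      qed
      finally have a: "\<bar>\<eta> s * \<Lambda>R x - \<eta>' s * \<psi> x\<bar> \<le> r * b" .
      have "?A (s, x) * apply_bcontfun (u s) x \<le> \<bar>\<eta> s * \<Lambda>R x - \<eta>' s * \<psi> x\<bar> * v"
        using True by (simp add: v_def flip: abs_mult)
      also have "\<dots> \<le> b * (r * v)"
        using mult_right_mono[OF a, of v] by (simp add: v_def mult_ac)
      also have "\<dots> \<le> (norm x powr (- \<alpha>) * \<psi> x) * (r * v) powr p + b * (b / (norm x powr (- \<alpha>) * \<psi> x)) powr \<beta>"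
        unfolding \<beta>_def using p b \<psi> x r by (intro young_threshold) (auto simp: v_def)
      also have "(norm x powr (- \<alpha>) * \<psi> x) * (r * v) powr p = ?f (s, x) * (\<eta> s * \<psi> x)"
        using True r by (simp add: v_def powr_mult)
      also have "b * (b / (norm x powr (- \<alpha>) * \<psi> x)) powr \<beta> = d x"
      proof -
        have TR: "R powr (2 * real m) = T"
          using R powr_realpow[OF R, of "2 * m"] by (simp add: T_def)
        have "norm x powr \<alpha> = (R * norm ?z) powr \<alpha>"
          using R by (intro arg_cong[where f="\<lambda>t. t powr \<alpha>"]) simp
        also have "\<dots> = R powr \<alpha> * norm ?z powr \<alpha>" by (rule powr_mult)
        finally have nx: "norm x powr \<alpha> = R powr \<alpha> * norm ?z powr \<alpha>" .
        have "b / (norm x powr (- \<alpha>) * \<psi> x) = h ?z * norm x powr \<alpha> / T"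
          using \<psi> x by (simp add: b_def powr_minus field_simps)
        then have "b / (norm x powr (- \<alpha>) * \<psi> x) = R powr (\<alpha> - 2 * real m) * (h ?z * norm ?z powr \<alpha>)"
          by (simp add: nx powr_diff TR)
        then have "(b / (norm x powr (- \<alpha>) * \<psi> x)) powr \<beta>
           = (R powr (\<alpha> - 2 * real m)) powr \<beta> * (h ?z * norm ?z powr \<alpha>) powr \<beta>"
          by (simp only: powr_mult)
        moreover have "b = R powr (- (2 * real m)) * (h ?z * \<psi> x)"
          unfolding powr_minus TR by (simp add: b_def divide_inverse mult_ac)
        ultimately show ?thesis by (simp add: d_def J_def \<psi>_def mult_ac)
      qed
      finally show ?thesis using True by simp
    qed simp
    have Jz: "integrable lborel (\<lambda>x. J (x /\<^sub>R R))"
      using lborel_affine_integrable_iff[of "inverse R" J 0] R Ji by simp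
    then have di: "integrable lborel d" unfolding d_def by simp
    have id: "integrable lborel (\<lambda>q. indicator {0<..<T} (fst q) * d (snd q))"
      using integrable_lborel_pair_mult[of "indicator {0<..<T} :: real \<Rightarrow> real" d] di T
      by (simp add: lborel_prod case_prod_beta')
    have "(\<integral>x. apply_bcontfun u0 x * \<psi> x \<partial>lborel)
      = (\<integral>q. ?A q * apply_bcontfun (u (fst q)) (snd q) - ?f q * (\<eta> (fst q) * \<psi> (snd q)) \<partial>lborel)"
      using weak \<eta>0 by simp
    also have "\<dots> \<le> (\<integral>q. indicator {0<..<T} (fst q) * d (snd q) \<partial>lborel)"
    proof (rule integral_mono_AE)
      \<comment> \<open>At the origin the weight has the value \<open>0\<close> and absorbs nothing, so the pointwise bound excludes it.\<close>
      have "AE q in (lborel :: real measure) \<Otimes>\<^sub>M lborel. (snd q :: real ^ 'n) \<noteq> 0"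
      proof (rule lborel_pair.AE_pair_measure)
        show "{q \<in> space ((lborel :: real measure) \<Otimes>\<^sub>M lborel). (snd q :: real ^ 'n) \<noteq> 0}
            \<in> sets (lborel \<Otimes>\<^sub>M lborel)"
          by measurable
      qed (simp add: AE_lborel_singleton)
      then have "AE q in (lborel :: (real \<times> (real ^ 'n)) measure). snd q \<noteq> 0" unfolding lborel_prod .
      then show "AE q in lborel. ?A q * apply_bcontfun (u (fst q)) (snd q) - ?f q * (\<eta> (fst q) * \<psi> (snd q))
         \<le> indicator {0<..<T} (fst q) * d (snd q)"
      proof eventually_elim
        case (elim q)
        then show ?case using pointwise[of "snd q" "fst q"] by simp
      qed
    qed (use weak id in auto)
    also have "\<dots> = T * (\<integral>x. d x \<partial>lborel)"
    proof -
      have "(\<integral>q. indicator {0<..<T} (fst q) * d (snd q) \<partial>lborel)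
        = (\<integral>s. (\<integral>x. indicator {0<..<T} s * d x \<partial>lborel) \<partial>lborel)"
        using lborel_pair.integral_fst'[of "\<lambda>q. indicator {0<..<T} (fst q) * d (snd q)"] id by (simp add: lborel_prod)
      also have "\<dots> = T * (\<integral>x. d x \<partial>lborel)" using T by simp
      finally show ?thesis .
    qed
    also have "(\<integral>x. d x \<partial>lborel) = R powr (- (2 * real m)) * (R powr (\<alpha> - 2 * real m)) powr \<beta> * (R ^ CARD('n) * I)"
      using lborel_affine_integral[of "inverse R" J 0] R
      by (simp add: d_def I_def power_inverse field_simps)
    also have "T * \<dots> = R powr (- \<gamma>) * I"
    proof -
      have "T = R powr (2 * real m)" "R ^ CARD('n) = R powr real CARD('n)"
        using R by (simp_all add: T_def flip: powr_realpow)
      then have "T * (R powr (- (2 * real m)) * (R powr (\<alpha> - 2 * real m)) powr \<beta> * (R ^ CARD('n) * I))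
        = (R powr (2 * real m) * R powr (- (2 * real m)) * (R powr (\<alpha> - 2 * real m)) powr \<beta> * R powr real CARD('n)) * I"
        by simp
      also have "R powr (2 * real m) * R powr (- (2 * real m)) * (R powr (\<alpha> - 2 * real m)) powr \<beta> * R powr real CARD('n)
        = R powr (- \<gamma>)"
        unfolding powr_powr powr_add[symmetric] by (simp add: \<gamma>_def algebra_simps)
      finally show ?thesis .
    qed
    finally show ?thesis by (simp add: \<psi>_def)
  qed
  have "(\<lambda>i. \<integral>x. apply_bcontfun u0 x * exp (- (norm (x /\<^sub>R real (Suc i)))\<^sup>2 / 2) \<partial>lborel)
     \<longlonglongrightarrow> (\<integral>x. apply_bcontfun u0 x \<partial>lborel)"
  proof (rule integral_dominated_convergence[where w="\<lambda>x. \<bar>apply_bcontfun u0 x\<bar>"])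
    have [measurable]: "apply_bcontfun u0 \<in> borel_measurable borel"
      using borel_measurable_integrable[OF assms(6)] by simp
    show "apply_bcontfun u0 \<in> borel_measurable lborel" by measurable
    show "(\<lambda>x. apply_bcontfun u0 x * exp (- (norm (x /\<^sub>R real (Suc i)))\<^sup>2 / 2)) \<in> borel_measurable lborel" for i
      by measurable
    show "integrable lborel (\<lambda>x. \<bar>apply_bcontfun u0 x\<bar>)" using assms(6) by simp
    show "AE x in lborel. norm (apply_bcontfun u0 x * exp (- (norm (x /\<^sub>R real (Suc i)))\<^sup>2 / 2)) \<le> \<bar>apply_bcontfun u0 x\<bar>" for i
      by (intro AE_I2) (auto simp: abs_mult intro!: mult_left_le)
    show "AE x in lborel. (\<lambda>i. apply_bcontfun u0 x * exp (- (norm (x /\<^sub>R real (Suc i)))\<^sup>2 / 2)) \<longlonglongrightarrow> apply_bcontfun u0 x"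
    proof (rule AE_I2)
      fix x :: "real ^ 'n"
      have "(\<lambda>i. inverse (real (Suc i)) *\<^sub>R x) \<longlonglongrightarrow> 0 *\<^sub>R x"
        by (intro tendsto_scaleR tendsto_const LIMSEQ_inverse_real_of_nat)
      moreover have "(\<lambda>i. apply_bcontfun u0 x * exp (- (norm (z i))\<^sup>2 / 2))
         \<longlonglongrightarrow> apply_bcontfun u0 x * exp (- (norm l)\<^sup>2 / 2)" if "z \<longlonglongrightarrow> l" for z and l :: "real ^ 'n"
        by (intro tendsto_intros that) auto
      ultimately have "(\<lambda>i. apply_bcontfun u0 x * exp (- (norm (inverse (real (Suc i)) *\<^sub>R x))\<^sup>2 / 2))
         \<longlonglongrightarrow> apply_bcontfun u0 x * exp (- (norm (0 *\<^sub>R x))\<^sup>2 / 2)"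
        by blast
      then show "(\<lambda>i. apply_bcontfun u0 x * exp (- (norm (x /\<^sub>R real (Suc i)))\<^sup>2 / 2)) \<longlonglongrightarrow> apply_bcontfun u0 x"
        by simp
    qed
  qed
  moreover have "(\<lambda>i. real (Suc i) powr (- \<gamma>) * I) \<longlonglongrightarrow> 0 * I"
  proof (intro tendsto_mult tendsto_const)
    have "filterlim (\<lambda>i. real (Suc i)) at_top sequentially"
      by (rule filterlim_compose[OF filterlim_real_sequentially filterlim_Suc])
    then show "(\<lambda>i. real (Suc i) powr (- \<gamma>)) \<longlonglongrightarrow> 0"
      using \<gamma> by (intro tendsto_neg_powr) auto
  qed
  ultimately have "(\<integral>x. apply_bcontfun u0 x \<partial>lborel) \<le> 0 * I"
    by (rule LIMSEQ_le) (use key in auto)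
  then show False using assms(7) by simp
qed

end
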